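(* Let $\mathcal J:\mathcal P_2(\mathbb R^d)\to(-\infty,+\infty]$ be a proper lower semi-continuous functional which has at least one global minimiser, and set $\hat{\mathcal J}=\min_{\mathcal P_2(\mathbb R^d)}\mathcal J$. Fix $r_0\in(\hat{\mathcal J},+\infty]$ and $\theta\in(0,1]$. Consider the two properties: (LG) (Łojasiewicz gradient property) there exists $c_g>0$ such that for all $\rho\in\mathcal P_2(\mathbb R^d)$ with $\hat{\mathcal J}<\mathcal J[\rho]<r_0$ and all $\nu\in\partial\mathcal J[\rho]$, $$c_g\,(\mathcal J[\rho]-\hat{\mathcal J})^{1-\theta}\le\|\nu\|_\rho ;$$ (LF) (functional Łojasiewicz inequality) there exists $c_f>0$ such that for all $\rho\in\mathcal P_2(\mathbb R^d)$ with $\hat{\mathcal J}<\mathcal J[\rho]<r_0$, $$c_f\,\mathcal W_2(\rho,\operatorname{Argmin}\mathcal J)^{1/\theta}\le\mathcal J[\rho]-\hat{\mathcal J}.$$ Then: (i) If $\mathcal J$ is $\lambda$-convex along generalised geodesics for some $\lambda\in\mathbb R$, then (LG) implies (LF). (ii) If $\mathcal J$ is convex along generalised geodesics, then (LG) and (LF) are equivalent.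
   Context: $\mathcal P_2(\mathbb R^d)$ is the set of Borel probability measures on $\mathbb R^d$ with finite second moment, equipped with the Monge-Kantorovich (2-Wasserstein) distance $$\mathcal W_2^2(\mu,\nu)=\min_{\gamma\in\Pi(\mu,\nu)}\iint|x-y|^2\,d\gamma(x,y),$$ where $\Pi(\mu,\nu)$ is the set of couplings of $\mu$ and $\nu$; $\Gamma_{\rm opt}(\mu,\nu)$ denotes the set of optimal couplings. Lower semi-continuity is with respect to $\mathcal W_2$. For a set $\mathcal S\subset\mathcal P_2(\mathbb R^d)$, $\mathcal W_2(\mu,\mathcal S)=\inf_{\nu\in\mathcal S}\mathcal W_2(\mu,\nu)$. $\operatorname{dom}\mathcal J=\{\mathcal J<+\infty\}$, and $\mathcal J$ is proper if $\operatorname{dom}\mathcal J\ne\emptyset$. $\operatorname{Argmin}\mathcal J$ is the set of global minimisers of $\mathcal J$. Generalised geodesics and $\lambda$-convexity: let $\rho,\nu_0,\nu_1\in\mathcal P_2(\mathbb R^d)$ and let $\Psi$ be a probability measure on $(\mathbb R^d)^3$ with marginals $\rho,\nu_0,\nu_1$ such that its image under $(x,y,z)\mapsto(x,y)$ is in $\Gamma_{\rm opt}(\rho,\nu_0)$ and its image under $(x,y,z)\mapsto(x,z)$ is in $\Gamma_{\rm opt}(\rho,\nu_1)$. The generalised geodesic from $\nu_0$ to $\nu_1$ with base $\rho$ induced by $\Psi$ is $\nu_t=(\pi^t)_\#\Psi$, $t\in[0,1]$, with $\pi^t(x,y,z)=(1-t)y+tz$. For $\lambda\in\mathbb R$, $\mathcal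 J$ is $\lambda$-convex along generalised geodesics if for all $\nu_0,\nu_1\in\operatorname{dom}\mathcal J$, every base $\rho$ and every generalised geodesic $(\nu_t)$ with base $\rho$ induced by such a $\Psi$, $$\mathcal J[\nu_t]\le(1-t)\mathcal J[\nu_0]+t\mathcal J[\nu_1]-\frac{\lambda}{2}\iiint|x_3-x_2|^2\,d\Psi(x_1,x_2,x_3)\quad\text{for all }t\in[0,1],$$ up to the usual factor convention exactly as written here. $\mathcal J$ is convex along generalised geodesics if, for all such $\nu_0,\nu_1$ and all generalised geodesics, $\mathcal J[\nu_t]\le(1-t)\mathcal J[\nu_0]+t\mathcal J[\nu_1]$ for every $t\in[0,1]$. Subdifferential: for a $\lambda$-convex lower semi-continuous functional $\mathcal J$ bounded from below ($\lambda=0$ in the convex case), $\mu\in\operatorname{dom}\mathcal J$ and $\gamma\in L^2_\mu(\mathbb R^d;\mathbb R^d)$, one has $\gamma\in\partial\mathcal J[\mu]$ iff for every $\nu\in\mathcal P_2(\mathbb R^d)$ there exists $\Psi\in\Gamma_{\rm opt}(\mu,\nu)$ with $$\mathcal J[\nu]\ge\mathcal J[\mu]+\int\gamma(x)\cdot(y-x)\,d\Psi(x,y)+\frac\lambda2\mathcal W_2^2(\mu,\nu).$$ If $\mu\notin\operatorname{dom}\mathcal J$ then $\partial\mathcal J[\mu]=\emptyset$. $\|\cdot\|_\rho$ is the norm of $L^2_\rho(\mathbb R^d;\mathbb R^d)$.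
   Formalization: λ-convexity along generalised geodesics is taken with the standard term −(λ/2) t(1−t)∭|x₃−x₂|²dΨ; with the displayed term lacking t(1−t), part (i) fails for λ<0, and for λ≥0 nothing is lost. *)

theory Defs
  imports "HOL-Probability.Probability"
begin

text \<open>
  The space \<open>R^d\<close> is an arbitrary type of class \<open>euclidean_space\<close>.  Functionals on the Wasserstein
  space are total functions on \<open>'a measure\<close>, of which only the restriction to \<open>P2\<close> is ever used.
\<close>

definition P2 :: "'a::euclidean_space measure set" where
  "P2 = {\<mu>. prob_space \<mu> \<and> sets \<mu> = sets borel \<and> integrable \<mu> (\<lambda>x. (norm x)\<^sup>2)}"

definition couplings ::
  "'a::euclidean_space measure \<Rightarrow> 'a measure \<Rightarrow> ('a \<times> 'a) measure set" where
  "couplings \<mu> \<nu> = {\<gamma>. prob_space \<gamma> \<and> sets \<gamma> = sets borel \<and>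
     distr \<gamma> borel fst = \<mu> \<and> distr \<gamma> borel snd = \<nu>}"

text \<open>For couplings of two elements of \<open>P2\<close> the integrand below is integrable, so the Bochner
  integral is the true transport cost.\<close>

definition transport_cost :: "('a::euclidean_space \<times> 'a) measure \<Rightarrow> real" where
  "transport_cost \<gamma> = (\<integral>p. (norm (fst p - snd p))\<^sup>2 \<partial>\<gamma>)"

definition W2 :: "'a::euclidean_space measure \<Rightarrow> 'a measure \<Rightarrow> real" where
  "W2 \<mu> \<nu> = sqrt (INF \<gamma>\<in>couplings \<mu> \<nu>. transport_cost \<gamma>)"

definition opt_couplings ::
  "'a::euclidean_space measure \<Rightarrow> 'a measure \<Rightarrow> ('a \<times> 'a) measure set" where
  "opt_couplings \<mu> \<nu> = {\<gamma> \<in> couplings \<mu> \<nu>. \<forall>\<gamma>'\<in>couplings \<mu> \<nu>. transport_cost \<gamma> \<le> transport_cost \<gamma>'}"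

definition W2_set :: "'a::euclidean_space measure \<Rightarrow> 'a measure set \<Rightarrow> real" where
  "W2_set \<mu> S = (INF \<nu>\<in>S. W2 \<mu> \<nu>)"

definition dom_J :: "('a::euclidean_space measure \<Rightarrow> ereal) \<Rightarrow> 'a measure set" where
  "dom_J J = {\<mu> \<in> P2. J \<mu> < \<infinity>}"

definition proper_J :: "('a::euclidean_space measure \<Rightarrow> ereal) \<Rightarrow> bool" where
  "proper_J J \<longleftrightarrow> dom_J J \<noteq> {}"

definition W2_lsc :: "('a::euclidean_space measure \<Rightarrow> ereal) \<Rightarrow> bool" where
  "W2_lsc J \<longleftrightarrow>
     (\<forall>\<mu>\<in>P2. \<forall>c. c < J \<mu> \<longrightarrow> (\<exists>\<delta>>0. \<forall>\<nu>\<in>P2. W2 \<mu> \<nu> < \<delta> \<longrightarrow> c < J \<nu>))"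

definition Argmin :: "('a::euclidean_space measure \<Rightarrow> ereal) \<Rightarrow> 'a measure set" where
  "Argmin J = {\<mu> \<in> P2. \<forall>\<nu>\<in>P2. J \<mu> \<le> J \<nu>}"

definition min_J :: "('a::euclidean_space measure \<Rightarrow> ereal) \<Rightarrow> ereal" where
  "min_J J = (INF \<mu>\<in>P2. J \<mu>)"

definition geodesic_plans ::
  "'a::euclidean_space measure \<Rightarrow> 'a measure \<Rightarrow> 'a measure \<Rightarrow> ('a \<times> 'a \<times> 'a) measure set" where
  "geodesic_plans \<rho> \<nu>0 \<nu>1 = {\<Psi>. prob_space \<Psi> \<and> sets \<Psi> = sets borel \<and>
     distr \<Psi> borel (\<lambda>(x, y, z). x) = \<rho> \<and>
     distr \<Psi> borel (\<lambda>(x, y, z). y) = \<nu>0 \<and>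
     distr \<Psi> borel (\<lambda>(x, y, z). z) = \<nu>1 \<and>
     distr \<Psi> borel (\<lambda>(x, y, z). (x, y)) \<in> opt_couplings \<rho> \<nu>0 \<and>
     distr \<Psi> borel (\<lambda>(x, y, z). (x, z)) \<in> opt_couplings \<rho> \<nu>1}"

definition gen_geodesic :: "('a::euclidean_space \<times> 'a \<times> 'a) measure \<Rightarrow> real \<Rightarrow> 'a measure" where
  "gen_geodesic \<Psi> t = distr \<Psi> borel (\<lambda>(x, y, z). (1 - t) *\<^sub>R y + t *\<^sub>R z)"

text \<open>
  The modulus term carries the usual factor \<open>t * (1 - t)\<close>, which is the one matching the term
  \<open>l / 2 * (W2 \<mu> \<nu>)\<^sup>2\<close> in the subdifferential.  Without that factor the inequality
  at \<open>t = 0\<close> would force \<open>dom_J J\<close> to be a singleton when \<open>l > 0\<close>, and for \<open>l < 0\<close> it would only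
  give convexity with modulus \<open>4 * l\<close>, for which the subdifferential of modulus \<open>l\<close> may be empty at
  every point that is not a minimiser.
\<close>

definition lambda_convex_gg :: "real \<Rightarrow> ('a::euclidean_space measure \<Rightarrow> ereal) \<Rightarrow> bool" where
  "lambda_convex_gg l J \<longleftrightarrow>
     (\<forall>\<nu>0\<in>dom_J J. \<forall>\<nu>1\<in>dom_J J. \<forall>\<rho>\<in>P2. \<forall>\<Psi>\<in>geodesic_plans \<rho> \<nu>0 \<nu>1. \<forall>t\<in>{0..1}.
        J (gen_geodesic \<Psi> t) \<le> ereal (1 - t) * J \<nu>0 + ereal t * J \<nu>1
          - ereal (l / 2 * t * (1 - t) * (\<integral>p. (case p of (x, y, z) \<Rightarrow> (norm (z - y))\<^sup>2) \<partial>\<Psi>)))"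

definition convex_gg :: "('a::euclidean_space measure \<Rightarrow> ereal) \<Rightarrow> bool" where
  "convex_gg J \<longleftrightarrow>
     (\<forall>\<nu>0\<in>dom_J J. \<forall>\<nu>1\<in>dom_J J. \<forall>\<rho>\<in>P2. \<forall>\<Psi>\<in>geodesic_plans \<rho> \<nu>0 \<nu>1. \<forall>t\<in>{0..1}.
        J (gen_geodesic \<Psi> t) \<le> ereal (1 - t) * J \<nu>0 + ereal t * J \<nu>1)"

text \<open>Elements of \<open>L\<^sup>2\<close> are represented by Borel functions rather than by classes.\<close>

definition L2_fields :: "'a::euclidean_space measure \<Rightarrow> ('a \<Rightarrow> 'a) set" where
  "L2_fields \<mu> = {g \<in> borel_measurable \<mu>. integrable \<mu> (\<lambda>x. (norm (g x))\<^sup>2)}"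

definition L2_norm :: "'a::euclidean_space measure \<Rightarrow> ('a \<Rightarrow> 'a) \<Rightarrow> real" where
  "L2_norm \<mu> g = sqrt (\<integral>x. (norm (g x))\<^sup>2 \<partial>\<mu>)"

text \<open>The parameter \<open>l\<close> is the modulus of convexity of \<open>J\<close>.\<close>

definition subdiff ::
  "real \<Rightarrow> ('a::euclidean_space measure \<Rightarrow> ereal) \<Rightarrow> 'a measure \<Rightarrow> ('a \<Rightarrow> 'a) set" where
  "subdiff l J \<mu> = {g \<in> L2_fields \<mu>. \<mu> \<in> dom_J J \<and>
     (\<forall>\<nu>\<in>P2. \<exists>\<Psi>\<in>opt_couplings \<mu> \<nu>.
        J \<nu> \<ge> J \<mu> + ereal (\<integral>p. g (fst p) \<bullet> (snd p - fst p) \<partial>\<Psi>) + ereal (l / 2 * (W2 \<mu> \<nu>)\<^sup>2))}"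

text \<open>In both properties \<open>J \<rho> - min_J J\<close> is a positive real number, so \<open>real_of_ereal\<close> is harmless
  and \<open>powr\<close> with exponent \<open>0\<close> yields \<open>1\<close>.\<close>

definition Lojasiewicz_gradient ::
  "real \<Rightarrow> ('a::euclidean_space measure \<Rightarrow> ereal) \<Rightarrow> ereal \<Rightarrow> real \<Rightarrow> bool" where
  "Lojasiewicz_gradient l J r0 \<theta> \<longleftrightarrow>
     (\<exists>c>0. \<forall>\<rho>\<in>P2. min_J J < J \<rho> \<and> J \<rho> < r0 \<longrightarrow>
        (\<forall>\<nu>\<in>subdiff l J \<rho>. c * real_of_ereal (J \<rho> - min_J J) powr (1 - \<theta>) \<le> L2_norm \<rho> \<nu>))"

definition Lojasiewicz_functional ::
  "('a::euclidean_space measure \<Rightarrow> ereal) \<Rightarrow> ereal \<Rightarrow> real \<Rightarrow> bool" where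
  "Lojasiewicz_functional J r0 \<theta> \<longleftrightarrow>
     (\<exists>c>0. \<forall>\<rho>\<in>P2. min_J J < J \<rho> \<and> J \<rho> < r0 \<longrightarrow>
        c * W2_set \<rho> (Argmin J) powr (1 / \<theta>) \<le> real_of_ereal (J \<rho> - min_J J))"

end

theory Submission
  imports Defs
begin

text \<open>
  If (LF) holds and \<open>g\<close> is a subgradient at \<open>\<rho>\<close>, testing the subdifferential inequality with the
  minimisers gives \<open>J \<rho> - min J \<le> \<parallel>g\<parallel> W2 \<rho> (Argmin J)\<close>, and (LG) follows.

  Conversely, let \<open>m\<close> minimise \<open>J + (W2 \<mu>)\<^sup>2 / (2 \<tau>)\<close>. Convexity along geodesics issuing from \<open>m\<close> shows that
  \<open>1 / \<tau>\<close> times the barycentric projection of the optimal displacement from \<open>m\<close> to \<open>\<mu>\<close> is a subgradient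
  at \<open>m\<close>, of norm at most \<open>W2 \<mu> m / \<tau>\<close>. For small \<open>\<tau>\<close>, (LG) at \<open>m\<close> turns this into
  \<open>\<psi> m + \<kappa> W2 \<mu> m \<le> \<psi> \<mu>\<close> with \<open>\<psi> = (J - min J) powr \<theta>\<close>. So a point that is critical in the sense of
  Ekeland's principle for \<open>\<psi>\<close> is a minimiser, and the principle, started at \<open>\<rho>\<close>, yields a minimiser
  at distance at most \<open>\<psi> \<rho> / \<kappa>\<close>; this is (LF).

  Existence of \<open>m\<close> and Ekeland's principle need completeness of \<open>P2\<close>. Everything about couplings rests
  on writing a coupling as the law of \<open>(X, f(X, U))\<close> with independent uniform noise \<open>U\<close>. Since the
  marginals are fixed, optimal couplings exist by a compactness argument without topology on measures:
  the masses of all rectangles converge along a filter, the limit is again realised by some \<open>f\<close>, and the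
  cost is approximated by simple functions uniformly over all couplings.
\<close>

subsection \<open>Realisation of bimeasures by random variables\<close>

text \<open>By the chain rule, the slope of \<open>(J - min J) powr \<theta>\<close> is formally
  \<theta> times \<open>(J - min J) powr (\<theta> - 1)\<close> times the slope of \<open>J\<close>,
  so (LG) bounds it below by \<open>\<theta> * c\<close> away from the minimisers, and a function
  with such a slope should reach its minimum within a distance proportional to its value. A gradient
  flow would show this but has to be constructed; Ekeland's principle asks only for one descending
  step from every non-minimal point. The discrete step loses two factors 2, hence \<kappa> is
  \<open>\<theta> * c / 4\<close>: a proximal step lowers the energy by half of slope times length,
  and the gap at its end point is only known to exceed half the gap at its start. The base of the
  generalised geodesics matters twice. With base \<mu> the squared distance to \<mu> is as convex as
  in a Hilbert space, which gives existence of \<open>m\<close>; with base \<open>m\<close> one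
  differentiates at \<open>m\<close>. The optimal plan from \<open>m\<close> to \<mu> may split mass
  while a subgradient is a vector field. Averaging over the noise loses nothing, because the
  displacement is only paired with displacements that are conditionally independent of it.\<close>

lemma ternary_digit:
  fixes w :: "nat \<Rightarrow> bool"
  defines "t \<equiv> (\<Sum>k. of_bool (w k) * (1 / 3) ^ Suc k :: real)"
  shows "w n \<longleftrightarrow> \<lfloor>3 ^ Suc n * t\<rfloor> mod 3 = 1"
proof -
  define a where "a k = (of_bool (w k) * (1 / 3) ^ Suc k :: real)" for k
  have geo: "summable (\<lambda>k. (1 / 3) ^ k :: real)" by (rule summable_geometric) simp
  have s: "summable a"
    by (rule summable_comparison_test'[OF geo, of 0]) (auto simp: a_def)
  \<comment> \<open>\<open>r\<close> is the tail behind digit \<open>n\<close>. With digits 0 and 1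
    in base three it is at most 1/2 and cannot disturb the floor; in base two it could reach
    1.\<close>
  define r where "r = (\<Sum>k. of_bool (w (k + Suc n)) * (1 / 3) ^ Suc k :: real)"
  have sr: "summable (\<lambda>k. of_bool (w (k + Suc n)) * (1 / 3) ^ Suc k :: real)"
    by (rule summable_comparison_test'[OF geo, of 0]) auto
  have r0: "0 \<le> r" unfolding r_def by (rule suminf_nonneg[OF sr]) auto
  have "r \<le> (\<Sum>k. (1 / 3) ^ Suc k :: real)" unfolding r_def
    by (rule suminf_le[OF _ sr]) (use geo summable_mult[OF geo, of "1/3"] in auto)
  also have "\<dots> = 1 / 2"
    using suminf_mult[OF geo, of "1/3"] suminf_geometric[of "1/3::real"] by simp
  finally have r1: "r < 1" by simp
  have "t = (\<Sum>k. a (k + Suc n)) + (\<Sum>k<Suc n. a k)"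
    unfolding t_def a_def[symmetric] using suminf_split_initial_segment[OF s, of "Suc n"] by simp
  also have "(\<Sum>k. a (k + Suc n)) = (1 / 3) ^ Suc n * r"
    unfolding r_def by (subst suminf_mult[OF sr, symmetric]) (simp add: a_def power_add mult_ac)
  finally have t: "3 ^ Suc n * t = r + of_bool (w n) + 3 ^ Suc n * (\<Sum>k<n. a k)"
    by (simp add: algebra_simps a_def power_divide)
  have "3 ^ Suc n * (\<Sum>k<n. a k) = real_of_int (3 * (\<Sum>k<n. of_bool (w k) * 3 ^ (n - Suc k)))"
  proof -
    have "3 ^ n * a k = of_bool (w k) * 3 ^ (n - Suc k)" if "k < n" for k
      using that by (simp add: a_def power_divide power_diff)
    then have "3 * (\<Sum>k<n. 3 ^ n * a k) = 3 * (\<Sum>k<n. of_bool (w k) * 3 ^ (n - Suc k))"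
      by (intro arg_cong[of _ _ "(*) 3"] sum.cong) auto
    then show ?thesis by (simp only: sum_distrib_left[symmetric] power_Suc mult.assoc) (simp add: of_int_sum)
  qed
  with t have "3 ^ Suc n * t = r + real_of_int (of_bool (w n) + 3 * (\<Sum>k<n. of_bool (w k) * 3 ^ (n - Suc k)))"
    by simp
  then have "\<lfloor>3 ^ Suc n * t\<rfloor> = of_bool (w n) + 3 * (\<Sum>k<n. of_bool (w k) * 3 ^ (n - Suc k))"
    using r0 r1 by (simp add: floor_unique)
  then have "\<lfloor>3 ^ Suc n * t\<rfloor> mod 3 = of_bool (w n) mod 3" by simp
  then show ?thesis by simp
qed

text \<open>Reduces conditional laws on the Euclidean space to conditional distribution functions on
  the line. The bits of \<open>e x\<close> record which balls of radius \<open>1 / Suc m\<close>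
  around a countable dense set contain \<open>x\<close>; for each \<open>m\<close> the decoder takes
  the first centre whose bit is set, and \<open>r\<close> is the limit of these centres.\<close>

lemma borel_retract_of_unit_interval:
  obtains e :: "'a::euclidean_space \<Rightarrow> real" and r :: "real \<Rightarrow> 'a"
  where "e \<in> borel_measurable borel" "r \<in> borel_measurable borel"
    "\<And>x. r (e x) = x" "\<And>x. 0 \<le> e x" "\<And>x. e x < 1"
proof -
  obtain D :: "'a set" where D: "countable D" "\<And>X. open X \<Longrightarrow> X \<noteq> {} \<Longrightarrow> \<exists>d\<in>D. d \<in> X"
    using countable_dense_exists[where 'a='a] by blast
  define q where "q = from_nat_into D"
  have Dne: "D \<noteq> {}" using D(2)[of UNIV] by auto
  have q: "\<exists>k. dist x (q k) < 1 / Suc m" for x m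
  proof -
    obtain d where "d \<in> D" "d \<in> ball x (1 / Suc m)" using D(2)[of "ball x (1 / Suc m)"] by auto
    then show ?thesis using from_nat_into_surj[OF D(1)] by (auto simp: q_def)
  qed
  define w where "w x n = (case prod_decode n of (k, m) \<Rightarrow> dist x (q k) < 1 / Suc m)" for x n
  define e where "e x = (\<Sum>k. of_bool (w x k) * (1 / 3) ^ Suc k :: real)" for x
  define b where "b t n \<longleftrightarrow> \<lfloor>3 ^ Suc n * t\<rfloor> mod 3 = 1" for t :: real and n
  define g where "g t m = q (LEAST k. b t (prod_encode (k, m)))" for t m
  define r where "r t = lim (g t)" for t
  have [measurable]: "Measurable.pred borel (\<lambda>x. w x n)" for n
    unfolding w_def by (cases "prod_decode n") simp
  have e: "e \<in> borel_measurable borel" unfolding e_def by measurable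
  have [measurable]: "Measurable.pred borel (\<lambda>t. b t n)" for n unfolding b_def by measurable
  have [measurable]: "(\<lambda>t. g t m) \<in> borel_measurable borel" for m
  proof -
    have "(\<lambda>t. LEAST k. b t (prod_encode (k, m))) \<in> borel \<rightarrow>\<^sub>M count_space UNIV" by measurable
    then show ?thesis unfolding g_def by measurable
  qed
  have r: "r \<in> borel_measurable borel" unfolding r_def by measurable
  have re: "r (e x) = x" for x
  proof -
    have bw: "b (e x) n = w x n" for n unfolding b_def e_def using ternary_digit[of "w x" n] by simp
    have d: "dist (g (e x) m) x < 1 / Suc m" for m
    proof -
      have "\<exists>k. w x (prod_encode (k, m))" using q[of x m] by (simp add: w_def)
      from LeastI_ex[OF this] have "w x (prod_encode (LEAST k. w x (prod_encode (k, m)), m))" .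
      then show ?thesis by (simp add: g_def bw w_def dist_commute)
    qed
    have "(\<lambda>m. dist (g (e x) m) x) \<longlonglongrightarrow> 0"
    proof (rule tendsto_sandwich[OF _ _ tendsto_const])
      show "(\<lambda>m. 1 / real (Suc m)) \<longlonglongrightarrow> 0"
        using LIMSEQ_inverse_real_of_nat by (simp only: inverse_eq_divide)
      show "\<forall>\<^sub>F m in sequentially. dist (g (e x) m) x \<le> 1 / real (Suc m)"
        using d by (intro always_eventually allI less_imp_le)
      show "\<forall>\<^sub>F m in sequentially. 0 \<le> dist (g (e x) m) x" by simp
    qed
    then have "g (e x) \<longlonglongrightarrow> x" by (subst tendsto_dist_iff)
    then show ?thesis unfolding r_def by (rule limI)
  qed
  have geo: "summable (\<lambda>k. (1 / 3) ^ k :: real)" by (rule summable_geometric) simp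
  have sw: "summable (\<lambda>k. of_bool (w x k) * (1 / 3) ^ Suc k :: real)" for x
    by (rule summable_comparison_test'[OF geo, of 0]) auto
  have "e x \<le> (\<Sum>k. (1 / 3) ^ Suc k :: real)" for x unfolding e_def
    by (rule suminf_le[OF _ sw]) (use geo summable_mult[OF geo, of "1/3"] in auto)
  also have "(\<Sum>k. (1 / 3) ^ Suc k :: real) = 1 / 2"
    using suminf_mult[OF geo, of "1/3"] suminf_geometric[of "1/3::real"] by simp
  finally have "e x < 1" for x by (smt (verit) field_sum_of_halves)
  moreover have "0 \<le> e x" for x unfolding e_def by (rule suminf_nonneg[OF sw]) auto
  ultimately show ?thesis using that e r re by blast
qed

text \<open>Domination by a finite measure gives continuity at the empty set, which upgrades finite
  to countable additivity. Finite additivity and domination survive pointwise limits, and this is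
  how limits of couplings remain measures.\<close>

lemma dominated_additive_measure:
  fixes F :: "'a set \<Rightarrow> real"
  assumes "finite_measure N"
    and F: "\<And>A. A \<in> sets N \<Longrightarrow> 0 \<le> F A" "\<And>A. A \<in> sets N \<Longrightarrow> F A \<le> measure N A"
    and add: "\<And>A B. A \<in> sets N \<Longrightarrow> B \<in> sets N \<Longrightarrow> A \<inter> B = {} \<Longrightarrow> F (A \<union> B) = F A + F B"
  obtains N' where "sets N' = sets N" "space N' = space N" "\<And>A. A \<in> sets N \<Longrightarrow> emeasure N' A = ennreal (F A)"
proof -
  interpret finite_measure N by fact
  define f where "f A = ennreal (F A)" for A
  have F0: "F {} = 0" using F(1)[of "{}"] F(2)[of "{}"] by simp
  have pos: "positive (sets N) f" by (simp add: positive_def f_def F0)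
  have addf: "additive (sets N) f"
    by (auto simp: additive_def f_def add F(1) ennreal_plus)
  have ca: "countably_additive (sets N) f"
  proof (rule sets.empty_continuous_imp_countably_additive[OF pos addf])
    show "\<forall>A\<in>sets N. f A \<noteq> \<infinity>" by (simp add: f_def)
    fix A :: "nat \<Rightarrow> 'a set" assume A: "range A \<subseteq> sets N" "decseq A" "(\<Inter>i. A i) = {}"
    have "(\<lambda>i. measure N (A i)) \<longlonglongrightarrow> measure N (\<Inter>i. A i)"
      by (rule finite_Lim_measure_decseq[OF A(1,2)])
    then have "(\<lambda>i. measure N (A i)) \<longlonglongrightarrow> 0" using A by simp
    then have "(\<lambda>i. F (A i)) \<longlonglongrightarrow> 0"
      by (rule tendsto_sandwich[OF _ _ tendsto_const, rotated 2])
        (use A F in \<open>auto intro!: always_eventually\<close>)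
    then show "(\<lambda>i. f (A i)) \<longlonglongrightarrow> 0" unfolding f_def
      using tendsto_ennrealI by fastforce
  qed
  define N' where "N' = measure_of (space N) (sets N) f"
  show ?thesis
  proof (rule that[of N'])
    show "sets N' = sets N" "space N' = space N" by (simp_all add: N'_def)
    fix A assume "A \<in> sets N"
    then show "emeasure N' A = ennreal (F A)" unfolding N'_def
      by (subst emeasure_measure_of_sigma[OF sets.sigma_algebra_axioms pos ca]) (simp_all add: f_def)
  qed
qed

text \<open>If the set where \<open>g < f\<close> had positive mass, integrating over it would
  contradict the hypothesis; finiteness of the integral of \<open>g\<close> makes that comparison
  strict.\<close>

lemma AE_le_of_set_nn_integral_le:
  fixes f g :: "'a \<Rightarrow> ennreal"
  assumes [measurable]: "f \<in> borel_measurable M" "g \<in> borel_measurable M"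
    and le: "\<And>A. A \<in> sets M \<Longrightarrow> (\<integral>\<^sup>+x\<in>A. f x \<partial>M) \<le> (\<integral>\<^sup>+x\<in>A. g x \<partial>M)"
    and fin: "(\<integral>\<^sup>+x. g x \<partial>M) \<noteq> \<infinity>"
  shows "AE x in M. f x \<le> g x"
proof -
  define A where "A = {x \<in> space M. g x < f x}"
  have [measurable]: "A \<in> sets M" unfolding A_def by measurable
  have "AE x in M. f x * indicator A x \<le> g x * indicator A x"
  proof (rule ccontr)
    assume "\<not> (AE x in M. f x * indicator A x \<le> g x * indicator A x)"
    moreover have "(\<integral>\<^sup>+x\<in>A. g x \<partial>M) \<le> (\<integral>\<^sup>+x. g x \<partial>M)"
      by (intro nn_integral_mono) (simp split: split_indicator)
    then have "(\<integral>\<^sup>+x\<in>A. g x \<partial>M) \<noteq> \<infinity>" using fin neq_top_trans by auto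
    moreover have "AE x in M. g x * indicator A x \<le> f x * indicator A x"
      by (rule AE_I2) (auto simp: A_def split: split_indicator)
    ultimately have "(\<integral>\<^sup>+x\<in>A. g x \<partial>M) < (\<integral>\<^sup>+x\<in>A. f x \<partial>M)"
      by (intro nn_integral_less) auto
    with le[of A] show False by simp
  qed
  then show ?thesis
    by (rule AE_mp, intro AE_I2) (auto simp: A_def split: split_indicator_asm)
qed

section \<open>Uniform noise and bimeasures\<close>

definition unif :: "real measure" where
  "unif = uniform_measure lborel {0..1}"

lemma sets_unif [simp, measurable_cong]: "sets unif = sets borel"
  by (simp add: unif_def)

lemma space_unif [simp]: "space unif = UNIV"
  by (simp add: unif_def)

interpretation unif: prob_space unif
  unfolding unif_def by (rule prob_space_uniform_measure) auto

text \<open>Comparing a uniform level with \<open>h\<close> realises an event of probability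
  \<open>h\<close>. Negative levels, which \<open>ennreal\<close> sends to 0, lie outside the
  interval that carries \<open>unif\<close>.\<close>

lemma emeasure_unif_less:
  assumes "h \<le> (1::ennreal)"
  shows "emeasure unif {u. ennreal u < h} = h"
proof -
  obtain c where c: "h = ennreal c" "0 \<le> c" "c \<le> 1"
    using assms by (cases h) (auto simp: top_unique ennreal_le_1)
  have eq: "{0..1} \<inter> {u. ennreal u < ennreal c} = {0..<c}"
    using c by (auto simp: ennreal_less_iff)
  have "{u. ennreal u < ennreal c} \<in> sets borel" by measurable
  then show ?thesis unfolding unif_def c(1)
    by (subst emeasure_uniform_measure) (use c in \<open>auto simp: eq divide_ennreal_def\<close>)
qed

text \<open>Models the masses of measurable rectangles under a coupling. Finite additivity in each
  variable and the marginal bounds are closed under pointwise limits; countable additivity in each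
  variable follows from the bounds.\<close>

locale bimeasure = mu: prob_space \<mu> + nu: prob_space \<nu>
  for \<mu> :: "'a measure" and \<nu> :: "'b measure" +
  fixes m :: "'a set \<Rightarrow> 'b set \<Rightarrow> real"
  assumes nonneg: "A \<in> sets \<mu> \<Longrightarrow> B \<in> sets \<nu> \<Longrightarrow> 0 \<le> m A B"
    and add_left: "A \<in> sets \<mu> \<Longrightarrow> A' \<in> sets \<mu> \<Longrightarrow> A \<inter> A' = {} \<Longrightarrow> B \<in> sets \<nu> \<Longrightarrow> m (A \<union> A') B = m A B + m A' B"
    and add_right: "A \<in> sets \<mu> \<Longrightarrow> B \<in> sets \<nu> \<Longrightarrow> B' \<in> sets \<nu> \<Longrightarrow> B \<inter> B' = {} \<Longrightarrow> m A (B \<union> B') = m A B + m A B'"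
    and le_left: "A \<in> sets \<mu> \<Longrightarrow> B \<in> sets \<nu> \<Longrightarrow> m A B \<le> measure \<mu> A"
    and le_right: "A \<in> sets \<mu> \<Longrightarrow> B \<in> sets \<nu> \<Longrightarrow> m A B \<le> measure \<nu> B"
    and total: "A \<in> sets \<mu> \<Longrightarrow> m A (space \<nu>) = measure \<mu> A"
begin

lemma left_measure:
  assumes "B \<in> sets \<nu>"
  obtains N where "sets N = sets \<mu>" "space N = space \<mu>" "\<And>A. A \<in> sets \<mu> \<Longrightarrow> emeasure N A = ennreal (m A B)"
  by (rule dominated_additive_measure[OF mu.finite_measure_axioms, of "\<lambda>A. m A B"])
    (use assms nonneg le_left add_left in auto)

lemma right_measure:
  assumes "A \<in> sets \<mu>"
  obtains N where "sets N = sets \<nu>" "space N = space \<nu>" "\<And>B. B \<in> sets \<nu> \<Longrightarrow> emeasure N B = ennreal (m A B)"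
  by (rule dominated_additive_measure[OF nu.finite_measure_axioms, of "\<lambda>B. m A B"])
    (use assms nonneg le_right add_right in auto)

text \<open>\<open>h\<close> is a version of the conditional probability of \<open>B\<close> given
  the first variable; the bound by \<open>measure \<mu> A\<close> is the absolute continuity that
  Radon-Nikodym asks for.\<close>

lemma right_density:
  assumes "B \<in> sets \<nu>"
  obtains h where "h \<in> borel_measurable \<mu>"
    "\<And>A. A \<in> sets \<mu> \<Longrightarrow> (\<integral>\<^sup>+x\<in>A. h x \<partial>\<mu>) = ennreal (m A B)"
proof -
  obtain N where N: "sets N = sets \<mu>" "space N = space \<mu>" "\<And>A. A \<in> sets \<mu> \<Longrightarrow> emeasure N A = ennreal (m A B)"
    using left_measure[OF assms] by blast
  have "absolutely_continuous \<mu> N"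
    unfolding absolutely_continuous_def
  proof
    fix A assume A: "A \<in> null_sets \<mu>"
    then have "A \<in> sets \<mu>" "measure \<mu> A = 0" by (auto simp: measure_def)
    then show "A \<in> null_sets N" using le_left[of A B] nonneg[of A B] assms N by (auto simp: null_sets_def)
  qed
  from mu.Radon_Nikodym[OF this N(1)] obtain h where h: "h \<in> borel_measurable \<mu>" "density \<mu> h = N" by blast
  show ?thesis
    by (rule that[OF h(1)]) (use emeasure_density[OF h(1)] N(3) h(2) in auto)
qed

lemma right_mono: "A \<in> sets \<mu> \<Longrightarrow> B \<in> sets \<nu> \<Longrightarrow> B' \<in> sets \<nu> \<Longrightarrow> B \<subseteq> B' \<Longrightarrow> m A B \<le> m A B'"
  using add_right[of A B "B' - B"] nonneg[of A "B' - B"] by (auto simp: Un_absorb1)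

end

lemma dyadic_approx_below:
  fixes c :: real
  assumes "0 < c" "c \<le> 1"
  obtains q where "incseq q" "\<And>n. q n \<in> \<rat> \<inter> {0..1}" "\<And>n. q n < c" "\<And>x. x < c \<Longrightarrow> \<exists>n. x \<le> q n"
proof -
  \<comment> \<open>Ceiling minus one, rather than the floor, keeps \<open>q n\<close> strictly
    below \<open>c\<close> even when \<open>2 ^ n * c\<close> is an integer; the event
    \<open>f p < c\<close> demands this strictness.\<close>
  define q where "q n = (real_of_int \<lceil>2 ^ n * c\<rceil> - 1) / 2 ^ n" for n :: nat
  have ub: "q n < c" for n
    unfolding q_def by (simp add: field_simps) (smt (verit) ceiling_correct mult.commute)
  have lb: "c - 1 / 2 ^ n \<le> q n" for n
  proof -
    have "2 ^ n * c - 1 \<le> real_of_int \<lceil>2 ^ n * c\<rceil> - 1" by simp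
    then have "(2 ^ n * c - 1) / 2 ^ n \<le> q n" unfolding q_def by (rule divide_right_mono) simp
    then show ?thesis by (simp add: diff_divide_distrib)
  qed
  have "1 \<le> \<lceil>2 ^ n * c\<rceil>" for n using assms by (simp add: one_le_ceiling)
  then have nn: "0 \<le> q n" for n unfolding q_def
    by (metis diff_ge_0_iff_ge divide_nonneg_pos of_int_1_le_iff zero_less_numeral zero_less_power)
  have rat: "q n \<in> \<rat>" for n unfolding q_def by (intro Rats_divide) auto
  have inc: "incseq q"
  proof (rule incseq_SucI)
    fix n
    have "2 * (\<lceil>2 ^ n * c\<rceil> - 1) < 2 * (2 ^ n * c)" by (smt (verit) ceiling_correct of_int_diff of_int_1)
    then have "2 * (\<lceil>2 ^ n * c\<rceil> - 1) < \<lceil>2 ^ Suc n * c\<rceil>" by (simp add: less_ceiling_iff mult.assoc)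
    then have "2 * (\<lceil>2 ^ n * c\<rceil> - 1) \<le> \<lceil>2 ^ Suc n * c\<rceil> - 1" by simp
    then have "real_of_int (2 * (\<lceil>2 ^ n * c\<rceil> - 1)) \<le> real_of_int (\<lceil>2 ^ Suc n * c\<rceil> - 1)"
      by (simp only: of_int_le_iff)
    then show "q n \<le> q (Suc n)" unfolding q_def by (simp add: divide_simps)
  qed
  have "\<exists>n. x \<le> q n" if "x < c" for x
  proof -
    obtain n where "inverse (c - x) < 2 ^ n" using real_arch_pow[of 2 "inverse (c - x)"] by auto
    then have "1 / 2 ^ n \<le> c - x" using that by (simp add: field_simps)
    then show ?thesis using lb[of n] by (intro exI[of _ n]) simp
  qed
  moreover have "q n \<le> 1" for n using ub[of n] assms by simp
  ultimately show ?thesis using that[OF inc _ ub] nn rat by auto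
qed

text \<open>The random variable is the conditional quantile function: conditionally on \<open>x\<close> it is the
  generalised inverse, at a uniform level, of the distribution function built from the densities of
  \<open>\<lambda>A. m A {..q}\<close>.\<close>

lemma bimeasure_realization_real:
  fixes m :: "'a set \<Rightarrow> real set \<Rightarrow> real"
  assumes "bimeasure \<mu> \<nu> m" and s\<nu>: "sets \<nu> = sets borel" and conc: "measure \<nu> {..<0} = 0" "measure \<nu> {1..} = 0"
  obtains f where "f \<in> borel_measurable (\<mu> \<Otimes>\<^sub>M unif)"
    "\<And>A B. A \<in> sets \<mu> \<Longrightarrow> B \<in> sets borel \<Longrightarrow>
      emeasure (\<mu> \<Otimes>\<^sub>M unif) {p \<in> space (\<mu> \<Otimes>\<^sub>M unif). fst p \<in> A \<and> f p \<in> B} = ennreal (m A B)"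
proof -
  interpret bimeasure \<mu> \<nu> m by fact
  let ?P = "\<mu> \<Otimes>\<^sub>M unif"
  interpret P: pair_prob_space \<mu> unif ..
  have sp\<nu>: "space \<nu> = UNIV" using sets_eq_imp_space_eq[OF s\<nu>] by simp
  define Q :: "real set" where "Q = \<rat> \<inter> {0..1}"
  have cQ: "countable Q" unfolding Q_def using countable_rat by (rule countable_Int1)
  have "\<exists>h. h \<in> borel_measurable \<mu> \<and> (\<forall>A \<in> sets \<mu>. (\<integral>\<^sup>+x\<in>A. h x \<partial>\<mu>) = ennreal (m A {..q}))" for q
    by (rule right_density[of "{..q}"]) (use s\<nu> in auto)
  then obtain h where h[measurable]: "\<And>q. h q \<in> borel_measurable \<mu>"
    and hi: "\<And>A q. A \<in> sets \<mu> \<Longrightarrow> (\<integral>\<^sup>+x\<in>A. h q x \<partial>\<mu>) = ennreal (m A {..q})" by metis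
  have hfin: "(\<integral>\<^sup>+x. h q x \<partial>\<mu>) \<noteq> \<infinity>" for q
  proof -
    have "(\<integral>\<^sup>+x. h q x \<partial>\<mu>) = (\<integral>\<^sup>+x\<in>space \<mu>. h q x \<partial>\<mu>)" by (intro nn_integral_cong) simp
    then show ?thesis using hi[of "space \<mu>" q] by simp
  qed
  have h1: "AE x in \<mu>. h q x \<le> 1" for q
  proof (rule AE_le_of_set_nn_integral_le)
    fix A assume "A \<in> sets \<mu>"
    then show "(\<integral>\<^sup>+x\<in>A. h q x \<partial>\<mu>) \<le> (\<integral>\<^sup>+x\<in>A. 1 \<partial>\<mu>)"
      using le_left[of A "{..q}"] s\<nu> by (simp add: hi mu.emeasure_eq_measure)
  qed (simp_all add: mu.emeasure_space_1)
  have hmono: "AE x in \<mu>. h q x \<le> h q' x" if "q \<le> q'" for q q'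
  proof (rule AE_le_of_set_nn_integral_le)
    fix A assume "A \<in> sets \<mu>"
    then show "(\<integral>\<^sup>+x\<in>A. h q x \<partial>\<mu>) \<le> (\<integral>\<^sup>+x\<in>A. h q' x \<partial>\<mu>)"
      using right_mono[of A "{..q}" "{..q'}"] s\<nu> that by (simp add: hi ennreal_leI)
  qed (use hfin in auto)
  \<comment> \<open>\<open>h q\<close> is monotone in \<open>q\<close> and bounded by 1 only almost
    everywhere. The capped supremum over the countable set \<open>Q\<close> has both properties at
    every point and, for \<open>q\<close> in \<open>Q\<close>, agrees with \<open>h q\<close> almost
    everywhere.\<close>
  define k where "k q x = (SUP q'\<in>{q' \<in> Q. q' \<le> q}. min 1 (h q' x))" for q x
  have cQ': "countable {q' \<in> Q. q' \<le> q}" for q by (rule countable_subset[OF _ cQ]) auto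
  have [measurable]: "k q \<in> borel_measurable \<mu>" for q
    unfolding k_def by (rule borel_measurable_SUP[OF cQ']) measurable
  have k1: "k q x \<le> 1" for q x unfolding k_def by (auto intro!: SUP_least)
  have kmono: "k q x \<le> k q' x" if "q \<le> q'" for q q' x
    unfolding k_def by (rule SUP_subset_mono) (use that in auto)
  have kh: "AE x in \<mu>. k q x = h q x" if q: "q \<in> Q" for q
  proof -
    have "AE x in \<mu>. \<forall>q'\<in>{q' \<in> Q. q' \<le> q}. h q' x \<le> h q x"
      unfolding AE_ball_countable[OF cQ'] using hmono by auto
    with h1[of q] show ?thesis
    proof eventually_elim
      case (elim x)
      have "k q x \<le> h q x" unfolding k_def
        by (rule SUP_least) (use elim in \<open>auto intro: min.coboundedI2\<close>)
      moreover have "min 1 (h q x) \<le> k q x" unfolding k_def by (rule SUP_upper) (use q in auto)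
      ultimately show ?case using elim by (simp add: min_absorb2)
    qed
  qed
  have ki: "(\<integral>\<^sup>+x\<in>A. k q x \<partial>\<mu>) = ennreal (m A {..q})" if "A \<in> sets \<mu>" "q \<in> Q" for A q
    unfolding hi[OF that(1), symmetric] using kh[OF that(2)] by (intro nn_integral_cong_AE) auto
  \<comment> \<open>Generalised inverse at the level \<open>snd p\<close>. The inserted 1 keeps the
    set nonempty when no element of \<open>Q\<close> qualifies, and 0 is a lower bound, so
    \<open>Inf\<close> is a true infimum with values in [0,1].\<close>
  define f where "f p = Inf (insert 1 {q \<in> Q. ennreal (snd p) < k q (fst p)})" for p
  have f_less: "f p < c \<longleftrightarrow> 1 < c \<or> (\<exists>q\<in>Q. q < c \<and> ennreal (snd p) < k q (fst p))" for p c
    unfolding f_def by (subst cInf_less_iff) (auto simp: Q_def intro!: bdd_belowI[of _ 0])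
  have f_meas: "f \<in> borel_measurable ?P"
  proof (rule borel_measurableI_less)
    fix c
    have "Measurable.pred ?P (\<lambda>p. \<exists>q\<in>Q. q < c \<and> ennreal (snd p) < k q (fst p))"
      using cQ by measurable
    then show "{p \<in> space ?P. f p < c} \<in> sets ?P" unfolding f_less by measurable
  qed
  have E: "emeasure ?P {p \<in> space ?P. fst p \<in> A \<and> ennreal (snd p) < k q (fst p)} = ennreal (m A {..q})"
    if [measurable]: "A \<in> sets \<mu>" and q: "q \<in> Q" for A q
  proof -
    have "emeasure ?P {p \<in> space ?P. fst p \<in> A \<and> ennreal (snd p) < k q (fst p)} =
      (\<integral>\<^sup>+x. emeasure unif (Pair x -` {p \<in> space ?P. fst p \<in> A \<and> ennreal (snd p) < k q (fst p)}) \<partial>\<mu>)"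
      by (rule unif.emeasure_pair_measure_alt) measurable
    also have "\<dots> = (\<integral>\<^sup>+x\<in>A. k q x \<partial>\<mu>)"
    proof (intro nn_integral_cong)
      fix x assume x: "x \<in> space \<mu>"
      show "emeasure unif (Pair x -` {p \<in> space ?P. fst p \<in> A \<and> ennreal (snd p) < k q (fst p)}) = k q x * indicator A x"
      proof (cases "x \<in> A")
        case True
        with x have "Pair x -` {p \<in> space ?P. fst p \<in> A \<and> ennreal (snd p) < k q (fst p)} = {u. ennreal u < k q x}"
          by (auto simp: space_pair_measure)
        then show ?thesis using True emeasure_unif_less[OF k1] by simp
      qed simp
    qed
    finally show ?thesis by (simp add: ki q)
  qed
  \<comment> \<open>For \<open>c\<close> outside (0,1] both sides are trivial, because \<nu> is
    carried by [0,1) and \<open>f\<close> takes values in [0,1]. Otherwise the events belonging to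
    rationals that increase to \<open>c\<close> exhaust the event \<open>f p < c\<close>.\<close>
  have cdf: "emeasure ?P {p \<in> space ?P. fst p \<in> A \<and> f p < c} = ennreal (m A {..<c})"
    if A[measurable]: "A \<in> sets \<mu>" for A c
  proof -
    obtain N where N: "sets N = sets \<nu>" "space N = space \<nu>" "\<And>B. B \<in> sets \<nu> \<Longrightarrow> emeasure N B = ennreal (m A B)"
      using right_measure[OF A] by blast
    consider "1 < c" | "c \<le> 0" | "0 < c" "c \<le> 1" by linarith
    then show ?thesis
    proof cases
      case 1
      have "{p \<in> space ?P. fst p \<in> A \<and> f p < c} = A \<times> space unif"
        using 1 sets.sets_into_space[OF A] by (auto simp: space_pair_measure f_less)
      then have "emeasure ?P {p \<in> space ?P. fst p \<in> A \<and> f p < c} = measure \<mu> A"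
        by (simp add: unif.emeasure_pair_measure_Times unif.emeasure_space_1[simplified] mu.emeasure_eq_measure)
      moreover have "m A {c..} = 0"
        using le_right[OF A, of "{c..}"] nonneg[OF A, of "{c..}"] s\<nu> conc(2) 1
          nu.finite_measure_mono[of "{c..}" "{1..}"] measure_nonneg[of \<nu> "{c..}"] by auto
      moreover have "{..<c} \<union> {c..} = UNIV" "{..<c} \<inter> {c..} = {}" by auto
      ultimately show ?thesis
        using add_right[OF A, of "{..<c}" "{c..}"] total[OF A] s\<nu> sp\<nu> by auto
    next
      case 2
      then have "\<not> f p < c" for p unfolding f_less by (auto simp: Q_def)
      moreover have "m A {..<c} = 0"
        using le_right[OF A, of "{..<c}"] nonneg[OF A, of "{..<c}"] s\<nu> conc(1) 2
          nu.finite_measure_mono[of "{..<c}" "{..<0}"] by auto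
      ultimately show ?thesis by simp
    next
      case 3
      then obtain q where q: "incseq q" "\<And>n. q n \<in> \<rat> \<inter> {0..1}" "\<And>n. q n < c" "\<And>x. x < c \<Longrightarrow> \<exists>n. x \<le> q n"
        using dyadic_approx_below by blast
      have qQ: "q n \<in> Q" for n using q(2) by (simp add: Q_def)
      define S where "S n = {p \<in> space ?P. fst p \<in> A \<and> ennreal (snd p) < k (q n) (fst p)}" for n
      have "{p \<in> space ?P. fst p \<in> A \<and> f p < c} = (\<Union>n. S n)"
      proof (intro equalityI subsetI)
        fix p assume p: "p \<in> {p \<in> space ?P. fst p \<in> A \<and> f p < c}"
        with 3 obtain q' where q': "q' \<in> Q" "q' < c" "ennreal (snd p) < k q' (fst p)" by (auto simp: f_less)
        obtain n where "q' \<le> q n" using q(4)[OF q'(2)] by auto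
        with q' p show "p \<in> (\<Union>n. S n)" using kmono[of q' "q n" "fst p"] by (auto simp: S_def intro: less_le_trans)
      next
        fix p assume "p \<in> (\<Union>n. S n)"
        then show "p \<in> {p \<in> space ?P. fst p \<in> A \<and> f p < c}" using qQ q(3) by (auto simp: S_def f_less)
      qed
      moreover have "S n \<in> sets ?P" for n unfolding S_def by measurable
      then have "range S \<subseteq> sets ?P" by blast
      moreover have "incseq S"
        unfolding incseq_def S_def using kmono incseqD[OF q(1)] by (auto intro: less_le_trans)
      ultimately have "emeasure ?P {p \<in> space ?P. fst p \<in> A \<and> f p < c} = (SUP n. emeasure ?P (S n))"
        by (simp add: SUP_emeasure_incseq)
      also have "\<dots> = (SUP n. emeasure N {..q n})"
        by (simp add: S_def E[OF A qQ] N(3) s\<nu>)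
      also have "\<dots> = emeasure N (\<Union>n. {..q n})"
        by (rule SUP_emeasure_incseq) (use N(1) s\<nu> q(1) in \<open>auto simp: incseq_def\<close>)
      also have "(\<Union>n. {..q n}) = {..<c}" using q(3,4) by (auto intro: le_less_trans)
      finally show ?thesis by (simp add: N(3) s\<nu>)
    qed
  qed
  have "emeasure ?P {p \<in> space ?P. fst p \<in> A \<and> f p \<in> B} = ennreal (m A B)"
    if A[measurable]: "A \<in> sets \<mu>" and B: "B \<in> sets borel" for A B
  proof -
    obtain N where N: "sets N = sets \<nu>" "space N = space \<nu>" "\<And>B. B \<in> sets \<nu> \<Longrightarrow> emeasure N B = ennreal (m A B)"
      using right_measure[OF A] by blast
    \<comment> \<open>The law of \<open>f\<close> on the event that the first variable lies in
      \<open>A\<close>. It is identified with the measure \<open>m A\<close> by comparison on open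
      half-lines, which generate the Borel sets and are stable under intersection.\<close>
    define L where "L = distr (density ?P (indicator (A \<times> UNIV))) borel f"
    have At: "A \<times> (UNIV::real set) \<in> sets ?P" using A by simp
    have L: "emeasure L B = emeasure ?P {p \<in> space ?P. fst p \<in> A \<and> f p \<in> B}" if "B \<in> sets borel" for B
    proof -
      have fB: "f -` B \<inter> space ?P \<in> sets ?P" using measurable_sets[OF f_meas that] .
      have "emeasure L B = emeasure (density ?P (indicator (A \<times> UNIV))) (f -` B \<inter> space ?P)"
        unfolding L_def by (subst emeasure_distr) (use f_meas that in auto)
      also have "\<dots> = (\<integral>\<^sup>+p. indicator (A \<times> UNIV) p * indicator (f -` B \<inter> space ?P) p \<partial>?P)"
        by (rule emeasure_density[OF _ fB]) (use At in auto)
      also have "\<dots> = (\<integral>\<^sup>+p. indicator ((A \<times> UNIV) \<inter> (f -` B \<inter> space ?P)) p \<partial>?P)"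
        by (intro nn_integral_cong) (auto split: split_indicator)
      also have "\<dots> = emeasure ?P ((A \<times> UNIV) \<inter> (f -` B \<inter> space ?P))"
        by (rule nn_integral_indicator[OF sets.Int[OF At fB]])
      also have "(A \<times> UNIV) \<inter> (f -` B \<inter> space ?P) = {p \<in> space ?P. fst p \<in> A \<and> f p \<in> B}" by auto
      finally show ?thesis .
    qed
    have "L = N"
    proof (rule measure_eqI_generator_eq[where \<Omega> = UNIV and E = "range lessThan" and A = "\<lambda>i::nat. {..<real i}"])
      have "{..<a} \<inter> {..<b} = {..<min a b}" for a b :: real by auto
      then show "Int_stable (range (lessThan :: real \<Rightarrow> _))" by (auto simp: Int_stable_def)
      show "sets L = sigma_sets UNIV (range lessThan)" "sets N = sigma_sets UNIV (range lessThan)"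
        unfolding N(1) s\<nu> L_def sets_distr by (simp_all add: borel_Iio)
      show "emeasure L X = emeasure N X" if "X \<in> range lessThan" for X
      proof -
        from that obtain c where X: "X = {..<c}" by auto
        then show ?thesis using L[of X] cdf[OF A, of c] N(3)[of X] s\<nu> by simp
      qed
      show "(\<Union>i::nat. {..<real i}) = UNIV" using reals_Archimedean2 by auto
      show "emeasure L {..<real i} \<noteq> \<infinity>" for i using L[of "{..<real i}"] cdf[OF A, of "real i"] by simp
    qed auto
    then show ?thesis using L[OF B] N(3)[of B] B s\<nu> by simp
  qed
  then show ?thesis using that f_meas by blast
qed

text \<open>Encode by \<open>e\<close>, apply the real case, decode by \<open>r\<close>. Since
  \<open>r\<close> inverts \<open>e\<close>, the preimage under \<open>e\<close> of the preimage of
  \<open>B\<close> under \<open>r\<close> is \<open>B\<close> itself, so the original masses come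
  back.\<close>

lemma bimeasure_realization:
  fixes m :: "'a set \<Rightarrow> 'b::euclidean_space set \<Rightarrow> real"
  assumes "bimeasure \<mu> \<nu> m" and s\<nu>: "sets \<nu> = sets borel"
  obtains f where "f \<in> borel_measurable (\<mu> \<Otimes>\<^sub>M unif)"
    "\<And>A B. A \<in> sets \<mu> \<Longrightarrow> B \<in> sets borel \<Longrightarrow>
      emeasure (\<mu> \<Otimes>\<^sub>M unif) {p \<in> space (\<mu> \<Otimes>\<^sub>M unif). fst p \<in> A \<and> f p \<in> B} = ennreal (m A B)"
proof -
  interpret bimeasure \<mu> \<nu> m by fact
  have sp\<nu>: "space \<nu> = UNIV" using sets_eq_imp_space_eq[OF s\<nu>] by simp
  note [measurable_cong] = s\<nu>
  obtain e :: "'b \<Rightarrow> real" and r :: "real \<Rightarrow> 'b" where er[measurable]: "e \<in> borel_measurable borel" "r \<in> borel_measurable borel"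
    and re: "\<And>x. r (e x) = x" and e01: "\<And>x. 0 \<le> e x" "\<And>x. e x < 1"
    by (rule borel_retract_of_unit_interval) blast
  have em: "e -` B \<in> sets \<nu>" if "B \<in> sets borel" for B
    using measurable_sets[OF er(1) that] s\<nu> by simp
  define \<nu>' where "\<nu>' = distr \<nu> borel e"
  have \<nu>': "measure \<nu>' B = measure \<nu> (e -` B)" if "B \<in> sets borel" for B
    unfolding \<nu>'_def by (subst measure_distr) (use that sp\<nu> in auto)
  have bi: "bimeasure \<mu> \<nu>' (\<lambda>A B. m A (e -` B))"
  proof -
    interpret nu': prob_space \<nu>' unfolding \<nu>'_def by (rule nu.prob_space_distr) measurable
    have s': "sets \<nu>' = sets borel" "space \<nu>' = UNIV" by (simp_all add: \<nu>'_def)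
    show ?thesis
    proof
      fix A B B' assume "A \<in> sets \<mu>" "B \<in> sets \<nu>'" "B' \<in> sets \<nu>'" "B \<inter> B' = {}"
      then show "m A (e -` (B \<union> B')) = m A (e -` B) + m A (e -` B')"
        using add_right[of A "e -` B" "e -` B'"] em s' by (auto simp: vimage_Un)
    qed (use s' nonneg add_left le_left le_right em total \<nu>' sp\<nu> in auto)
  qed
  have "e -` {..<0} = {}" "e -` {1..} = {}" using e01 by (auto simp: not_less[symmetric])
  then have conc: "measure \<nu>' {..<0} = 0" "measure \<nu>' {1..} = 0" using \<nu>' by auto
  obtain f where f: "f \<in> borel_measurable (\<mu> \<Otimes>\<^sub>M unif)"
    "\<And>A B. A \<in> sets \<mu> \<Longrightarrow> B \<in> sets borel \<Longrightarrow>
      emeasure (\<mu> \<Otimes>\<^sub>M unif) {p \<in> space (\<mu> \<Otimes>\<^sub>M unif). fst p \<in> A \<and> f p \<in> B} = ennreal (m A (e -` B))"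
    by (rule bimeasure_realization_real[OF bi _ conc]) (auto simp: \<nu>'_def)
  show ?thesis
  proof (rule that[of "\<lambda>p. r (f p)"])
    show "(\<lambda>p. r (f p)) \<in> borel_measurable (\<mu> \<Otimes>\<^sub>M unif)" using f(1) by measurable
    fix A B assume A: "A \<in> sets \<mu>" and B: "B \<in> sets (borel :: 'b measure)"
    have "r -` B \<in> sets borel" using measurable_sets[OF er(2) B] by simp
    moreover have "e -` (r -` B) = B" using re by auto
    ultimately show "emeasure (\<mu> \<Otimes>\<^sub>M unif) {p \<in> space (\<mu> \<Otimes>\<^sub>M unif). fst p \<in> A \<and> r (f p) \<in> B} = ennreal (m A B)"
      using f(2)[OF A, of "r -` B"] by simp
  qed
qed

subsection \<open>Square integrable random variables and couplings\<close>

definition sq_int :: "'b measure \<Rightarrow> ('b \<Rightarrow> 'a::euclidean_space) \<Rightarrow> bool" where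
  "sq_int M X \<longleftrightarrow> X \<in> borel_measurable M \<and> integrable M (\<lambda>w. (norm (X w))\<^sup>2)"

definition l2 :: "'b measure \<Rightarrow> ('b \<Rightarrow> 'a::euclidean_space) \<Rightarrow> real" where
  "l2 M X = sqrt (\<integral>w. (norm (X w))\<^sup>2 \<partial>M)"

lemma sq_int_measurable [measurable_dest]: "sq_int M X \<Longrightarrow> X \<in> borel_measurable M"
  by (simp add: sq_int_def)

lemma l2_nonneg [simp]: "0 \<le> l2 M X"
  by (simp add: l2_def)

lemma l2_power2: "(l2 M X)\<^sup>2 = (\<integral>w. (norm (X w))\<^sup>2 \<partial>M)"
  by (simp add: l2_def)

lemma sq_int_add [intro]:
  assumes "sq_int M X" "sq_int M Y"
  shows "sq_int M (\<lambda>w. X w + Y w)"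
proof -
  have [measurable]: "X \<in> borel_measurable M" "Y \<in> borel_measurable M" using assms by (auto simp: sq_int_def)
  have "integrable M (\<lambda>w. (norm (X w + Y w))\<^sup>2)"
  proof (rule Bochner_Integration.integrable_bound)
    show "integrable M (\<lambda>w. 2 * (norm (X w))\<^sup>2 + 2 * (norm (Y w))\<^sup>2)"
      using assms by (auto simp: sq_int_def)
    have "(norm (x + y))\<^sup>2 \<le> 2 * (norm x)\<^sup>2 + 2 * (norm y)\<^sup>2" for x y :: 'b
      using zero_le_power2[of "norm (x - y)"] by (simp add: power2_norm_eq_inner inner_simps inner_commute)
    then show "AE w in M. norm ((norm (X w + Y w))\<^sup>2) \<le> norm (2 * (norm (X w))\<^sup>2 + 2 * (norm (Y w))\<^sup>2)"
      by auto
  qed measurable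
  then show ?thesis by (simp add: sq_int_def)
qed

lemma sq_int_scaleR [intro]: "sq_int M X \<Longrightarrow> sq_int M (\<lambda>w. c *\<^sub>R X w)"
  by (auto simp: sq_int_def power_mult_distrib)

lemma sq_int_diff [intro]: "sq_int M X \<Longrightarrow> sq_int M Y \<Longrightarrow> sq_int M (\<lambda>w. X w - Y w)"
  using sq_int_add[of M X "\<lambda>w. (-1) *\<^sub>R Y w"] sq_int_scaleR[of M Y "-1"] by simp

lemma integrable_inner [intro]:
  assumes "sq_int M X" "sq_int M Y"
  shows "integrable M (\<lambda>w. X w \<bullet> Y w)"
proof (rule Bochner_Integration.integrable_bound)
  have [measurable]: "X \<in> borel_measurable M" "Y \<in> borel_measurable M" using assms by (auto simp: sq_int_def)
  show "(\<lambda>w. X w \<bullet> Y w) \<in> borel_measurable M" by measurable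
  show "integrable M (\<lambda>w. (norm (X w))\<^sup>2 + (norm (Y w))\<^sup>2)" using assms by (auto simp: sq_int_def)
  have "\<bar>x \<bullet> y\<bar> \<le> (norm x)\<^sup>2 + (norm y)\<^sup>2" for x y :: 'b
  proof -
    have "\<bar>x \<bullet> y\<bar> \<le> norm x * norm y" by (rule Cauchy_Schwarz_ineq2)
    also have "\<dots> \<le> 2 * (norm x * norm y)" by simp
    also have "\<dots> \<le> (norm x)\<^sup>2 + (norm y)\<^sup>2"
      using sum_squares_bound[of "norm x" "norm y"] by (simp only: mult.assoc)
    finally show ?thesis .
  qed
  then show "AE w in M. norm (X w \<bullet> Y w) \<le> norm ((norm (X w))\<^sup>2 + (norm (Y w))\<^sup>2)" by auto
qed

lemma integral_norm_diff_scaleR: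
  assumes "sq_int M X" "sq_int M Y"
  shows "(\<integral>w. (norm (X w - s *\<^sub>R Y w))\<^sup>2 \<partial>M)
    = (l2 M X)\<^sup>2 - 2 * s * (\<integral>w. X w \<bullet> Y w \<partial>M) + s\<^sup>2 * (l2 M Y)\<^sup>2"
proof -
  have i: "integrable M (\<lambda>w. (norm (X w))\<^sup>2)" "integrable M (\<lambda>w. (norm (Y w))\<^sup>2)"
    "integrable M (\<lambda>w. X w \<bullet> Y w)" using assms by (auto simp: sq_int_def)
  have "(norm (x - s *\<^sub>R y))\<^sup>2 = (norm x)\<^sup>2 - 2 * s * (x \<bullet> y) + s\<^sup>2 * (norm y)\<^sup>2" for x y :: 'b
    unfolding power2_norm_eq_inner by (simp add: inner_simps inner_commute power2_eq_square algebra_simps)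
  then show ?thesis unfolding l2_power2 using i by simp
qed

lemma l2_Cauchy_Schwarz:
  assumes "sq_int M X" "sq_int M Y"
  shows "\<bar>\<integral>w. X w \<bullet> Y w \<partial>M\<bar> \<le> l2 M X * l2 M Y"
proof -
  define a b c where "a = (l2 M X)\<^sup>2" "b = (\<integral>w. X w \<bullet> Y w \<partial>M)" "c = (l2 M Y)\<^sup>2"
  have q: "0 \<le> a - 2 * s * b + s\<^sup>2 * c" for s
    unfolding a_b_c_def integral_norm_diff_scaleR[OF assms, symmetric] by simp
  have "b\<^sup>2 \<le> a * c"
  proof (cases "c = 0")
    case True
    have "b = 0"
    proof (rule ccontr)
      assume "b \<noteq> 0"
      \<comment> \<open>For \<open>c = 0\<close> the quadratic is linear in \<open>s\<close>, and at
        this point it takes the value -1.\<close>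
      with True q[of "(a + 1) / (2 * b)"] show False by simp
    qed
    then show ?thesis using True by simp
  next
    case False
    then have "0 < c" by (simp add: a_b_c_def zero_less_power2 l2_nonneg less_le)
    with q[of "b / c"] show ?thesis by (simp add: field_simps power2_eq_square)
  qed
  then have "\<bar>b\<bar> \<le> sqrt (a * c)" using real_le_rsqrt[of "\<bar>b\<bar>" "a * c"] by simp
  then show ?thesis by (simp add: a_b_c_def real_sqrt_mult)
qed

lemma l2_add_le:
  assumes "sq_int M X" "sq_int M Y"
  shows "l2 M (\<lambda>w. X w + Y w) \<le> l2 M X + l2 M Y"
proof (rule power2_le_imp_le)
  have "(l2 M (\<lambda>w. X w + Y w))\<^sup>2 = (l2 M X)\<^sup>2 + 2 * (\<integral>w. X w \<bullet> Y w \<partial>M) + (l2 M Y)\<^sup>2"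
    using integral_norm_diff_scaleR[OF assms, of "-1"] by (simp add: l2_power2)
  also have "\<dots> \<le> (l2 M X + l2 M Y)\<^sup>2"
    using l2_Cauchy_Schwarz[OF assms] by (simp add: power2_sum)
  finally show "(l2 M (\<lambda>w. X w + Y w))\<^sup>2 \<le> (l2 M X + l2 M Y)\<^sup>2" .
qed simp

lemma l2_minus_commute: "l2 M (\<lambda>w. X w - Y w) = l2 M (\<lambda>w. Y w - X w)"
  by (simp add: l2_def norm_minus_commute)

lemma l2_triangle:
  assumes "sq_int M X" "sq_int M Y" "sq_int M Z"
  shows "l2 M (\<lambda>w. X w - Z w) \<le> l2 M (\<lambda>w. X w - Y w) + l2 M (\<lambda>w. Y w - Z w)"
  using l2_add_le[of M "\<lambda>w. X w - Y w" "\<lambda>w. Y w - Z w"] assms by auto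

lemma sq_int_distr:
  assumes [measurable]: "f \<in> M \<rightarrow>\<^sub>M N" "X \<in> borel_measurable N"
  shows "sq_int (distr M N f) X \<longleftrightarrow> sq_int M (\<lambda>w. X (f w))"
  unfolding sq_int_def by (subst integrable_distr_eq) auto

lemma l2_distr:
  assumes [measurable]: "f \<in> M \<rightarrow>\<^sub>M N" "X \<in> borel_measurable N"
  shows "l2 (distr M N f) X = l2 M (\<lambda>w. X (f w))"
  unfolding l2_def by (subst integral_distr) auto

lemma P2_iff: "\<mu> \<in> P2 \<longleftrightarrow> prob_space \<mu> \<and> sets \<mu> = sets borel \<and> sq_int \<mu> (\<lambda>x. x)"
  unfolding P2_def sq_int_def using measurable_ident_sets by (auto simp: id_def)

lemma distr_in_P2_iff:
  assumes "prob_space M" "X \<in> borel_measurable M"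
  shows "distr M borel X \<in> P2 \<longleftrightarrow> sq_int M X"
  using prob_space.prob_space_distr[OF assms] sq_int_distr[OF assms(2), of "\<lambda>x. x"] assms(2)
  by (auto simp: P2_iff)

lemma distr_pair_couplings:
  assumes "prob_space M" and [measurable]: "X \<in> borel_measurable M" "Y \<in> borel_measurable M"
  shows "distr M borel (\<lambda>w. (X w, Y w)) \<in> couplings (distr M borel X) (distr M borel Y)"
proof -
  have [measurable]: "(fst :: 'b \<times> 'b \<Rightarrow> 'b) \<in> borel \<rightarrow>\<^sub>M borel" "(snd :: 'b \<times> 'b \<Rightarrow> 'b) \<in> borel \<rightarrow>\<^sub>M borel"
    by (simp_all add: borel_prod[symmetric])
  show ?thesis
    unfolding couplings_def using assms(1)
    by (auto intro!: prob_space.prob_space_distr simp: distr_distr comp_def)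
qed

lemma couplings_distr:
  assumes "\<gamma> \<in> couplings \<mu> \<nu>"
  shows "prob_space \<gamma>" "sets \<gamma> = sets borel" "distr \<gamma> borel fst = \<mu>" "distr \<gamma> borel snd = \<nu>"
    "fst \<in> borel_measurable \<gamma>" "snd \<in> borel_measurable \<gamma>"
proof -
  show "prob_space \<gamma>" and s: "sets \<gamma> = sets borel" and "distr \<gamma> borel fst = \<mu>" "distr \<gamma> borel snd = \<nu>"
    using assms by (auto simp: couplings_def)
  show "fst \<in> borel_measurable \<gamma>" "snd \<in> borel_measurable \<gamma>"
    unfolding measurable_cong_sets[OF s refl] by (simp_all add: borel_prod[symmetric])
qed

lemma couplings_sq_int:
  assumes "\<gamma> \<in> couplings \<mu> \<nu>" "\<mu> \<in> P2" "\<nu> \<in> P2"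
  shows "sq_int \<gamma> fst" "sq_int \<gamma> snd"
  using assms(2,3) distr_in_P2_iff[of \<gamma> fst] distr_in_P2_iff[of \<gamma> snd] couplings_distr[OF assms(1)] by simp_all

lemma transport_cost_l2: "transport_cost \<gamma> = (l2 \<gamma> (\<lambda>p. fst p - snd p))\<^sup>2"
  by (simp add: transport_cost_def l2_power2)

lemma transport_cost_nonneg: "0 \<le> transport_cost \<gamma>"
  by (simp add: transport_cost_l2)

lemma transport_cost_distr:
  assumes [measurable]: "X \<in> borel_measurable M" "Y \<in> borel_measurable M"
  shows "transport_cost (distr M borel (\<lambda>w. (X w, Y w))) = (l2 M (\<lambda>w. X w - Y w))\<^sup>2"
proof -
  have [measurable]: "(fst :: 'b \<times> 'b \<Rightarrow> 'b) \<in> borel \<rightarrow>\<^sub>M borel" "(snd :: 'b \<times> 'b \<Rightarrow> 'b) \<in> borel \<rightarrow>\<^sub>M borel"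
    by (simp_all add: borel_prod[symmetric])
  show ?thesis unfolding transport_cost_l2 by (subst l2_distr) auto
qed

lemma W2_le_coupling:
  assumes "\<gamma> \<in> couplings \<mu> \<nu>"
  shows "W2 \<mu> \<nu> \<le> l2 \<gamma> (\<lambda>p. fst p - snd p)"
proof -
  have "(INF \<gamma>\<in>couplings \<mu> \<nu>. transport_cost \<gamma>) \<le> transport_cost \<gamma>"
    by (rule cINF_lower[OF _ assms]) (auto intro!: bdd_belowI[of _ 0] transport_cost_nonneg)
  then have "W2 \<mu> \<nu> \<le> sqrt (transport_cost \<gamma>)" unfolding W2_def by simp
  then show ?thesis by (simp add: transport_cost_l2)
qed

lemma l2_distr_pair:
  assumes "X \<in> borel_measurable M" "Y \<in> borel_measurable M"
  shows "l2 (distr M borel (\<lambda>w. (X w, Y w))) (\<lambda>p. fst p - snd p) = l2 M (\<lambda>w. X w - Y w)"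
  using transport_cost_distr[OF assms] by (simp add: transport_cost_l2 power2_eq_iff_nonneg)

lemma W2_le:
  assumes "prob_space M" "X \<in> borel_measurable M" "Y \<in> borel_measurable M"
  shows "W2 (distr M borel X) (distr M borel Y) \<le> l2 M (\<lambda>w. X w - Y w)"
  using W2_le_coupling[OF distr_pair_couplings[OF assms]] l2_distr_pair[OF assms(2,3)] by simp

lemma opt_couplings_W2:
  assumes "\<gamma> \<in> opt_couplings \<mu> \<nu>"
  shows "W2 \<mu> \<nu> = l2 \<gamma> (\<lambda>p. fst p - snd p)"
proof -
  have "(INF \<gamma>\<in>couplings \<mu> \<nu>. transport_cost \<gamma>) = transport_cost \<gamma>"
    using assms by (intro cInf_eq_minimum) (auto simp: opt_couplings_def)
  then show ?thesis unfolding W2_def by (simp add: transport_cost_l2)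
qed

section \<open>Couplings as laws of noisy maps\<close>

lemma measure_eq_on_rectangles:
  fixes M N :: "('a::euclidean_space \<times> 'b::euclidean_space) measure"
  assumes s: "sets M = sets borel" "sets N = sets borel" and "finite_measure M"
    and eq: "\<And>A B. A \<in> sets borel \<Longrightarrow> B \<in> sets borel \<Longrightarrow> emeasure M (A \<times> B) = emeasure N (A \<times> B)"
  shows "M = N"
proof -
  interpret finite_measure M by fact
  let ?E = "{A \<times> B | A B. A \<in> sets (borel::'a measure) \<and> B \<in> sets (borel::'b measure)}"
  have b: "sets (borel :: ('a \<times> 'b) measure) = sigma_sets UNIV ?E"
    unfolding borel_prod[symmetric] sets_pair_measure by simp
  show ?thesis
  proof (rule measure_eqI_generator_eq[where \<Omega> = UNIV and E = ?E and A = "\<lambda>_. UNIV"])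
    show "Int_stable ?E" using Int_stable_pair_measure_generator[of "borel::'a measure" "borel :: 'b measure"] .
    have "UNIV \<times> UNIV \<in> ?E" by (intro CollectI exI[of _ UNIV]) auto
    then show "range (\<lambda>_::nat. UNIV) \<subseteq> ?E" by (simp only: UNIV_Times_UNIV) blast
    show "emeasure M X = emeasure N X" if "X \<in> ?E" for X using that eq by auto
    show "?E \<subseteq> Pow UNIV" "(\<Union>i::nat. UNIV) = UNIV" "emeasure M UNIV \<noteq> \<infinity>" by simp_all
    show "sets M = sigma_sets UNIV ?E" "sets N = sigma_sets UNIV ?E" using s b by simp_all
  qed
qed

lemma realization_law:
  fixes \<mu> :: "'a::euclidean_space measure"
  assumes "bimeasure \<mu> \<nu> m" "sets \<mu> = sets borel" "sets \<nu> = sets (borel :: 'b::euclidean_space measure)"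
  obtains f \<gamma> where "f \<in> borel_measurable (\<mu> \<Otimes>\<^sub>M unif)" "\<gamma> = distr (\<mu> \<Otimes>\<^sub>M unif) borel (\<lambda>p. (fst p, f p))"
    "\<And>A B. A \<in> sets borel \<Longrightarrow> B \<in> sets borel \<Longrightarrow> emeasure \<gamma> (A \<times> B) = ennreal (m A B)"
proof -
  obtain f where f: "f \<in> borel_measurable (\<mu> \<Otimes>\<^sub>M unif)"
    "\<And>A B. A \<in> sets \<mu> \<Longrightarrow> B \<in> sets borel \<Longrightarrow>
      emeasure (\<mu> \<Otimes>\<^sub>M unif) {p \<in> space (\<mu> \<Otimes>\<^sub>M unif). fst p \<in> A \<and> f p \<in> B} = ennreal (m A B)"
    using bimeasure_realization[OF assms(1,3)] by blast
  note [measurable] = f(1) and [measurable_cong] = assms(2)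
  have ff: "(\<lambda>p. (fst p, f p)) \<in> (\<mu> \<Otimes>\<^sub>M unif) \<rightarrow>\<^sub>M borel" unfolding borel_prod[symmetric] by measurable
  define \<gamma> where "\<gamma> = distr (\<mu> \<Otimes>\<^sub>M unif) borel (\<lambda>p. (fst p, f p))"
  show ?thesis
  proof (rule that[OF f(1) \<gamma>_def])
    fix A B assume A: "A \<in> sets (borel::'a measure)" and B: "B \<in> sets (borel::'b measure)"
    then have "A \<times> B \<in> sets borel" unfolding borel_prod[symmetric] by auto
    then have "emeasure \<gamma> (A \<times> B) = emeasure (\<mu> \<Otimes>\<^sub>M unif) ((\<lambda>p. (fst p, f p)) -` (A \<times> B) \<inter> space (\<mu> \<Otimes>\<^sub>M unif))"
      unfolding \<gamma>_def by (rule emeasure_distr[OF ff])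
    also have "(\<lambda>p. (fst p, f p)) -` (A \<times> B) \<inter> space (\<mu> \<Otimes>\<^sub>M unif) = {p \<in> space (\<mu> \<Otimes>\<^sub>M unif). fst p \<in> A \<and> f p \<in> B}"
      by auto
    finally show "emeasure \<gamma> (A \<times> B) = ennreal (m A B)" using f(2) A B assms(2) by simp
  qed
qed

lemma coupling_bimeasure:
  assumes \<gamma>: "\<gamma> \<in> couplings \<mu> \<nu>"
  shows "bimeasure \<mu> \<nu> (\<lambda>A B. measure \<gamma> (A \<times> B))" "sets \<mu> = sets borel" "sets \<nu> = sets borel"
    "\<And>A. A \<in> sets borel \<Longrightarrow> measure \<mu> A = measure \<gamma> (A \<times> UNIV)"
    "\<And>B. B \<in> sets borel \<Longrightarrow> measure \<nu> B = measure \<gamma> (UNIV \<times> B)"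
proof -
  note c = couplings_distr[OF \<gamma>]
  interpret g: prob_space \<gamma> by fact
  have sp: "space \<gamma> = UNIV" using sets_eq_imp_space_eq[OF c(2)] by simp
  interpret mu: prob_space \<mu> using g.prob_space_distr[OF c(5)] c(3) by simp
  interpret nu: prob_space \<nu> using g.prob_space_distr[OF c(6)] c(4) by simp
  show s: "sets \<mu> = sets borel" "sets \<nu> = sets borel" using c(3,4) by (metis sets_distr)+
  have sn: "space \<nu> = UNIV" using sets_eq_imp_space_eq[OF s(2)] by simp
  have r: "A \<times> B \<in> sets \<gamma>" if "A \<in> sets borel" "B \<in> sets borel" for A B
    using that unfolding c(2) borel_prod[symmetric] by auto
  show m: "measure \<mu> A = measure \<gamma> (A \<times> UNIV)" if "A \<in> sets borel" for A
    unfolding c(3)[symmetric] using that c(5) sp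
    by (subst measure_distr) (auto simp: vimage_fst)
  show n: "measure \<nu> B = measure \<gamma> (UNIV \<times> B)" if "B \<in> sets borel" for B
    unfolding c(4)[symmetric] using that c(6) sp
    by (subst measure_distr) (auto simp: vimage_snd)
  show "bimeasure \<mu> \<nu> (\<lambda>A B. measure \<gamma> (A \<times> B))"
  proof
    fix A A' B assume "A \<in> sets \<mu>" "A' \<in> sets \<mu>" "A \<inter> A' = {}" "B \<in> sets \<nu>"
    then show "measure \<gamma> ((A \<union> A') \<times> B) = measure \<gamma> (A \<times> B) + measure \<gamma> (A' \<times> B)"
      unfolding Sigma_Un_distrib1 using r s by (intro g.finite_measure_Union) auto
  next
    fix A B B' assume "A \<in> sets \<mu>" "B \<in> sets \<nu>" "B' \<in> sets \<nu>" "B \<inter> B' = {}"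
    then show "measure \<gamma> (A \<times> (B \<union> B')) = measure \<gamma> (A \<times> B) + measure \<gamma> (A \<times> B')"
      unfolding Sigma_Un_distrib2 using r s by (intro g.finite_measure_Union) auto
  next
    fix A B assume "A \<in> sets \<mu>" "B \<in> sets \<nu>"
    then show "measure \<gamma> (A \<times> B) \<le> measure \<mu> A" "measure \<gamma> (A \<times> B) \<le> measure \<nu> B"
      using r s m n by (auto intro!: g.finite_measure_mono)
  qed (use m sn s in auto)
qed

text \<open>Every coupling is the law of \<open>(X, f(X, U))\<close> with \<open>U\<close> uniform and independent of \<open>X\<close>; this
  takes the place of disintegration.\<close>

lemma coupling_realization:
  assumes \<gamma>: "\<gamma> \<in> couplings \<mu> \<nu>"
  obtains f where "f \<in> borel_measurable (\<mu> \<Otimes>\<^sub>M unif)" "\<gamma> = distr (\<mu> \<Otimes>\<^sub>M unif) borel (\<lambda>p. (fst p, f p))"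
proof -
  note b = coupling_bimeasure[OF \<gamma>] and c = couplings_distr[OF \<gamma>]
  interpret g: prob_space \<gamma> by fact
  obtain f \<gamma>' where f: "f \<in> borel_measurable (\<mu> \<Otimes>\<^sub>M unif)" "\<gamma>' = distr (\<mu> \<Otimes>\<^sub>M unif) borel (\<lambda>p. (fst p, f p))"
    "\<And>A B. A \<in> sets borel \<Longrightarrow> B \<in> sets borel \<Longrightarrow> emeasure \<gamma>' (A \<times> B) = ennreal (measure \<gamma> (A \<times> B))"
    using realization_law[OF b(1-3)] by blast
  have "\<gamma> = \<gamma>'"
    by (rule measure_eq_on_rectangles) (use c(2) g.finite_measure_axioms f(2,3) in \<open>auto simp: g.emeasure_eq_measure\<close>)
  then show ?thesis using that f(1,2) by blast
qed

subsection \<open>Optimal couplings\<close>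

text \<open>Tychonoff's theorem. The index set, later all pairs of sets, may be uncountable, so a
  subsequence converging at every index need not exist; a filter finer than
  \<open>sequentially\<close> takes its place.\<close>

lemma cluster_filter:
  fixes \<Phi> :: "nat \<Rightarrow> 'i \<Rightarrow> real"
  assumes "\<And>n i. \<Phi> n i \<in> {0..1}"
  obtains G m where "G \<noteq> bot" "G \<le> sequentially" "\<And>i. ((\<lambda>n. \<Phi> n i) \<longlongrightarrow> m i) G"
proof -
  have "compactin (product_topology (\<lambda>_::'i. euclidean) UNIV) (PiE UNIV (\<lambda>_. {0..1::real}))"
    by (subst compactin_PiE) auto
  then have "compact (PiE UNIV (\<lambda>_::'i. {0..1::real}))"
    by (simp add: euclidean_product_topology)
  moreover have "filtermap \<Phi> sequentially \<noteq> bot" by (simp add: filtermap_bot_iff)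
  moreover have "eventually (\<lambda>f. f \<in> PiE UNIV (\<lambda>_::'i. {0..1::real})) (filtermap \<Phi> sequentially)"
    using assms by (simp add: eventually_filtermap PiE_iff extensional_def)
  ultimately obtain m where m: "inf (nhds m) (filtermap \<Phi> sequentially) \<noteq> bot"
    unfolding compact_filter by blast
  \<comment> \<open>Pulls the neighbourhoods of the cluster point \<open>m\<close> back to the
    indices; that \<open>G\<close> is proper is exactly the cluster property.\<close>
  define G where "G = inf sequentially (filtercomap \<Phi> (nhds m))"
  have "G \<noteq> bot"
  proof
    assume "G = bot"
    then have "eventually (\<lambda>_. False) G" by simp
    then obtain P Q where P: "eventually P sequentially" and Q: "eventually Q (filtercomap \<Phi> (nhds m))"
      and PQ: "\<And>n. P n \<Longrightarrow> Q n \<Longrightarrow> False"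
      unfolding G_def eventually_inf by auto
    from Q obtain R where R: "eventually R (nhds m)" "\<And>n. R (\<Phi> n) \<Longrightarrow> Q n"
      unfolding eventually_filtercomap by auto
    have "eventually (\<lambda>f. \<not> R f) (filtermap \<Phi> sequentially)"
      unfolding eventually_filtermap using P by eventually_elim (use PQ R in auto)
    then have "eventually (\<lambda>f. False) (inf (nhds m) (filtermap \<Phi> sequentially))"
      unfolding eventually_inf using R(1) by blast
    then show False using m by (simp add: eventually_False)
  qed
  moreover have "G \<le> sequentially" by (simp add: G_def)
  moreover have "((\<lambda>n. \<Phi> n i) \<longlongrightarrow> m i) G" for i
  proof -
    have "filterlim \<Phi> (nhds m) G"
      unfolding G_def by (rule filterlim_mono[OF filterlim_filtercomap order_refl]) simp
    moreover have "((\<lambda>f. f i) \<longlongrightarrow> m i) (nhds m)"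
    proof (rule topological_tendstoI)
      fix S :: "real set" assume S: "open S" "m i \<in> S"
      have "open ((\<lambda>f. f i) -` S)"
        by (rule open_vimage[OF S(1) continuous_on_product_coordinates])
      then show "eventually (\<lambda>f. f i \<in> S) (nhds m)"
        unfolding eventually_nhds using S(2) by (intro exI[of _ "(\<lambda>f. f i) -` S"]) auto
    qed
    ultimately show ?thesis by (rule filterlim_compose[rotated])
  qed
  ultimately show ?thesis using that by blast
qed

text \<open>The bimeasure axioms are equations and inequalities between finitely many rectangle
  masses and masses of the fixed \<mu> and \<nu>, hence pass to the limit. The fixed marginals play
  the role of tightness, and \<open>realization_law\<close> turns the limit into a measure.\<close>

lemma coupling_limit:
  fixes \<mu> \<nu> :: "'a::euclidean_space measure"
  assumes g: "\<And>n. g n \<in> couplings \<mu> \<nu>"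
  obtains G \<gamma> where "G \<noteq> bot" "G \<le> sequentially" "\<gamma> \<in> couplings \<mu> \<nu>"
    "\<And>A B. A \<in> sets borel \<Longrightarrow> B \<in> sets borel \<Longrightarrow> ((\<lambda>n. measure (g n) (A \<times> B)) \<longlongrightarrow> measure \<gamma> (A \<times> B)) G"
proof -
  note b = coupling_bimeasure[OF g]
  interpret gb: bimeasure \<mu> \<nu> "\<lambda>A B. measure (g n) (A \<times> B)" for n by (rule b)
  have p: "prob_space (g n)" for n using couplings_distr(1)[OF g] .
  obtain G m where G: "G \<noteq> bot" "G \<le> sequentially"
    and m: "\<And>i. ((\<lambda>n. measure (g n) (fst i \<times> snd i)) \<longlongrightarrow> m i) G"
    by (rule cluster_filter[of "\<lambda>n i. measure (g n) (fst i \<times> snd i)"])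
      (auto simp: prob_space.prob_le_1[OF p])
  have m: "((\<lambda>n. measure (g n) (A \<times> B)) \<longlongrightarrow> m (A, B)) G" for A B using m[of "(A, B)"] by simp
  note lim_eq = tendsto_unique[OF G(1)] and lim_le = tendsto_le[OF G(1)]
  have bm: "bimeasure \<mu> \<nu> (\<lambda>A B. m (A, B))"
  proof
    fix A B assume "A \<in> sets \<mu>" "B \<in> sets \<nu>"
    then show "m (A, B) \<le> measure \<mu> A" "m (A, B) \<le> measure \<nu> B" "0 \<le> m (A, B)"
      using gb.le_left gb.le_right by (auto intro!: lim_le[OF tendsto_const m] lim_le[OF m tendsto_const])
  next
    fix A A' B assume *: "A \<in> sets \<mu>" "A' \<in> sets \<mu>" "A \<inter> A' = {}" "B \<in> sets \<nu>"
    show "m (A \<union> A', B) = m (A, B) + m (A', B)"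
      by (rule lim_eq[OF m]) (use tendsto_add[OF m m, of A B A' B] gb.add_left[OF *] in simp)
  next
    fix A B B' assume *: "A \<in> sets \<mu>" "B \<in> sets \<nu>" "B' \<in> sets \<nu>" "B \<inter> B' = {}"
    show "m (A, B \<union> B') = m (A, B) + m (A, B')"
      by (rule lim_eq[OF m]) (use tendsto_add[OF m m, of A B A B'] gb.add_right[OF *] in simp)
  next
    fix A assume "A \<in> sets \<mu>"
    then show "m (A, space \<nu>) = measure \<mu> A"
      by (intro lim_eq[OF m]) (simp add: gb.total)
  qed
  then interpret mb: bimeasure \<mu> \<nu> "\<lambda>A B. m (A, B)" .
  obtain f \<gamma> where f: "f \<in> borel_measurable (\<mu> \<Otimes>\<^sub>M unif)"
    and \<gamma>: "\<gamma> = distr (\<mu> \<Otimes>\<^sub>M unif) borel (\<lambda>p. (fst p, f p))"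
    and \<gamma>e: "\<And>A B. A \<in> sets borel \<Longrightarrow> B \<in> sets borel \<Longrightarrow> emeasure \<gamma> (A \<times> B) = ennreal (m (A, B))"
    using realization_law[OF bm b(2,3)] by blast
  have \<gamma>m: "measure \<gamma> (A \<times> B) = m (A, B)" if "A \<in> sets borel" "B \<in> sets borel" for A B
    using \<gamma>e[OF that] mb.nonneg[of A B] that b(2,3) by (simp add: measure_def)
  interpret P: pair_prob_space \<mu> unif ..
  have s: "sets \<gamma> = sets borel" "space \<gamma> = UNIV" by (simp_all add: \<gamma>)
  have fst_snd: "fst \<in> borel_measurable \<gamma>" "snd \<in> borel_measurable \<gamma>"
    unfolding measurable_cong_sets[OF s(1) refl] by (simp_all add: borel_prod[symmetric])
  have pg: "prob_space \<gamma>" unfolding \<gamma>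
    by (rule P.prob_space_distr) (use f b(2) in \<open>simp add: borel_prod[symmetric] cong: measurable_cong_sets\<close>)
  have "distr \<gamma> borel fst = \<mu>"
  proof (rule measure_eqI)
    show "sets (distr \<gamma> borel fst) = sets \<mu>" using b(2) by simp
    fix A assume "A \<in> sets (distr \<gamma> borel fst)"
    then have A: "A \<in> sets borel" by simp
    have "emeasure (distr \<gamma> borel fst) A = emeasure \<gamma> (A \<times> UNIV)"
      using A fst_snd s(2) by (subst emeasure_distr) (auto simp: vimage_fst)
    also have "\<dots> = emeasure \<mu> A"
      using \<gamma>e[OF A, of UNIV] mb.total[of A] A b(2) sets_eq_imp_space_eq[OF b(3)]
      by (simp add: gb.mu.emeasure_eq_measure)
    finally show "emeasure (distr \<gamma> borel fst) A = emeasure \<mu> A" .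
  qed
  moreover have "distr \<gamma> borel snd = \<nu>"
  proof (rule measure_eqI)
    show "sets (distr \<gamma> borel snd) = sets \<nu>" using b(3) by simp
    fix B assume "B \<in> sets (distr \<gamma> borel snd)"
    then have B: "B \<in> sets borel" by simp
    have "m (UNIV, B) = measure \<nu> B"
      by (rule lim_eq[OF m]) (simp add: b(5)[OF B, symmetric])
    moreover have "emeasure (distr \<gamma> borel snd) B = emeasure \<gamma> (UNIV \<times> B)"
      using B fst_snd s(2) by (subst emeasure_distr) (auto simp: vimage_snd)
    ultimately show "emeasure (distr \<gamma> borel snd) B = emeasure \<nu> B"
      using \<gamma>e[OF _ B, of UNIV] by (simp add: gb.nu.emeasure_eq_measure)
  qed
  ultimately have "\<gamma> \<in> couplings \<mu> \<nu>" using pg s by (simp add: couplings_def)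
  then show ?thesis using that[OF G] m \<gamma>m by simp
qed

text \<open>A finite combination of rectangle masses passes to the limit along the filter of
  \<open>coupling_limit\<close>, which the quadratic cost itself need not do directly.\<close>

lemma integral_cost_simple:
  fixes s :: "'a::euclidean_space \<Rightarrow> 'a"
  assumes \<gamma>: "\<gamma> \<in> couplings \<mu> \<nu>" and s: "simple_function borel s"
  shows "(\<integral>p. (norm (s (fst p) - s (snd p)))\<^sup>2 \<partial>\<gamma>) =
    (\<Sum>a\<in>range s. \<Sum>b\<in>range s. (norm (a - b))\<^sup>2 * measure \<gamma> ((s -` {a}) \<times> (s -` {b})))"
proof -
  interpret prob_space \<gamma> using couplings_distr[OF \<gamma>] by simp
  have fin: "finite (range s)" using s by (simp add: simple_function_def)
  have sb: "s -` {a} \<in> sets borel" for a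
    using measurable_sets[OF borel_measurable_simple_function[OF s], of "{a}"] by simp
  have r: "(s -` {a}) \<times> (s -` {b}) \<in> sets \<gamma>" for a b
    using sb couplings_distr(2)[OF \<gamma>] unfolding borel_prod[symmetric] by auto
  have "(norm (s (fst p) - s (snd p)))\<^sup>2 =
      (\<Sum>a\<in>range s. \<Sum>b\<in>range s. (norm (a - b))\<^sup>2 * indicator ((s -` {a}) \<times> (s -` {b})) p)" (is "?l = ?r") for p
  proof -
    have "?r = (\<Sum>a\<in>range s. \<Sum>b\<in>range s. if b = s (snd p) then (if a = s (fst p) then (norm (a - b))\<^sup>2 else 0) else 0)"
      by (intro sum.cong refl) (auto simp: indicator_def mem_Times_iff)
    also have "\<dots> = ?l" using fin by (simp add: sum.delta)
    finally show ?thesis by simp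
  qed
  then show ?thesis using r by (simp add: emeasure_eq_measure)
qed

text \<open>The limit of a minimising sequence is optimal. Replacing \<open>x\<close> by
  \<open>s k x\<close> in both coordinates changes the \<open>L2\<close> size of the displacement by
  at most \<open>e k\<close>, which depends on the marginals only; this uniformity over couplings
  allows the approximation and the limit to be exchanged.\<close>

lemma opt_couplings_nonempty:
  fixes \<mu> \<nu> :: "'a::euclidean_space measure"
  assumes \<mu>: "\<mu> \<in> P2" and \<nu>: "\<nu> \<in> P2"
  shows "opt_couplings \<mu> \<nu> \<noteq> {}"
proof -
  have P: "prob_space \<mu>" "prob_space \<nu>" "sets \<mu> = sets borel" "sets \<nu> = sets borel"
    and sqi: "sq_int \<mu> (\<lambda>x. x)" "sq_int \<nu> (\<lambda>x. x)"
    using \<mu> \<nu> by (auto simp: P2_iff)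
  interpret mu: prob_space \<mu> by (rule P)
  interpret nu: prob_space \<nu> by (rule P)
  interpret mn: pair_prob_space \<mu> \<nu> ..
  define w where "w = (INF \<gamma>\<in>couplings \<mu> \<nu>. transport_cost \<gamma>)"
  have ne: "couplings \<mu> \<nu> \<noteq> {}"
  proof -
    have "sets (\<mu> \<Otimes>\<^sub>M \<nu>) = sets borel"
      unfolding borel_prod[symmetric] using P by (intro sets_pair_measure_cong)
    moreover have "distr (\<mu> \<Otimes>\<^sub>M \<nu>) borel fst = \<mu>"
      using nu.distr_pair_fst[of \<mu>] distr_cong[OF refl P(3), of "\<mu> \<Otimes>\<^sub>M \<nu>" fst fst] by simp
    moreover have "distr (\<mu> \<Otimes>\<^sub>M \<nu>) borel snd = \<nu>"
    proof (rule measure_eqI)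
      fix B assume "B \<in> sets (distr (\<mu> \<Otimes>\<^sub>M \<nu>) borel snd)"
      then have B: "B \<in> sets \<nu>" using P by simp
      have "emeasure (distr (\<mu> \<Otimes>\<^sub>M \<nu>) borel snd) B = emeasure (\<mu> \<Otimes>\<^sub>M \<nu>) (space \<mu> \<times> B)"
        using B P(4) sets.sets_into_space[OF B]
        by (subst emeasure_distr) (auto simp: space_pair_measure intro!: arg_cong2[where f = emeasure] cong: measurable_cong_sets)
      then show "emeasure (distr (\<mu> \<Otimes>\<^sub>M \<nu>) borel snd) B = emeasure \<nu> B"
        using B by (simp add: nu.emeasure_pair_measure_Times mu.emeasure_space_1)
    qed (use P in simp)
    ultimately have "\<mu> \<Otimes>\<^sub>M \<nu> \<in> couplings \<mu> \<nu>" by (simp add: couplings_def mn.prob_space_axioms)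
    then show ?thesis by blast
  qed
  have bdd: "bdd_below (transport_cost ` couplings \<mu> \<nu>)"
    by (auto intro!: bdd_belowI[of _ 0] transport_cost_nonneg)
  have "\<exists>\<gamma>\<in>couplings \<mu> \<nu>. transport_cost \<gamma> < w + 1 / Suc n" for n
    using cInf_lessD[of "transport_cost ` couplings \<mu> \<nu>" "w + 1 / Suc n"] ne by (auto simp: w_def)
  then obtain g where g: "\<And>n. g n \<in> couplings \<mu> \<nu>" and gw: "\<And>n. transport_cost (g n) < w + 1 / Suc n"
    by metis
  obtain G \<gamma> where G: "G \<noteq> bot" "G \<le> sequentially" and \<gamma>: "\<gamma> \<in> couplings \<mu> \<nu>"
    and lim: "\<And>A B. A \<in> sets borel \<Longrightarrow> B \<in> sets borel \<Longrightarrow> ((\<lambda>n. measure (g n) (A \<times> B)) \<longlongrightarrow> measure \<gamma> (A \<times> B)) G"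
    using coupling_limit[of g \<mu> \<nu>] g by blast
  \<comment> \<open>The bound by \<open>2 * norm x\<close> supplies the majorants
    \<open>4 * (norm x)\<^sup>2\<close> for square integrability and
    \<open>9 * (norm x)\<^sup>2\<close> for dominated convergence.\<close>
  obtain s :: "nat \<Rightarrow> 'a \<Rightarrow> 'a" where s: "\<And>k. simple_function borel (s k)"
    and slim: "\<And>x. (\<lambda>k. s k x) \<longlonglongrightarrow> x" and sb: "\<And>k x. norm (s k x) \<le> 2 * norm x"
    using borel_measurable_implies_sequence_metric[of "\<lambda>x::'a. x" borel 0] by auto
  have sm[measurable]: "s k \<in> borel_measurable borel" for k using borel_measurable_simple_function[OF s] .
  have eps: "sq_int M (s k) \<and> (\<lambda>k. l2 M (\<lambda>x. s k x - x)) \<longlonglongrightarrow> 0" if M: "sets M = sets borel" "sq_int M (\<lambda>x. x)" for M k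
  proof
    note [measurable_cong] = M(1)
    have i: "integrable M (\<lambda>x. (norm x)\<^sup>2)" using M by (simp add: sq_int_def)
    have "integrable M (\<lambda>x. (norm (s k x))\<^sup>2)"
      by (rule Bochner_Integration.integrable_bound[where f = "\<lambda>x. 4 * (norm x)\<^sup>2"])
        (use i power_mono[OF sb, of _ _ 2] in \<open>auto simp: power_mult_distrib\<close>)
    then show "sq_int M (s k)" by (simp add: sq_int_def)
    have "(\<lambda>k. \<integral>x. (norm (s k x - x))\<^sup>2 \<partial>M) \<longlonglongrightarrow> (\<integral>x. 0 \<partial>M)"
    proof (rule integral_dominated_convergence[where w = "\<lambda>x. 9 * (norm x)\<^sup>2"])
      show "AE x in M. (\<lambda>k. (norm (s k x - x))\<^sup>2) \<longlonglongrightarrow> 0"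
      proof (intro AE_I2)
        fix x
        have "(\<lambda>k. (norm (s k x - x))\<^sup>2) \<longlonglongrightarrow> (norm (x - x))\<^sup>2" by (intro tendsto_intros slim)
        then show "(\<lambda>k. (norm (s k x - x))\<^sup>2) \<longlonglongrightarrow> 0" by simp
      qed
      have "norm (s k x - x) \<le> 3 * norm x" for k x
        using norm_triangle_ineq4[of "s k x" x] sb[of k x] by simp
      then have "(norm (s k x - x))\<^sup>2 \<le> (3 * norm x)\<^sup>2" for k x by (intro power_mono) auto
      then show "AE x in M. norm ((norm (s k x - x))\<^sup>2) \<le> 9 * (norm x)\<^sup>2" for k
        by (auto simp: power_mult_distrib)
    qed (use i in auto)
    then have "(\<lambda>k. l2 M (\<lambda>x. s k x - x)) \<longlonglongrightarrow> sqrt 0"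
      unfolding l2_def by (intro tendsto_real_sqrt) simp
    then show "(\<lambda>k. l2 M (\<lambda>x. s k x - x)) \<longlonglongrightarrow> 0" by simp
  qed
  define e where "e k = l2 \<mu> (\<lambda>x. s k x - x) + l2 \<nu> (\<lambda>x. s k x - x)" for k
  have "e \<longlonglongrightarrow> 0 + 0" unfolding e_def using eps[OF P(3) sqi(1)] eps[OF P(4) sqi(2)] by (intro tendsto_add) auto
  then have e0: "e \<longlonglongrightarrow> 0" by simp
  define D where "D k p = s k (fst p) - s k (snd p)" for k and p :: "'a \<times> 'a"
  have near: "l2 \<gamma>' (D k) \<le> l2 \<gamma>' (\<lambda>p. fst p - snd p) + e k" "l2 \<gamma>' (\<lambda>p. fst p - snd p) \<le> l2 \<gamma>' (D k) + e k"
    if \<gamma>': "\<gamma>' \<in> couplings \<mu> \<nu>" for \<gamma>' k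
  proof -
    note c = couplings_distr[OF \<gamma>'] and q = couplings_sq_int[OF \<gamma>' \<mu> \<nu>]
    note [measurable] = c(5,6)
    have q1: "sq_int \<gamma>' (\<lambda>p. s k (fst p))" using eps[OF P(3) sqi(1), of k] c(3) sq_int_distr[of fst \<gamma>' borel "s k"] c(5) sm by simp
    have q2: "sq_int \<gamma>' (\<lambda>p. s k (snd p))" using eps[OF P(4) sqi(2), of k] c(4) sq_int_distr[of snd \<gamma>' borel "s k"] c(6) sm by simp
    have e1: "l2 \<mu> (\<lambda>x. s k x - x) = l2 \<gamma>' (\<lambda>p. s k (fst p) - fst p)"
      unfolding c(3)[symmetric] by (rule l2_distr) measurable
    have e2: "l2 \<nu> (\<lambda>x. s k x - x) = l2 \<gamma>' (\<lambda>p. s k (snd p) - snd p)"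
      unfolding c(4)[symmetric] by (rule l2_distr) measurable
    have "l2 \<gamma>' (D k) \<le> l2 \<gamma>' (\<lambda>p. s k (fst p) - fst p) + l2 \<gamma>' (\<lambda>p. fst p - s k (snd p))"
      unfolding D_def by (rule l2_triangle[OF q1 q(1) q2])
    moreover have "l2 \<gamma>' (\<lambda>p. fst p - s k (snd p)) \<le> l2 \<gamma>' (\<lambda>p. fst p - snd p) + l2 \<gamma>' (\<lambda>p. snd p - s k (snd p))"
      by (rule l2_triangle[OF q(1) q(2) q2])
    ultimately show "l2 \<gamma>' (D k) \<le> l2 \<gamma>' (\<lambda>p. fst p - snd p) + e k"
      unfolding e_def e1 e2 by (simp add: l2_minus_commute[of \<gamma>' snd])
    have "l2 \<gamma>' (\<lambda>p. fst p - snd p) \<le> l2 \<gamma>' (\<lambda>p. fst p - s k (fst p)) + l2 \<gamma>' (\<lambda>p. s k (fst p) - snd p)"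
      by (rule l2_triangle[OF q(1) q1 q(2)])
    moreover have "l2 \<gamma>' (\<lambda>p. s k (fst p) - snd p) \<le> l2 \<gamma>' (D k) + l2 \<gamma>' (\<lambda>p. s k (snd p) - snd p)"
      unfolding D_def by (rule l2_triangle[OF q1 q2 q(2)])
    ultimately show "l2 \<gamma>' (\<lambda>p. fst p - snd p) \<le> l2 \<gamma>' (D k) + e k"
      unfolding e_def e1 e2 by (simp add: l2_minus_commute[of \<gamma>' fst])
  qed
  have "w \<ge> 0" unfolding w_def using ne by (intro cINF_greatest) (auto simp: transport_cost_nonneg)
  have D_lim: "((\<lambda>n. l2 (g n) (D k)) \<longlongrightarrow> l2 \<gamma> (D k)) G" for k
    unfolding l2_def D_def integral_cost_simple[OF g s] integral_cost_simple[OF \<gamma> s]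
    by (intro tendsto_real_sqrt tendsto_sum tendsto_mult tendsto_const lim)
      (use measurable_sets[OF sm, of "{_}"] in auto)
  have D_le: "l2 \<gamma> (D k) \<le> sqrt w + e k" for k
  proof (rule tendsto_le[OF G(1) _ D_lim])
    have "(\<lambda>n. sqrt (w + 1 / Suc n) + e k) \<longlonglongrightarrow> sqrt (w + 0) + e k"
      using LIMSEQ_inverse_real_of_nat by (intro tendsto_intros) (simp add: inverse_eq_divide)
    then show "((\<lambda>n. sqrt (w + 1 / Suc n) + e k) \<longlongrightarrow> sqrt w + e k) G"
      using tendsto_mono[OF G(2)] by simp
    have "l2 (g n) (D k) \<le> sqrt (w + 1 / Suc n) + e k" for n
    proof -
      have "l2 (g n) (\<lambda>p. fst p - snd p) \<le> sqrt (w + 1 / Suc n)"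
        using gw[of n] by (intro real_le_rsqrt) (simp add: transport_cost_l2)
      with near(1)[OF g[of n], of k] show ?thesis by simp
    qed
    then show "\<forall>\<^sub>F n in G. l2 (g n) (D k) \<le> sqrt (w + 1 / Suc n) + e k" by (rule always_eventually[OF allI])
  qed
  \<comment> \<open>The error \<open>e k\<close> is paid twice: once to pass to simple functions
    along the sequence, once to return from them at the limit coupling.\<close>
  have "l2 \<gamma> (\<lambda>p. fst p - snd p) \<le> sqrt w"
  proof (rule LIMSEQ_le_const)
    show "(\<lambda>k. sqrt w + e k + e k) \<longlonglongrightarrow> sqrt w"
      using tendsto_add[OF tendsto_add[OF tendsto_const[of "sqrt w"] e0] e0] by simp
    have "l2 \<gamma> (\<lambda>p. fst p - snd p) \<le> sqrt w + e k + e k" for k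
      using near(2)[OF \<gamma>, of k] D_le[of k] by simp
    then show "\<exists>N. \<forall>n\<ge>N. l2 \<gamma> (\<lambda>p. fst p - snd p) \<le> sqrt w + e n + e n" by blast
  qed
  then have "transport_cost \<gamma> \<le> w"
    unfolding transport_cost_l2 using \<open>w \<ge> 0\<close> power_mono[of "l2 \<gamma> (\<lambda>p. fst p - snd p)" "sqrt w" 2] by simp
  moreover have "w \<le> transport_cost \<gamma>'" if "\<gamma>' \<in> couplings \<mu> \<nu>" for \<gamma>'
    unfolding w_def by (rule cINF_lower[OF bdd that])
  ultimately have "\<gamma> \<in> opt_couplings \<mu> \<nu>"
    unfolding opt_couplings_def using \<gamma> by (auto intro: order_trans)
  then show ?thesis by blast
qed

subsection \<open>Gluing and the triangle inequality\<close>

lemma opt_couplings_sub: "\<gamma> \<in> opt_couplings \<mu> \<nu> \<Longrightarrow> \<gamma> \<in> couplings \<mu> \<nu>"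
  by (simp add: opt_couplings_def)

text \<open>Cauchy-Schwarz against the constant 1, whose norm is 1 on a probability space.\<close>

lemma (in prob_space) norm_integral_le_l2:
  assumes "sq_int M X"
  shows "(\<integral>w. norm (X w) \<partial>M) \<le> l2 M X" "integrable M X" "norm (\<integral>w. X w \<partial>M) \<le> l2 M X"
proof -
  have [measurable]: "X \<in> borel_measurable M" using assms by (simp add: sq_int_def)
  have s: "sq_int M (\<lambda>w. norm (X w))" "sq_int M (\<lambda>_. 1 :: real)" using assms by (auto simp: sq_int_def)
  have "(\<integral>w. norm (X w) \<bullet> 1 \<partial>M) \<le> l2 M (\<lambda>w. norm (X w)) * l2 M (\<lambda>_. 1 :: real)"
    using l2_Cauchy_Schwarz[OF s] by simp
  then show le: "(\<integral>w. norm (X w) \<partial>M) \<le> l2 M X" by (simp add: l2_def prob_space)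
  have "integrable M (\<lambda>w. norm (X w))" using integrable_inner[OF s] by simp
  then show "integrable M X" by (simp add: integrable_norm_iff)
  show "norm (\<integral>w. X w \<partial>M) \<le> l2 M X" by (rule order_trans[OF integral_norm_bound le])
qed

text \<open>The vector field \<open>g\<close> is the barycentric projection of \<open>\<gamma>\<close>, shifted by the identity. The identity
  for the integrals expresses that the two couplings are glued so that \<open>Y\<close> and \<open>Z\<close> are independent
  conditionally on \<open>X\<close>.\<close>

lemma barycentric_gluing:
  fixes \<rho> \<mu> :: "'a::euclidean_space measure"
  assumes \<rho>: "\<rho> \<in> P2" and \<mu>: "\<mu> \<in> P2" and \<gamma>: "\<gamma> \<in> couplings \<rho> \<mu>"
  obtains g where "g \<in> L2_fields \<rho>" "L2_norm \<rho> g \<le> l2 \<gamma> (\<lambda>p. fst p - snd p)"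
    "\<And>\<nu> \<gamma>'. \<nu> \<in> P2 \<Longrightarrow> \<gamma>' \<in> couplings \<rho> \<nu> \<Longrightarrow>
      \<exists>(M :: (('a \<times> real) \<times> real) measure) X Y Z. prob_space M \<and> sq_int M X \<and> sq_int M Y \<and> sq_int M Z \<and>
        \<gamma> = distr M borel (\<lambda>w. (X w, Y w)) \<and> \<gamma>' = distr M borel (\<lambda>w. (X w, Z w)) \<and>
        (\<integral>w. (Y w - X w) \<bullet> (Z w - X w) \<partial>M) = (\<integral>p. g (fst p) \<bullet> (snd p - fst p) \<partial>\<gamma>')"
proof -
  have P: "prob_space \<rho>" "sets \<rho> = sets borel" "sq_int \<rho> (\<lambda>x. x)" using \<rho> by (auto simp: P2_iff)
  interpret rho: prob_space \<rho> by (rule P)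
  interpret ru: pair_prob_space \<rho> unif ..
  note [measurable_cong] = P(2)
  have fsb[measurable]: "(fst :: 'a \<times> 'a \<Rightarrow> 'a) \<in> borel \<rightarrow>\<^sub>M borel" "(snd :: 'a \<times> 'a \<Rightarrow> 'a) \<in> borel \<rightarrow>\<^sub>M borel"
    by (simp_all add: borel_prod[symmetric])
  obtain f where f[measurable]: "f \<in> borel_measurable (\<rho> \<Otimes>\<^sub>M unif)"
    and \<gamma>f: "\<gamma> = distr (\<rho> \<Otimes>\<^sub>M unif) borel (\<lambda>p. (fst p, f p))"
    using coupling_realization[OF \<gamma>] by blast
  have pairm: "(\<lambda>p. (fst p, h p)) \<in> (\<rho> \<Otimes>\<^sub>M unif) \<rightarrow>\<^sub>M (borel :: ('a \<times> 'a) measure)"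
    if "h \<in> borel_measurable (\<rho> \<Otimes>\<^sub>M unif)" for h
    unfolding borel_prod[symmetric] using that by measurable
  have sq: "sq_int (\<rho> \<Otimes>\<^sub>M unif) fst" "sq_int (\<rho> \<Otimes>\<^sub>M unif) h"
    if h: "h \<in> borel_measurable (\<rho> \<Otimes>\<^sub>M unif)" and
      c: "distr (\<rho> \<Otimes>\<^sub>M unif) borel (\<lambda>p. (fst p, h p)) \<in> couplings \<rho> \<nu>" and \<nu>: "\<nu> \<in> P2" for h \<nu>
    using couplings_sq_int[OF c \<rho> \<nu>]
    unfolding sq_int_distr[OF pairm[OF h] fsb(1)] sq_int_distr[OF pairm[OF h] fsb(2)] fst_conv snd_conv
    by simp_all
  have sqf: "sq_int (\<rho> \<Otimes>\<^sub>M unif) fst" "sq_int (\<rho> \<Otimes>\<^sub>M unif) f" using sq[OF f \<gamma>[unfolded \<gamma>f] \<mu>] by simp_all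
  define d where "d p = f p - fst p" for p
  have sqd: "sq_int (\<rho> \<Otimes>\<^sub>M unif) d" unfolding d_def using sqf by auto
  have [measurable]: "d \<in> borel_measurable (\<rho> \<Otimes>\<^sub>M unif)" using sqd by (simp add: sq_int_def)
  have id2: "integrable (\<rho> \<Otimes>\<^sub>M unif) (\<lambda>(x, u). (norm (d (x, u)))\<^sup>2)" using sqd by (simp add: sq_int_def split_beta')
  \<comment> \<open>Averaging the displacement over the noise gives its conditional expectation
    given the first variable. Where the fibre is not integrable the integral defaults to 0, which
    happens on a null set only.\<close>
  define g where "g x = (\<integral>u. d (x, u) \<partial>unif)" for x
  have [measurable]: "g \<in> borel_measurable \<rho>" unfolding g_def by measurable
  have AEd: "AE x in \<rho>. sq_int unif (\<lambda>u. d (x, u))"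
    using ru.AE_integrable_fst[OF id2] AE_space
    by eventually_elim (auto simp: sq_int_def)
  have gb: "AE x in \<rho>. (norm (g x))\<^sup>2 \<le> (\<integral>u. (norm (d (x, u)))\<^sup>2 \<partial>unif)"
    using AEd
  proof eventually_elim
    case (elim x)
    from power_mono[OF unif.norm_integral_le_l2(3)[OF elim] norm_ge_zero, of 2]
    show ?case by (simp add: g_def l2_power2)
  qed
  have ig: "integrable \<rho> (\<lambda>x. (norm (g x))\<^sup>2)"
    by (rule Bochner_Integration.integrable_bound[OF ru.integrable_fst[OF id2]])
      (use gb in \<open>auto intro: order_trans[OF _ abs_ge_self]\<close>)
  then have gL: "g \<in> L2_fields \<rho>" by (simp add: L2_fields_def)
  have "(\<integral>x. (norm (g x))\<^sup>2 \<partial>\<rho>) \<le> (\<integral>x. (\<integral>u. (norm (d (x, u)))\<^sup>2 \<partial>unif) \<partial>\<rho>)"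
    by (rule integral_mono_AE[OF ig ru.integrable_fst[OF id2] gb])
  also have "\<dots> = (l2 (\<rho> \<Otimes>\<^sub>M unif) d)\<^sup>2"
    using ru.integral_fst[OF id2] by (simp add: l2_power2 split_beta')
  also have "l2 (\<rho> \<Otimes>\<^sub>M unif) d = l2 \<gamma> (\<lambda>p. fst p - snd p)"
    unfolding \<gamma>f by (subst l2_distr[OF pairm[OF f]]) (simp_all add: d_def l2_def norm_minus_commute)
  finally have gn: "L2_norm \<rho> g \<le> l2 \<gamma> (\<lambda>p. fst p - snd p)"
    unfolding L2_norm_def using real_sqrt_le_mono by fastforce
  show ?thesis
  proof (rule that[OF gL gn])
    fix \<nu> \<gamma>' assume \<nu>: "\<nu> \<in> P2" and \<gamma>': "\<gamma>' \<in> couplings \<rho> \<nu>"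
    obtain h where h[measurable]: "h \<in> borel_measurable (\<rho> \<Otimes>\<^sub>M unif)"
      and \<gamma>h: "\<gamma>' = distr (\<rho> \<Otimes>\<^sub>M unif) borel (\<lambda>p. (fst p, h p))"
      using coupling_realization[OF \<gamma>'] by blast
    \<comment> \<open>Two independent noises over one base point: \<open>Z\<close> consumes the
      first and \<open>Y\<close> the second, which makes them conditionally independent given
      \<open>X\<close>.\<close>
    define M where "M = (\<rho> \<Otimes>\<^sub>M unif) \<Otimes>\<^sub>M unif"
    interpret m: pair_prob_space "\<rho> \<Otimes>\<^sub>M unif" unif ..
    have pM: "prob_space M" unfolding M_def by (rule m.prob_space_axioms)
    have a1: "distr M (\<rho> \<Otimes>\<^sub>M unif) fst = \<rho> \<Otimes>\<^sub>M unif"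
      unfolding M_def by (rule unif.distr_pair_fst)
    have a2: "distr M (\<rho> \<Otimes>\<^sub>M unif) (\<lambda>w. (fst (fst w), snd w)) = \<rho> \<Otimes>\<^sub>M unif"
    proof -
      have "distr (\<rho> \<Otimes>\<^sub>M unif) \<rho> fst \<Otimes>\<^sub>M distr unif unif (\<lambda>u. u) =
          distr M (\<rho> \<Otimes>\<^sub>M unif) (\<lambda>(x, y). (fst x, y))"
        unfolding M_def by (rule pair_measure_distr) (auto intro!: unif.sigma_finite_measure_axioms simp: distr_id2)
      then show ?thesis by (simp add: unif.distr_pair_fst split_beta' distr_id2)
    qed
    have mf[measurable]: "fst \<in> M \<rightarrow>\<^sub>M \<rho> \<Otimes>\<^sub>M unif" "(\<lambda>w. (fst (fst w), snd w)) \<in> M \<rightarrow>\<^sub>M \<rho> \<Otimes>\<^sub>M unif"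
      unfolding M_def by measurable
    define X Y Z where "X w = fst (fst w)" "Y w = f (fst (fst w), snd w)" "Z w = h (fst w)" for w :: "('a \<times> real) \<times> real"
    have e1: "\<gamma> = distr M borel (\<lambda>w. (X w, Y w))"
      unfolding \<gamma>f X_Y_Z_def by (subst a2[symmetric], subst distr_distr[OF pairm[OF f] mf(2)]) (simp add: comp_def)
    have e2: "\<gamma>' = distr M borel (\<lambda>w. (X w, Z w))"
      unfolding \<gamma>h X_Y_Z_def by (subst a1[symmetric], subst distr_distr[OF pairm[OF h] mf(1)]) (simp add: comp_def)
    have sh: "sq_int (\<rho> \<Otimes>\<^sub>M unif) h" using sq(2)[OF h \<gamma>'[unfolded \<gamma>h] \<nu>] .
    have sX: "sq_int M X" unfolding X_Y_Z_def using sq_int_distr[OF mf(1), of fst] sqf(1) a1 by simp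
    have sZ: "sq_int M Z" unfolding X_Y_Z_def using sq_int_distr[OF mf(1), of h] sh a1 by simp
    have sY: "sq_int M Y" unfolding X_Y_Z_def using sq_int_distr[OF mf(2), of f] sqf(2) a2 by simp
    have int: "integrable M (\<lambda>(q, u). d (fst q, u) \<bullet> (h q - fst q))"
      using integrable_inner[OF sq_int_diff[OF sY sX] sq_int_diff[OF sZ sX]]
      by (simp add: X_Y_Z_def d_def split_beta')
    have "(\<integral>w. (Y w - X w) \<bullet> (Z w - X w) \<partial>M) = (\<integral>(q, u). d (fst q, u) \<bullet> (h q - fst q) \<partial>M)"
      by (simp add: X_Y_Z_def d_def split_beta')
    also have "\<dots> = (\<integral>q. (\<integral>u. d (fst q, u) \<bullet> (h q - fst q) \<partial>unif) \<partial>(\<rho> \<Otimes>\<^sub>M unif))"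
      unfolding M_def by (rule m.integral_fst[symmetric]) (use int M_def in simp)
    also have "\<dots> = (\<integral>q. g (fst q) \<bullet> (h q - fst q) \<partial>(\<rho> \<Otimes>\<^sub>M unif))"
    proof (rule integral_cong_AE)
      \<comment> \<open>Integrability of almost every fibre allows the factor that is constant in
        the second noise to leave the inner integral.\<close>
      have "AE q in \<rho> \<Otimes>\<^sub>M unif. sq_int unif (\<lambda>u. d (fst q, u))"
        using AEd by (subst (asm) unif.distr_pair_fst[symmetric, of \<rho>])
          (erule AE_distrD[rotated], simp)
      then show "AE q in \<rho> \<Otimes>\<^sub>M unif. (\<integral>u. d (fst q, u) \<bullet> (h q - fst q) \<partial>unif) = g (fst q) \<bullet> (h q - fst q)"
      proof eventually_elim
        case (elim q)
        from unif.norm_integral_le_l2(2)[OF this] show ?case by (simp add: g_def)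
      qed
    qed measurable
    also have "\<dots> = (\<integral>p. g (fst p) \<bullet> (snd p - fst p) \<partial>\<gamma>')"
      unfolding \<gamma>h
    proof (subst integral_distr[OF pairm[OF h]])
      have "g \<in> borel_measurable borel" using measurable_cong_sets[OF P(2) refl, of borel] \<open>g \<in> borel_measurable \<rho>\<close> by simp
      then show "(\<lambda>p. g (fst p) \<bullet> (snd p - fst p)) \<in> borel_measurable borel" by measurable
    qed simp
    finally show "\<exists>(M :: (('a \<times> real) \<times> real) measure) X Y Z. prob_space M \<and> sq_int M X \<and> sq_int M Y \<and> sq_int M Z \<and>
        \<gamma> = distr M borel (\<lambda>w. (X w, Y w)) \<and> \<gamma>' = distr M borel (\<lambda>w. (X w, Z w)) \<and>
        (\<integral>w. (Y w - X w) \<bullet> (Z w - X w) \<partial>M) = (\<integral>p. g (fst p) \<bullet> (snd p - fst p) \<partial>\<gamma>')"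
      using pM sX sY sZ e1 e2 by blast
  qed
qed

lemma distr_pair_marginals:
  fixes X :: "'a \<Rightarrow> 'b::euclidean_space" and Y :: "'a \<Rightarrow> 'c::euclidean_space"
  assumes [measurable]: "X \<in> borel_measurable M" "Y \<in> borel_measurable M"
  shows "distr (distr M borel (\<lambda>w. (X w, Y w))) borel fst = distr M borel X"
    "distr (distr M borel (\<lambda>w. (X w, Y w))) borel snd = distr M borel Y"
proof -
  have [measurable]: "(fst :: 'b \<times> 'c \<Rightarrow> 'b) \<in> borel \<rightarrow>\<^sub>M borel" "(snd :: 'b \<times> 'c \<Rightarrow> 'c) \<in> borel \<rightarrow>\<^sub>M borel"
    by (simp_all add: borel_prod[symmetric])
  show "distr (distr M borel (\<lambda>w. (X w, Y w))) borel fst = distr M borel X"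
    "distr (distr M borel (\<lambda>w. (X w, Y w))) borel snd = distr M borel Y"
    by (simp_all add: distr_distr comp_def)
qed

lemma W2_nonneg [simp]:
  assumes "\<mu> \<in> P2" "\<nu> \<in> P2"
  shows "0 \<le> W2 \<mu> \<nu>"
proof -
  obtain \<gamma> where "\<gamma> \<in> opt_couplings \<mu> \<nu>" using opt_couplings_nonempty[OF assms] by blast
  then show ?thesis by (simp add: opt_couplings_W2)
qed

lemma W2_commute_le:
  assumes "\<mu> \<in> P2" "\<nu> \<in> P2"
  shows "W2 \<mu> \<nu> \<le> W2 \<nu> \<mu>"
proof -
  obtain \<gamma> where \<gamma>: "\<gamma> \<in> opt_couplings \<nu> \<mu>" using opt_couplings_nonempty[OF assms(2,1)] by blast
  note c = couplings_distr[OF opt_couplings_sub[OF \<gamma>]]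
  from W2_le[OF c(1,6,5)] show ?thesis
    by (simp add: c opt_couplings_W2[OF \<gamma>] l2_minus_commute[of \<gamma> snd fst])
qed

lemma W2_commute: "\<mu> \<in> P2 \<Longrightarrow> \<nu> \<in> P2 \<Longrightarrow> W2 \<mu> \<nu> = W2 \<nu> \<mu>"
  by (intro antisym W2_commute_le)

text \<open>The construction of \<open>barycentric_gluing\<close> with the vector field forgotten
  and the three marginals made explicit.\<close>

lemma gluing:
  fixes \<rho> :: "'a::euclidean_space measure"
  assumes P: "\<rho> \<in> P2" "\<mu> \<in> P2" "\<nu> \<in> P2" and c: "\<gamma> \<in> couplings \<rho> \<mu>" "\<gamma>' \<in> couplings \<rho> \<nu>"
  obtains M :: "(('a \<times> real) \<times> real) measure" and X Y Z where "prob_space M"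
    "sq_int M X" "sq_int M Y" "sq_int M Z"
    "\<gamma> = distr M borel (\<lambda>w. (X w, Y w))" "\<gamma>' = distr M borel (\<lambda>w. (X w, Z w))"
    "\<rho> = distr M borel X" "\<mu> = distr M borel Y" "\<nu> = distr M borel Z"
proof -
  obtain g where g: "\<exists>(M :: (('a \<times> real) \<times> real) measure) X Y Z. prob_space M \<and> sq_int M X \<and> sq_int M Y \<and> sq_int M Z \<and>
        \<gamma> = distr M borel (\<lambda>w. (X w, Y w)) \<and> \<gamma>' = distr M borel (\<lambda>w. (X w, Z w)) \<and>
        (\<integral>w. (Y w - X w) \<bullet> (Z w - X w) \<partial>M) = (\<integral>p. g (fst p) \<bullet> (snd p - fst p) \<partial>\<gamma>')"
  proof (rule barycentric_gluing[OF P(1,2) c(1)])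
    fix g
    assume "\<And>\<nu> \<gamma>'. \<nu> \<in> P2 \<Longrightarrow> \<gamma>' \<in> couplings \<rho> \<nu> \<Longrightarrow>
      \<exists>(M :: (('a \<times> real) \<times> real) measure) X Y Z. prob_space M \<and> sq_int M X \<and> sq_int M Y \<and> sq_int M Z \<and>
        \<gamma> = distr M borel (\<lambda>w. (X w, Y w)) \<and> \<gamma>' = distr M borel (\<lambda>w. (X w, Z w)) \<and>
        (\<integral>w. (Y w - X w) \<bullet> (Z w - X w) \<partial>M) = (\<integral>p. g (fst p) \<bullet> (snd p - fst p) \<partial>\<gamma>')"
    from that[OF this[OF P(3) c(2)]] show thesis .
  qed
  then obtain M :: "(('a \<times> real) \<times> real) measure" and X Y Z where M: "prob_space M"
    "sq_int M X" "sq_int M Y" "sq_int M Z"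
    "\<gamma> = distr M borel (\<lambda>w. (X w, Y w))" "\<gamma>' = distr M borel (\<lambda>w. (X w, Z w))"
    by blast
  have m: "X \<in> borel_measurable M" "Y \<in> borel_measurable M" "Z \<in> borel_measurable M"
    using M(2-4) by (auto simp: sq_int_def)
  show ?thesis
  proof (rule that[OF M])
    show "\<rho> = distr M borel X" "\<mu> = distr M borel Y" "\<nu> = distr M borel Z"
      using couplings_distr(3,4)[OF c(1)] couplings_distr(4)[OF c(2)]
      unfolding M(5,6) distr_pair_marginals[OF m(1,2)] distr_pair_marginals[OF m(1,3)] by simp_all
  qed
qed

text \<open>Both optimal couplings are written with the middle measure \<rho> as first marginal, so
  that gluing applies; symmetry of \<open>W2\<close> turns one of the distances around.\<close>

lemma W2_triangle:
  assumes "\<mu> \<in> P2" "\<rho> \<in> P2" "\<nu> \<in> P2"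
  shows "W2 \<mu> \<nu> \<le> W2 \<mu> \<rho> + W2 \<rho> \<nu>"
proof -
  obtain \<gamma> \<gamma>' where \<gamma>: "\<gamma> \<in> opt_couplings \<rho> \<mu>" and \<gamma>': "\<gamma>' \<in> opt_couplings \<rho> \<nu>"
    using opt_couplings_nonempty assms by blast
  obtain M :: "(('a \<times> real) \<times> real) measure" and X Y Z where M: "prob_space M" "sq_int M X" "sq_int M Y" "sq_int M Z"
    and e: "\<gamma> = distr M borel (\<lambda>w. (X w, Y w))" "\<gamma>' = distr M borel (\<lambda>w. (X w, Z w))"
    and l: "\<mu> = distr M borel Y" "\<nu> = distr M borel Z"
    by (rule gluing[OF assms(2,1,3) opt_couplings_sub[OF \<gamma>] opt_couplings_sub[OF \<gamma>']]) blast
  have m: "X \<in> borel_measurable M" "Y \<in> borel_measurable M" "Z \<in> borel_measurable M"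
    using M(2-4) by (auto simp: sq_int_def)
  have "W2 \<mu> \<nu> \<le> l2 M (\<lambda>w. Y w - Z w)" using W2_le[OF M(1) m(2,3)] l by simp
  also have "\<dots> \<le> l2 M (\<lambda>w. Y w - X w) + l2 M (\<lambda>w. X w - Z w)"
    using M(2-4) by (intro l2_triangle)
  also have "l2 M (\<lambda>w. Y w - X w) = W2 \<mu> \<rho>"
    using opt_couplings_W2[OF \<gamma>] l2_distr_pair[OF m(1,2)] W2_commute[OF assms(1,2)]
    unfolding e(1)[symmetric] l2_minus_commute[of M Y] by simp
  also have "l2 M (\<lambda>w. X w - Z w) = W2 \<rho> \<nu>"
    using opt_couplings_W2[OF \<gamma>'] l2_distr_pair[OF m(1,3)] unfolding e(2)[symmetric] by simp
  finally show ?thesis .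
qed

subsection \<open>Completeness of the Wasserstein space\<close>

lemma nn_integral_power2_l2:
  "sq_int M X \<Longrightarrow> (\<integral>\<^sup>+w. ennreal ((norm (X w))\<^sup>2) \<partial>M) = ennreal ((l2 M X)\<^sup>2)"
  by (simp add: sq_int_def l2_power2 nn_integral_eq_integral)

lemma sq_int_of_nn_integral_le:
  assumes X: "X \<in> borel_measurable M" and le: "(\<integral>\<^sup>+w. ennreal ((norm (X w))\<^sup>2) \<partial>M) \<le> ennreal (c\<^sup>2)" and c: "0 \<le> c"
  shows "sq_int M X" "l2 M X \<le> c"
proof -
  have "(\<lambda>w. (norm (X w))\<^sup>2) \<in> borel_measurable M" using X by measurable
  moreover have "(\<integral>\<^sup>+w. ennreal (norm ((norm (X w))\<^sup>2)) \<partial>M) < \<infinity>"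
    using le by (auto intro: le_less_trans)
  ultimately show s: "sq_int M X" unfolding sq_int_def using X by (simp add: integrable_iff_bounded)
  have "ennreal ((l2 M X)\<^sup>2) \<le> ennreal (c\<^sup>2)" using le nn_integral_power2_l2[OF s] by simp
  then show "l2 M X \<le> c" using c by (simp add: ennreal_le_iff power2_le_iff_abs_le)
qed

lemma l2_sum_telescope:
  assumes "\<And>n. sq_int M (X n)" "n \<le> m"
  shows "l2 M (\<lambda>w. X m w - X n w) \<le> (\<Sum>k=n..<m. l2 M (\<lambda>w. X k w - X (Suc k) w))"
  using assms(2)
proof (induction m rule: dec_induct)
  case base
  then show ?case by (simp add: l2_def)
next
  case (step m)
  have "l2 M (\<lambda>w. X (Suc m) w - X n w) \<le> l2 M (\<lambda>w. X (Suc m) w - X m w) + l2 M (\<lambda>w. X m w - X n w)"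
    by (intro l2_triangle assms)
  with step show ?case by (simp add: l2_minus_commute[of M "X (Suc m)"])
qed

text \<open>Riesz-Fischer. On a probability space the \<open>L2\<close> norm dominates the
  \<open>L1\<close> norm, so the increments are summable almost everywhere; Fatou's lemma then
  bounds the distance from \<open>X n\<close> to the limit by the tail \<open>t n\<close> of the
  series.\<close>

lemma (in prob_space) l2_complete:
  fixes X :: "nat \<Rightarrow> 'a \<Rightarrow> 'b::euclidean_space"
  assumes X: "\<And>n. sq_int M (X n)" and sum: "summable (\<lambda>n. l2 M (\<lambda>w. X n w - X (Suc n) w))"
  obtains Y where "sq_int M Y" "(\<lambda>n. l2 M (\<lambda>w. X n w - Y w)) \<longlonglongrightarrow> 0"
proof -
  define a where "a n = l2 M (\<lambda>w. X n w - X (Suc n) w)" for n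
  have sa: "summable a" using sum by (simp add: a_def[abs_def])
  have a0: "0 \<le> a n" for n by (simp add: a_def)
  have [measurable]: "X n \<in> borel_measurable M" for n using X by (simp add: sq_int_def)
  have dX: "sq_int M (\<lambda>w. X n w - X (Suc n) w)" for n using X by auto
  \<comment> \<open>\<open>lim\<close> is total and preserves measurability; its value on the null
    set without convergence does not affect the norms.\<close>
  define Y where "Y w = lim (\<lambda>n. X n w)" for w
  have [measurable]: "Y \<in> borel_measurable M" unfolding Y_def by measurable
  have "(\<integral>\<^sup>+w. (\<Sum>n. ennreal (norm (X n w - X (Suc n) w))) \<partial>M) = (\<Sum>n. \<integral>\<^sup>+w. ennreal (norm (X n w - X (Suc n) w)) \<partial>M)"
    by (rule nn_integral_suminf) measurable
  also have "\<dots> \<le> (\<Sum>n. ennreal (a n))"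
  proof (intro suminf_le allI)
    fix n
    have "(\<integral>\<^sup>+w. ennreal (norm (X n w - X (Suc n) w)) \<partial>M) = ennreal (\<integral>w. norm (X n w - X (Suc n) w) \<partial>M)"
      using norm_integral_le_l2(2)[OF dX] by (intro nn_integral_eq_integral) auto
    then show "(\<integral>\<^sup>+w. ennreal (norm (X n w - X (Suc n) w)) \<partial>M) \<le> ennreal (a n)"
      unfolding a_def using norm_integral_le_l2(1)[OF dX, of n] by (simp add: ennreal_leI)
  qed auto
  also have "\<dots> = ennreal (suminf a)" by (rule suminf_ennreal2[OF a0 sa])
  also have "\<dots> < \<infinity>" by simp
  finally have "AE w in M. (\<Sum>n. ennreal (norm (X n w - X (Suc n) w))) \<noteq> \<infinity>"
    by (intro nn_integral_PInf_AE) auto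
  then have conv: "AE w in M. (\<lambda>n. X n w) \<longlonglongrightarrow> Y w"
  proof eventually_elim
    case (elim w)
    have "summable (\<lambda>n. norm (X n w - X (Suc n) w))"
      using elim by (intro summable_suminf_not_top) auto
    then have "summable (\<lambda>n. X n w - X (Suc n) w)" by (rule summable_norm_cancel)
    then have "(\<lambda>n. \<Sum>i<n. X i w - X (Suc i) w) \<longlonglongrightarrow> (\<Sum>n. X n w - X (Suc n) w)" by (rule summable_LIMSEQ)
    moreover have "(\<Sum>i<n. X i w - X (Suc i) w) = X 0 w - X n w" for n by (induction n) auto
    ultimately have "(\<lambda>n. X 0 w - X n w) \<longlonglongrightarrow> (\<Sum>n. X n w - X (Suc n) w)" by simp
    from tendsto_diff[OF tendsto_const[of "X 0 w"] this] have "convergent (\<lambda>n. X n w)"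
      by (auto simp: convergent_def)
    then show ?case unfolding Y_def by (simp add: convergent_LIMSEQ_iff)
  qed
  define t where "t n = (\<Sum>k. a (k + n))" for n
  have t0: "0 \<le> t n" for n unfolding t_def using a0 sa by (intro suminf_nonneg) (auto simp: summable_iff_shift)
  have tail: "l2 M (\<lambda>w. X m w - X n w) \<le> t n" if "n \<le> m" for n m
  proof -
    have "l2 M (\<lambda>w. X m w - X n w) \<le> (\<Sum>k=n..<m. a k)"
      unfolding a_def by (rule l2_sum_telescope[OF X that])
    also have "\<dots> = (\<Sum>k<m - n. a (k + n))"
      using that by (intro sum.reindex_bij_witness[of _ "\<lambda>k. k + n" "\<lambda>k. k - n"]) auto
    also have "\<dots> \<le> t n" unfolding t_def
      using a0 sa by (intro sum_le_suminf) (auto simp: summable_iff_shift)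
    finally show ?thesis .
  qed
  have lim_le: "(\<integral>\<^sup>+w. ennreal ((norm (Y w - X n w))\<^sup>2) \<partial>M) \<le> ennreal ((t n)\<^sup>2)" for n
  proof -
    have "(\<integral>\<^sup>+w. ennreal ((norm (Y w - X n w))\<^sup>2) \<partial>M) = (\<integral>\<^sup>+w. liminf (\<lambda>m. ennreal ((norm (X m w - X n w))\<^sup>2)) \<partial>M)"
      using conv
    proof (intro nn_integral_cong_AE, eventually_elim)
      case (elim w)
      have "(\<lambda>m. ennreal ((norm (X m w - X n w))\<^sup>2)) \<longlonglongrightarrow> ennreal ((norm (Y w - X n w))\<^sup>2)"
        by (intro tendsto_intros tendsto_ennrealI elim)
      from lim_imp_Liminf[OF sequentially_bot this] show ?case by simp
    qed
    also have "\<dots> \<le> liminf (\<lambda>m. \<integral>\<^sup>+w. ennreal ((norm (X m w - X n w))\<^sup>2) \<partial>M)"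
      by (rule nn_integral_liminf) measurable
    also have "\<dots> \<le> liminf (\<lambda>m. ennreal ((t n)\<^sup>2))"
    proof (rule Liminf_mono)
      show "\<forall>\<^sub>F m in sequentially. (\<integral>\<^sup>+w. ennreal ((norm (X m w - X n w))\<^sup>2) \<partial>M) \<le> ennreal ((t n)\<^sup>2)"
        using eventually_ge_at_top[of n]
      proof eventually_elim
        case (elim m)
        then show ?case using nn_integral_power2_l2[OF sq_int_diff[OF X X]] power_mono[OF tail[OF elim] l2_nonneg, of 2]
          by (simp add: ennreal_leI)
      qed
    qed
    finally show ?thesis by (simp add: Liminf_const)
  qed
  note d = sq_int_of_nn_integral_le[OF _ lim_le t0]
  have "sq_int M (\<lambda>w. (Y w - X 0 w) + X 0 w)" by (intro sq_int_add d(1) X) measurable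
  then have Y: "sq_int M Y" by simp
  have "t \<longlonglongrightarrow> 0" unfolding t_def using suminf_exist_split2[OF sa] .
  then have "(\<lambda>n. l2 M (\<lambda>w. X n w - Y w)) \<longlonglongrightarrow> 0"
  proof (rule tendsto_sandwich[OF _ _ tendsto_const, rotated 2])
    have "l2 M (\<lambda>w. X n w - Y w) \<le> t n" for n
      by (subst l2_minus_commute) (rule d(2), measurable)
    then show "\<forall>\<^sub>F n in sequentially. l2 M (\<lambda>w. X n w - Y w) \<le> t n" by simp
  qed simp
  then show ?thesis using that Y by blast
qed

section \<open>Chains of couplings driven by independent noise\<close>

abbreviation noise :: "real stream measure" where
  "noise \<equiv> stream_space unif"

interpretation noise: prob_space noise
  by (rule unif.prob_space_stream_space)

lemma space_noise [simp]: "space noise = UNIV"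
  by (simp add: space_stream_space)

lemma distr_shd_noise: "distr noise unif shd = unif"
proof (rule measure_eqI)
  fix A assume "A \<in> sets (distr noise unif shd)"
  then have [measurable]: "A \<in> sets borel" by simp
  have "emeasure (distr noise unif shd) A = emeasure noise {s \<in> space noise. shd s \<in> A}"
    by (subst emeasure_distr) (auto intro: arg_cong[where f = "emeasure noise"])
  also have "\<dots> = (\<integral>\<^sup>+u. emeasure noise {s \<in> space noise. u ## s \<in> {s \<in> space noise. shd s \<in> A}} \<partial>unif)"
    by (rule unif.emeasure_stream_space) measurable
  also have "\<dots> = (\<integral>\<^sup>+u. indicator A u \<partial>unif)"
    using noise.emeasure_space_1 by (intro nn_integral_cong) (simp split: split_indicator)
  finally show "emeasure (distr noise unif shd) A = emeasure unif A" by simp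
qed simp

text \<open>The step consumes the head of the stream. The new position depends on the old position
  and the head only, hence is independent of the tail, which is again a stream of independent
  uniform variables; so the step can be iterated.\<close>

lemma noise_step:
  fixes f :: "'a::euclidean_space \<times> real \<Rightarrow> 'a"
  assumes "prob_space \<mu>" and s\<mu>: "sets \<mu> = sets borel" and f[measurable]: "f \<in> borel_measurable (\<mu> \<Otimes>\<^sub>M unif)"
  shows "distr (\<mu> \<Otimes>\<^sub>M noise) (borel \<Otimes>\<^sub>M noise) (\<lambda>(x, s). (f (x, shd s), stl s)) = distr (\<mu> \<Otimes>\<^sub>M unif) borel f \<Otimes>\<^sub>M noise"
proof -
  let ?\<nu> = "distr (\<mu> \<Otimes>\<^sub>M unif) borel f"
  define L where "L = distr (\<mu> \<Otimes>\<^sub>M noise) (borel \<Otimes>\<^sub>M noise) (\<lambda>(x, s). (f (x, shd s), stl s))"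
  interpret mu: prob_space \<mu> by fact
  interpret mu_u: pair_prob_space \<mu> unif ..
  interpret mu_n: pair_prob_space \<mu> noise ..
  interpret nu: prob_space ?\<nu> by (rule mu_u.prob_space_distr) measurable
  have sh: "(\<lambda>p. (fst p, shd (snd p))) \<in> \<mu> \<Otimes>\<^sub>M noise \<rightarrow>\<^sub>M \<mu> \<Otimes>\<^sub>M unif" by simp
  have mf: "(\<lambda>p. f (fst p, shd (snd p))) \<in> borel_measurable (\<mu> \<Otimes>\<^sub>M noise)"
    using measurable_compose[OF sh f] .
  have ms: "(\<lambda>p. stl (snd p)) \<in> \<mu> \<Otimes>\<^sub>M noise \<rightarrow>\<^sub>M noise" by measurable
  have m: "(\<lambda>(x, s). (f (x, shd s), stl s)) \<in> \<mu> \<Otimes>\<^sub>M noise \<rightarrow>\<^sub>M borel \<Otimes>\<^sub>M noise"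
    using measurable_Pair[OF mf ms] by (simp add: split_beta')
  have "?\<nu> \<Otimes>\<^sub>M noise = L"
  proof (rule pair_measure_eqI)
    show "sets (?\<nu> \<Otimes>\<^sub>M noise) = sets L" by (simp add: L_def cong: sets_pair_measure_cong)
    fix A B assume A: "A \<in> sets ?\<nu>" and B[measurable]: "B \<in> sets noise"
    from A have [measurable]: "A \<in> sets borel" by simp
    have V: "{p \<in> space (\<mu> \<Otimes>\<^sub>M noise). f (fst p, shd (snd p)) \<in> A \<and> stl (snd p) \<in> B} \<in> sets (\<mu> \<Otimes>\<^sub>M noise)"
      using mf ms by measurable
    have "emeasure L (A \<times> B) = emeasure (\<mu> \<Otimes>\<^sub>M noise) {p \<in> space (\<mu> \<Otimes>\<^sub>M noise). f (fst p, shd (snd p)) \<in> A \<and> stl (snd p) \<in> B}"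
      unfolding L_def by (subst emeasure_distr[OF m]) (auto intro: arg_cong[where f = "emeasure (\<mu> \<Otimes>\<^sub>M noise)"])
    also have "\<dots> = (\<integral>\<^sup>+x. emeasure noise {s \<in> space noise. f (x, shd s) \<in> A \<and> stl s \<in> B} \<partial>\<mu>)"
      by (subst noise.emeasure_pair_measure_alt[OF V])
        (auto intro!: nn_integral_cong arg_cong[where f = "emeasure noise"] simp: space_pair_measure)
    also have "\<dots> = (\<integral>\<^sup>+x. \<integral>\<^sup>+u. indicator {q \<in> space (\<mu> \<Otimes>\<^sub>M unif). f q \<in> A} (x, u) * emeasure noise B \<partial>unif \<partial>\<mu>)"
    proof (intro nn_integral_cong)
      fix x assume x: "x \<in> space \<mu>"
      have [measurable]: "(\<lambda>u. f (x, u)) \<in> borel_measurable unif"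
        using measurable_compose[OF measurable_Pair1'[OF x] f] .
      have "emeasure noise {s \<in> space noise. f (x, shd s) \<in> A \<and> stl s \<in> B} =
          (\<integral>\<^sup>+u. emeasure noise {s \<in> space noise. u ## s \<in> {s \<in> space noise. f (x, shd s) \<in> A \<and> stl s \<in> B}} \<partial>unif)"
        by (rule unif.emeasure_stream_space) measurable
      also have "\<dots> = (\<integral>\<^sup>+u. indicator {q \<in> space (\<mu> \<Otimes>\<^sub>M unif). f q \<in> A} (x, u) * emeasure noise B \<partial>unif)"
        using x by (intro nn_integral_cong) (auto split: split_indicator simp: space_pair_measure)
      finally show "emeasure noise {s \<in> space noise. f (x, shd s) \<in> A \<and> stl s \<in> B} = \<dots>" .
    qed
    also have "\<dots> = (\<integral>\<^sup>+q. indicator {q \<in> space (\<mu> \<Otimes>\<^sub>M unif). f q \<in> A} q * emeasure noise B \<partial>(\<mu> \<Otimes>\<^sub>M unif))"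
      by (rule unif.nn_integral_fst) measurable
    also have "\<dots> = emeasure ?\<nu> A * emeasure noise B"
    proof -
      have "{q \<in> space (\<mu> \<Otimes>\<^sub>M unif). f q \<in> A} = f -` A \<inter> space (\<mu> \<Otimes>\<^sub>M unif)" by auto
      moreover have "f -` A \<inter> space (\<mu> \<Otimes>\<^sub>M unif) \<in> sets (\<mu> \<Otimes>\<^sub>M unif)" by (rule measurable_sets[OF f]) simp
      ultimately show ?thesis by (simp add: nn_integral_multc emeasure_distr)
    qed
    finally show "emeasure ?\<nu> A * emeasure noise B = emeasure L (A \<times> B)" by simp
  qed (use nu.sigma_finite_measure_axioms noise.sigma_finite_measure_axioms in auto)
  then show ?thesis by (simp add: L_def)
qed

lemma distr_pair_shd_noise:
  assumes "prob_space \<mu>"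
  shows "distr (\<mu> \<Otimes>\<^sub>M noise) (\<mu> \<Otimes>\<^sub>M unif) (\<lambda>(x, s). (x, shd s)) = \<mu> \<Otimes>\<^sub>M unif"
proof -
  have "distr \<mu> \<mu> (\<lambda>x. x) \<Otimes>\<^sub>M distr noise unif shd = distr (\<mu> \<Otimes>\<^sub>M noise) (\<mu> \<Otimes>\<^sub>M unif) (\<lambda>(x, s). (x, shd s))"
    by (rule pair_measure_distr) (auto simp: distr_shd_noise intro!: unif.sigma_finite_measure_axioms)
  then show ?thesis
    by (simp add: distr_shd_noise distr_id2)
qed

text \<open>Optimal couplings of consecutive measures are realised as one Markov chain, whose next
  position is \<open>f n\<close> of the current one and fresh noise. The \<open>L2\<close> norm of
  each increment then equals the \<open>W2\<close> distance, the question becomes completeness of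
  \<open>L2\<close>, and the law of the limit variable is the limit measure.\<close>

lemma W2_complete:
  fixes \<nu> :: "nat \<Rightarrow> 'a::euclidean_space measure"
  assumes P: "\<And>n. \<nu> n \<in> P2" and sum: "summable (\<lambda>n. W2 (\<nu> n) (\<nu> (Suc n)))"
  obtains \<mu> where "\<mu> \<in> P2" "(\<lambda>n. W2 (\<nu> n) \<mu>) \<longlonglongrightarrow> 0"
proof -
  have p: "prob_space (\<nu> n)" "sets (\<nu> n) = sets borel" for n using P[of n] by (auto simp: P2_iff)
  have "\<exists>f. f \<in> borel_measurable (\<nu> n \<Otimes>\<^sub>M unif) \<and>
      distr (\<nu> n \<Otimes>\<^sub>M unif) borel (\<lambda>p. (fst p, f p)) \<in> opt_couplings (\<nu> n) (\<nu> (Suc n))" for n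
  proof -
    obtain \<gamma> where \<gamma>: "\<gamma> \<in> opt_couplings (\<nu> n) (\<nu> (Suc n))" using opt_couplings_nonempty[OF P P] by blast
    show ?thesis by (rule coupling_realization[OF opt_couplings_sub[OF \<gamma>]]) (use \<gamma> in auto)
  qed
  then obtain f where f: "\<And>n. f n \<in> borel_measurable (\<nu> n \<Otimes>\<^sub>M unif)"
    and opt: "\<And>n. distr (\<nu> n \<Otimes>\<^sub>M unif) borel (\<lambda>p. (fst p, f n p)) \<in> opt_couplings (\<nu> n) (\<nu> (Suc n))"
    by metis
  have [measurable]: "f n \<in> borel_measurable (borel \<Otimes>\<^sub>M unif)" for n
    using f[of n] measurable_cong_sets[OF sets_pair_measure_cong[OF p(2)[of n] refl] refl] by blast
  have ffst: "fst \<in> borel_measurable (\<nu> n \<Otimes>\<^sub>M unif)" for n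
    using measurable_fst[of "\<nu> n" unif] measurable_cong_sets[OF refl p(2)] by blast
  have law_f: "distr (\<nu> n \<Otimes>\<^sub>M unif) borel (f n) = \<nu> (Suc n)" for n
    using couplings_distr(4)[OF opt_couplings_sub[OF opt[of n]]] distr_pair_marginals(2)[OF ffst f] by simp
  have dist_f: "l2 (\<nu> n \<Otimes>\<^sub>M unif) (\<lambda>p. fst p - f n p) = W2 (\<nu> n) (\<nu> (Suc n))" for n
    using opt_couplings_W2[OF opt[of n]] l2_distr_pair[OF ffst f] by simp
  define M where "M = \<nu> 0 \<Otimes>\<^sub>M noise"
  interpret n0: prob_space "\<nu> 0" by (rule p)
  interpret n0n: pair_prob_space "\<nu> 0" noise ..
  interpret M: prob_space M unfolding M_def by (rule n0n.prob_space_axioms)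
  define T where "T n = (\<lambda>(x, s). (f n (x, shd s), stl s))" for n
  have [measurable]: "T n \<in> borel \<Otimes>\<^sub>M noise \<rightarrow>\<^sub>M borel \<Otimes>\<^sub>M noise" for n unfolding T_def by measurable
  define S where "S = rec_nat (\<lambda>p. p) (\<lambda>n S p. T n (S p))"
  have S0: "S 0 = (\<lambda>p. p)" and SS: "S (Suc n) = (\<lambda>p. T n (S n p))" for n by (simp_all add: S_def)
  note M_sets = sets_pair_measure_cong[OF p(2)[of 0] refl, of noise, folded M_def]
  have Sm[measurable]: "S n \<in> M \<rightarrow>\<^sub>M borel \<Otimes>\<^sub>M noise" for n
  proof (induction n)
    case 0
    show ?case unfolding S0 measurable_cong_sets[OF M_sets refl] by simp
  next
    case (Suc n)
    then show ?case unfolding SS by measurable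
  qed
  have law_S: "distr M (borel \<Otimes>\<^sub>M noise) (S n) = \<nu> n \<Otimes>\<^sub>M noise" for n
  proof (induction n)
    case 0
    show ?case unfolding S0 by (subst distr_id2) (simp_all add: M_sets, simp add: M_def)
  next
    case (Suc n)
    have "distr M (borel \<Otimes>\<^sub>M noise) (S (Suc n)) = distr (distr M (borel \<Otimes>\<^sub>M noise) (S n)) (borel \<Otimes>\<^sub>M noise) (T n)"
      unfolding SS by (subst distr_distr) (auto simp: comp_def)
    also have "\<dots> = \<nu> (Suc n) \<Otimes>\<^sub>M noise"
      unfolding Suc T_def using noise_step[OF p f] law_f by simp
    finally show ?case .
  qed
  define X where "X n p = fst (S n p)" for n p
  have Xm[measurable]: "X n \<in> borel_measurable M" for n unfolding X_def by measurable
  have law_X: "distr M borel (X n) = \<nu> n" for n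
  proof -
    have "distr M borel (X n) = distr (\<nu> n \<Otimes>\<^sub>M noise) borel fst"
      unfolding X_def by (subst law_S[symmetric], subst distr_distr) (auto simp: comp_def)
    also have "\<dots> = distr (\<nu> n \<Otimes>\<^sub>M noise) (\<nu> n) fst"
      by (rule distr_cong) (simp_all add: p)
    finally show ?thesis by (simp add: noise.distr_pair_fst)
  qed
  have X: "sq_int M (X n)" for n
    using P[of n] distr_in_P2_iff[OF M.prob_space_axioms Xm[of n]] by (simp add: law_X)
  have "l2 M (\<lambda>p. X n p - X (Suc n) p) = W2 (\<nu> n) (\<nu> (Suc n))" for n
  proof -
    have "l2 M (\<lambda>p. X n p - X (Suc n) p) = l2 M (\<lambda>p. (\<lambda>q. fst q - f n (fst q, shd (snd q))) (S n p))"
      by (simp add: X_def SS T_def split_beta')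
    also have "\<dots> = l2 (\<nu> n \<Otimes>\<^sub>M noise) (\<lambda>q. fst q - f n (fst q, shd (snd q)))"
      by (subst law_S[symmetric], rule l2_distr[symmetric]) measurable
    also have "\<dots> = l2 (\<nu> n \<Otimes>\<^sub>M noise) (\<lambda>q. (\<lambda>p. fst p - f n p) ((\<lambda>(x, s). (x, shd s)) q))"
      by (simp add: split_beta')
    also have "\<dots> = l2 (\<nu> n \<Otimes>\<^sub>M unif) (\<lambda>p. fst p - f n p)"
      by (subst distr_pair_shd_noise[OF p(1), symmetric], rule l2_distr[symmetric]) (use f ffst in \<open>measurable\<close>)
    finally show ?thesis by (simp add: dist_f)
  qed
  then obtain Y where Y: "sq_int M Y" "(\<lambda>n. l2 M (\<lambda>w. X n w - Y w)) \<longlonglongrightarrow> 0"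
    using M.l2_complete[of X] X sum by auto
  have Ym: "Y \<in> borel_measurable M" using Y by (simp add: sq_int_def)
  have PY: "distr M borel Y \<in> P2" using distr_in_P2_iff[OF M.prob_space_axioms Ym] Y by simp
  have "W2 (\<nu> n) (distr M borel Y) \<le> l2 M (\<lambda>w. X n w - Y w)" for n
    using W2_le[OF M.prob_space_axioms Xm[of n] Ym] by (simp add: law_X)
  then have "(\<lambda>n. W2 (\<nu> n) (distr M borel Y)) \<longlonglongrightarrow> 0"
    by (intro tendsto_sandwich[OF _ _ tendsto_const Y(2)]) (use P PY in auto)
  with that PY show ?thesis by blast
qed

subsection \<open>Generalised geodesics of random variables\<close>

lemma W2_self:
  assumes "\<mu> \<in> P2"
  shows "W2 \<mu> \<mu> = 0"
proof -
  have P: "prob_space \<mu>" "sets \<mu> = sets borel" "sq_int \<mu> (\<lambda>x. x)" using assms by (auto simp: P2_iff)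
  have "(\<lambda>x. x) \<in> borel_measurable \<mu>" using P(3) by (simp add: sq_int_def)
  from W2_le[OF P(1) this this] have "W2 \<mu> \<mu> \<le> 0"
    using distr_id2[OF P(2)[symmetric]] by (simp add: l2_def)
  then show ?thesis using W2_nonneg[OF assms assms] by simp
qed

text \<open>Its cost is 0. It makes a geodesic that starts at its own base a special case of a
  generalised geodesic.\<close>

lemma diagonal_opt_coupling:
  assumes "prob_space M" "X \<in> borel_measurable M"
  shows "distr M borel (\<lambda>w. (X w, X w)) \<in> opt_couplings (distr M borel X) (distr M borel X)"
  using distr_pair_couplings[OF assms(1,2,2)] transport_cost_distr[OF assms(2,2)]
  by (simp add: opt_couplings_def transport_cost_nonneg l2_def)

lemma borel_measurable_Pair3:
  fixes X Y Z :: "'b \<Rightarrow> 'a::euclidean_space"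
  assumes "X \<in> borel_measurable M" "Y \<in> borel_measurable M" "Z \<in> borel_measurable M"
  shows "(\<lambda>w. (X w, Y w, Z w)) \<in> borel_measurable M"
  using assms by (intro borel_measurable_Pair)

lemma triple_geodesic_plan:
  fixes X Y Z :: "'b \<Rightarrow> 'a::euclidean_space"
  assumes M: "prob_space M" and X: "X \<in> borel_measurable M" and Y: "Y \<in> borel_measurable M" and Z: "Z \<in> borel_measurable M"
    and o: "distr M borel (\<lambda>w. (X w, Y w)) \<in> opt_couplings \<rho> \<nu>0" "distr M borel (\<lambda>w. (X w, Z w)) \<in> opt_couplings \<rho> \<nu>1"
  defines "\<Psi> \<equiv> distr M borel (\<lambda>w. (X w, Y w, Z w))"
  shows "\<Psi> \<in> geodesic_plans \<rho> \<nu>0 \<nu>1"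
    and "gen_geodesic \<Psi> t = distr M borel (\<lambda>w. (1 - t) *\<^sub>R Y w + t *\<^sub>R Z w)"
    and "(\<integral>p. (case p of (x, y, z) \<Rightarrow> (norm (z - y))\<^sup>2) \<partial>\<Psi>) = (l2 M (\<lambda>w. Z w - Y w))\<^sup>2"
proof -
  note m = borel_measurable_Pair3[OF X Y Z]
  have c: "continuous_on UNIV (\<lambda>p::'a\<times>'a\<times>'a. fst p)" "continuous_on UNIV (\<lambda>p::'a\<times>'a\<times>'a. fst (snd p))"
    "continuous_on UNIV (\<lambda>p::'a\<times>'a\<times>'a. snd (snd p))" by (intro continuous_intros)+
  note b[measurable] = borel_measurable_continuous_onI[OF c(1)] borel_measurable_continuous_onI[OF c(2)]
    borel_measurable_continuous_onI[OF c(3)]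
  have d: "distr \<Psi> borel h = distr M borel (\<lambda>w. h (X w, Y w, Z w))" if "h \<in> borel_measurable borel" for h :: "'a \<times> 'a \<times> 'a \<Rightarrow> 'c::topological_space"
    unfolding \<Psi>_def using that m by (simp add: distr_distr comp_def)
  have ma: "\<rho> = distr M borel X" "\<nu>0 = distr M borel Y" "\<nu>1 = distr M borel Z"
    using couplings_distr(3,4)[OF opt_couplings_sub[OF o(1)]] couplings_distr(4)[OF opt_couplings_sub[OF o(2)]]
    unfolding distr_pair_marginals[OF X Y] distr_pair_marginals[OF X Z] by simp_all
  have "prob_space \<Psi>" unfolding \<Psi>_def by (rule prob_space.prob_space_distr[OF M m])
  moreover have "sets \<Psi> = sets borel" by (simp add: \<Psi>_def)
  moreover have "distr \<Psi> borel (\<lambda>(x, y, z). x) = \<rho>" "distr \<Psi> borel (\<lambda>(x, y, z). y) = \<nu>0" "distr \<Psi> borel (\<lambda>(x, y, z). z) = \<nu>1"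
    unfolding split_beta' by (simp_all add: d ma)
  moreover have "distr \<Psi> borel (\<lambda>(x, y, z). (x, y)) = distr M borel (\<lambda>w. (X w, Y w))"
    "distr \<Psi> borel (\<lambda>(x, y, z). (x, z)) = distr M borel (\<lambda>w. (X w, Z w))"
    unfolding split_beta' by (subst d; simp add: borel_measurable_Pair)+
  ultimately show "\<Psi> \<in> geodesic_plans \<rho> \<nu>0 \<nu>1"
    unfolding geodesic_plans_def using o by simp
  show "gen_geodesic \<Psi> t = distr M borel (\<lambda>w. (1 - t) *\<^sub>R Y w + t *\<^sub>R Z w)"
    unfolding gen_geodesic_def split_beta' by (subst d) simp_all
  show "(\<integral>p. (case p of (x, y, z) \<Rightarrow> (norm (z - y))\<^sup>2) \<partial>\<Psi>) = (l2 M (\<lambda>w. Z w - Y w))\<^sup>2"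
    unfolding l2_power2 \<Psi>_def split_beta' by (subst integral_distr[OF m]) simp_all
qed

subsection \<open>Ekeland's principle and two elementary inequalities\<close>

lemma nonneg_of_small_perturbation:
  fixes a c :: real
  assumes "\<And>t. 0 < t \<Longrightarrow> t \<le> 1 \<Longrightarrow> 0 \<le> a + t * c"
  shows "0 \<le> a"
proof (rule tendsto_lowerbound)
  show "((\<lambda>t. a + t * c) \<longlongrightarrow> a) (at_right 0)"
    by (rule tendsto_eq_intros | simp)+
  show "\<forall>\<^sub>F t in at_right 0. 0 \<le> a + t * c"
    unfolding eventually_at_right_field using assms by (intro exI[of _ 1]) auto
qed simp

text \<open>Concavity of the power: the right-hand side is the tangent at \<open>a\<close>. It is
  the weighted arithmetic-geometric mean inequality for \<open>b / a\<close> and 1, multiplied by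
  \<open>a powr \<theta>\<close>.\<close>

lemma Bernoulli_powr:
  fixes a b \<theta> :: real
  assumes "0 < a" "0 < b" "0 \<le> \<theta>" "\<theta> \<le> 1"
  shows "b powr \<theta> \<le> a powr \<theta> + \<theta> * a powr (\<theta> - 1) * (b - a)"
proof -
  have "(b / a) powr \<theta> \<le> \<theta> * (b / a) + (1 - \<theta>)"
    using Youngs_inequality_0[of \<theta> "1 - \<theta>" "b / a" 1] assms by simp
  then have "a powr \<theta> * (b / a) powr \<theta> \<le> a powr \<theta> * (\<theta> * (b / a) + (1 - \<theta>))"
    by (rule mult_left_mono) simp
  also have "a powr \<theta> * (b / a) powr \<theta> = b powr \<theta>"
    using assms by (simp add: powr_divide)
  also have "a powr \<theta> * (\<theta> * (b / a) + (1 - \<theta>)) = a powr \<theta> + \<theta> * a powr (\<theta> - 1) * (b - a)"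
    using assms by (simp add: powr_diff field_simps)
  finally show ?thesis .
qed

text \<open>From each point pass to a nearly minimal admissible successor; the drops of \<psi> pay
  for the distances travelled. As \<open>d\<close> is not assumed to separate points, strict
  minimality reads \<open>d y z = 0\<close>. The hypothesis \<open>complete\<close> combines
  completeness with lower semicontinuity along decreasing values.\<close>

lemma Ekeland_principle:
  fixes d :: "'p \<Rightarrow> 'p \<Rightarrow> real" and \<psi> :: "'p \<Rightarrow> real"
  assumes x0: "x0 \<in> D" and \<kappa>: "0 < \<kappa>"
    and psi: "\<And>x. x \<in> D \<Longrightarrow> 0 \<le> \<psi> x"
    and d0: "\<And>x y. x \<in> D \<Longrightarrow> y \<in> D \<Longrightarrow> 0 \<le> d x y" and dself: "\<And>x. x \<in> D \<Longrightarrow> d x x = 0"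
    and tri: "\<And>x y z. x \<in> D \<Longrightarrow> y \<in> D \<Longrightarrow> z \<in> D \<Longrightarrow> d x z \<le> d x y + d y z"
    and complete: "\<And>x. (\<And>n. x n \<in> D) \<Longrightarrow> decseq (\<lambda>n. \<psi> (x n)) \<Longrightarrow> summable (\<lambda>n. d (x n) (x (Suc n))) \<Longrightarrow>
      \<exists>y\<in>D. (\<lambda>n. d (x n) y) \<longlonglongrightarrow> 0 \<and> (\<forall>n. \<psi> y \<le> \<psi> (x n))"
  obtains y where "y \<in> D" "\<psi> y + \<kappa> * d x0 y \<le> \<psi> x0"
    "\<And>z. z \<in> D \<Longrightarrow> \<psi> z + \<kappa> * d y z \<le> \<psi> y \<Longrightarrow> d y z = 0"
proof -
  \<comment> \<open>The successors of \<open>x\<close> in Ekeland's order; the triangle inequality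
    makes the order transitive.\<close>
  define S where "S x = {z \<in> D. \<psi> z + \<kappa> * d x z \<le> \<psi> x}" for x
  have SD: "z \<in> D" if "z \<in> S x" for x z using that by (simp add: S_def)
  have Sself: "x \<in> S x" if "x \<in> D" for x using that by (simp add: S_def dself)
  have Strans: "z \<in> S x" if "x \<in> D" "y \<in> S x" "z \<in> S y" for x y z
  proof -
    have "\<kappa> * d x z \<le> \<kappa> * (d x y + d y z)" using \<kappa> tri[of x y z] that SD by (intro mult_left_mono) auto
    then show ?thesis using that by (simp add: S_def algebra_simps)
  qed
  have bdd: "bdd_below (\<psi> ` S x)" for x using psi SD by (auto intro!: bdd_belowI[of _ 0])
  have "\<forall>n. \<exists>s. \<forall>x\<in>D. s x \<in> S x \<and> \<psi> (s x) < (INF z\<in>S x. \<psi> z) + (1/2) ^ n"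
  proof (intro allI bchoice ballI)
    fix n x assume "x \<in> D"
    then show "\<exists>z. z \<in> S x \<and> \<psi> z < (INF z\<in>S x. \<psi> z) + (1/2) ^ n"
      using cInf_lessD[of "\<psi> ` S x" "(INF z\<in>S x. \<psi> z) + (1/2) ^ n"] Sself by auto
  qed
  from choice[OF this] obtain s where s: "\<And>x n. x \<in> D \<Longrightarrow> s n x \<in> S x"
    and sI: "\<And>x n. x \<in> D \<Longrightarrow> \<psi> (s n x) < (INF z\<in>S x. \<psi> z) + (1/2) ^ n" by blast
  define x where "x = rec_nat x0 s"
  have xS: "x (Suc n) = s n (x n)" and x_0: "x 0 = x0" for n by (simp_all add: x_def)
  have xD: "x n \<in> D" for n
    by (induction n) (use x0 s SD in \<open>auto simp: xS x_0\<close>)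
  have step: "x (Suc n) \<in> S (x n)" for n using s[OF xD] by (simp add: xS)
  have later: "x m \<in> S (x n)" if "n \<le> m" for n m
    using that
  proof (induction m rule: dec_induct)
    case base
    show ?case by (rule Sself[OF xD])
  next
    case (step m)
    then show ?case using Strans[OF xD] \<open>x (Suc m) \<in> S (x m)\<close> by blast
  qed
  have dstep: "d (x n) (x (Suc n)) \<le> (\<psi> (x n) - \<psi> (x (Suc n))) / \<kappa>" for n
    using step[of n] \<kappa> by (simp add: S_def pos_le_divide_eq mult.commute)
  have dec: "decseq (\<lambda>n. \<psi> (x n))"
  proof (rule decseq_SucI)
    fix n
    have "0 \<le> \<kappa> * d (x n) (x (Suc n))" using \<kappa> d0 xD by simp
    then show "\<psi> (x (Suc n)) \<le> \<psi> (x n)" using step[of n] by (simp add: S_def)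
  qed
  have sum: "summable (\<lambda>n. d (x n) (x (Suc n)))"
  proof (rule summableI_nonneg_bounded)
    show "0 \<le> d (x n) (x (Suc n))" for n using d0 xD by simp
    show "(\<Sum>i<n. d (x i) (x (Suc i))) \<le> \<psi> x0 / \<kappa>" for n
    proof -
      have "(\<Sum>i<n. d (x i) (x (Suc i))) \<le> (\<Sum>i<n. (\<psi> (x i) - \<psi> (x (Suc i))) / \<kappa>)"
        by (rule sum_mono) (rule dstep)
      also have "\<dots> = (\<psi> (x 0) - \<psi> (x n)) / \<kappa>"
        by (induction n) (simp_all add: diff_divide_distrib)
      also have "\<dots> \<le> \<psi> x0 / \<kappa>" using \<kappa> psi[OF xD] by (intro divide_right_mono) (auto simp: x_0)
      finally show ?thesis .
    qed
  qed
  obtain y where y: "y \<in> D" "(\<lambda>n. d (x n) y) \<longlonglongrightarrow> 0" "\<And>n. \<psi> y \<le> \<psi> (x n)"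
    using complete[of x, OF xD dec sum] by blast
  have yS: "y \<in> S (x n)" for n
  proof -
    \<comment> \<open>The limit is reached by a detour through \<open>x m\<close>, whose distance to
      \<open>y\<close> vanishes as \<open>m\<close> grows.\<close>
    have "\<psi> y + \<kappa> * d (x n) y \<le> \<psi> (x n) + \<kappa> * d (x m) y" if "n \<le> m" for m
    proof -
      have "\<kappa> * d (x n) y \<le> \<kappa> * (d (x n) (x m) + d (x m) y)"
        using \<kappa> tri xD y(1) by (intro mult_left_mono) auto
      then show ?thesis using later[OF that] y(3)[of m] by (simp add: S_def algebra_simps)
    qed
    moreover have "(\<lambda>m. \<psi> (x n) + \<kappa> * d (x m) y) \<longlonglongrightarrow> \<psi> (x n) + \<kappa> * 0"
      by (intro tendsto_intros y)
    ultimately have "\<psi> y + \<kappa> * d (x n) y \<le> \<psi> (x n)"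
      using LIMSEQ_le_const[of "\<lambda>m. \<psi> (x n) + \<kappa> * d (x m) y" "\<psi> (x n)"] by auto
    then show ?thesis using y(1) by (simp add: S_def)
  qed
  show ?thesis
  proof (rule that[OF y(1)])
    show "\<psi> y + \<kappa> * d x0 y \<le> \<psi> x0" using yS[of 0] by (simp add: S_def x_0)
    fix z assume z: "z \<in> D" "\<psi> z + \<kappa> * d y z \<le> \<psi> y"
    \<comment> \<open>A successor \<open>z\<close> of \<open>y\<close> is a successor of every
      \<open>x n\<close>, hence lies above the infimum that \<open>\<psi> (x (Suc n))\<close>
      approaches within \<open>(1/2) ^ n\<close>.\<close>
    have "\<psi> y - (1/2) ^ n \<le> \<psi> z" for n
    proof -
      have "z \<in> S (x n)" using Strans[OF xD yS] z by (simp add: S_def)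
      then have "(INF z\<in>S (x n). \<psi> z) \<le> \<psi> z" by (rule cINF_lower[OF bdd])
      then show ?thesis using sI[OF xD, of n n] y(3)[of "Suc n"] by (simp add: xS)
    qed
    moreover have "(\<lambda>n. \<psi> y - (1/2) ^ n) \<longlonglongrightarrow> \<psi> y - 0"
      by (intro tendsto_intros LIMSEQ_power_zero) simp
    ultimately have "\<psi> y \<le> \<psi> z" using LIMSEQ_le_const2[of "\<lambda>n. \<psi> y - (1/2) ^ n" "\<psi> y" "\<psi> z"] by auto
    then have "\<kappa> * d y z \<le> 0" using z(2) by simp
    then show "d y z = 0" using \<kappa> d0[OF y(1) z(1)] by (simp add: mult_le_0_iff)
  qed
qed

subsection \<open>Proximal points and the Lojasiewicz inequalities\<close>

locale W2_functional =
  fixes J :: "'a::euclidean_space measure \<Rightarrow> ereal"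
  assumes not_MInf: "\<And>\<mu>. \<mu> \<in> P2 \<Longrightarrow> J \<mu> \<noteq> -\<infinity>"
    and proper: "proper_J J"
    and lsc: "W2_lsc J"
    and Argmin_nonempty: "Argmin J \<noteq> {}"
begin

text \<open>Gives real arithmetic on the domain. Where \<open>J\<close> is infinite the value
  defaults to 0 and carries no information.\<close>

definition F :: "'a measure \<Rightarrow> real" where
  "F \<mu> = real_of_ereal (J \<mu>)"

definition Fmin :: real where
  "Fmin = real_of_ereal (min_J J)"

lemma dom_P2: "\<mu> \<in> dom_J J \<Longrightarrow> \<mu> \<in> P2"
  by (simp add: dom_J_def)

lemma J_eq: "\<mu> \<in> dom_J J \<Longrightarrow> J \<mu> = ereal (F \<mu>)"
  using not_MInf[of \<mu>] by (cases "J \<mu>") (auto simp: dom_J_def F_def)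

lemma dom_iff: "\<mu> \<in> P2 \<Longrightarrow> \<mu> \<in> dom_J J \<longleftrightarrow> J \<mu> \<noteq> \<infinity>"
  by (auto simp: dom_J_def)

lemma domI: "\<mu> \<in> P2 \<Longrightarrow> J \<mu> \<le> ereal c \<Longrightarrow> \<mu> \<in> dom_J J"
  by (auto simp: dom_J_def intro: le_less_trans)

lemma F_leI: "\<mu> \<in> P2 \<Longrightarrow> J \<mu> \<le> ereal c \<Longrightarrow> F \<mu> \<le> c"
  by (metis J_eq domI ereal_less_eq(3))

lemma Argmin_eq: "\<eta> \<in> Argmin J \<Longrightarrow> J \<eta> = min_J J"
  unfolding min_J_def Argmin_def by (intro antisym INF_greatest INF_lower) auto

lemma Argmin_dom: "\<eta> \<in> Argmin J \<Longrightarrow> \<eta> \<in> dom_J J"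
  using proper unfolding proper_J_def Argmin_def dom_J_def by (force intro: le_less_trans)

lemma min_J_eq: "min_J J = ereal Fmin"
proof -
  obtain \<eta> where "\<eta> \<in> Argmin J" using Argmin_nonempty by blast
  then have "min_J J = ereal (F \<eta>)" using Argmin_eq[of \<eta>] J_eq[OF Argmin_dom, of \<eta>] by simp
  then show ?thesis by (simp add: Fmin_def)
qed

lemma Fmin_le: "\<mu> \<in> dom_J J \<Longrightarrow> Fmin \<le> F \<mu>"
  using INF_lower[OF dom_P2, of \<mu> J] J_eq[of \<mu>] min_J_eq by (simp add: min_J_def)

lemma Argmin_iff: "\<mu> \<in> dom_J J \<Longrightarrow> \<mu> \<in> Argmin J \<longleftrightarrow> F \<mu> = Fmin"
proof
  assume "\<mu> \<in> dom_J J" "\<mu> \<in> Argmin J"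
  then show "F \<mu> = Fmin" using Argmin_eq[of \<mu>] J_eq[of \<mu>] min_J_eq by simp
next
  assume "\<mu> \<in> dom_J J" "F \<mu> = Fmin"
  moreover have "min_J J \<le> J \<nu>" if "\<nu> \<in> P2" for \<nu> unfolding min_J_def by (rule INF_lower[OF that])
  ultimately show "\<mu> \<in> Argmin J" using J_eq[of \<mu>] min_J_eq dom_P2 by (simp add: Argmin_def)
qed

text \<open>The bounds \<open>c n\<close> converge although the values \<open>F (\<nu> n)\<close>
  may not. Membership of the limit in the domain is part of the conclusion, since \<open>F\<close>
  alone cannot detect an infinite value.\<close>

lemma lsc_seq:
  assumes \<nu>: "\<And>n. \<nu> n \<in> dom_J J" and \<mu>: "\<mu> \<in> P2" and lim: "(\<lambda>n. W2 (\<nu> n) \<mu>) \<longlonglongrightarrow> 0"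
    and le: "\<And>n. F (\<nu> n) \<le> c n" and c: "c \<longlonglongrightarrow> b"
  shows "\<mu> \<in> dom_J J" "F \<mu> \<le> b"
proof -
  have "J \<mu> \<le> ereal b"
  proof (rule ccontr)
    assume "\<not> J \<mu> \<le> ereal b"
    then obtain b' where b': "b < b'" "ereal b' < J \<mu>"
      by (metis ereal_dense2 ereal_less_eq(3) ereal_less(2) less_ereal.simps(1) not_le)
    obtain \<delta> where \<delta>: "\<delta> > 0" "\<And>\<nu>. \<nu> \<in> P2 \<Longrightarrow> W2 \<mu> \<nu> < \<delta> \<Longrightarrow> ereal b' < J \<nu>"
      using lsc \<mu> b'(2) unfolding W2_lsc_def by blast
    have "eventually (\<lambda>n. W2 (\<nu> n) \<mu> < \<delta>) sequentially" using order_tendstoD(2)[OF lim \<delta>(1)] .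
    moreover have "eventually (\<lambda>n. c n < b') sequentially" using order_tendstoD(2)[OF c b'(1)] .
    ultimately have "eventually (\<lambda>n. False) sequentially"
    proof eventually_elim
      case (elim n)
      then have "ereal b' < J (\<nu> n)" using \<delta>(2)[OF dom_P2[OF \<nu>]] W2_commute[OF \<mu> dom_P2[OF \<nu>]] by simp
      then show False using J_eq[OF \<nu>[of n]] le[of n] elim by simp
    qed
    then show False by simp
  qed
  then show "\<mu> \<in> dom_J J" "F \<mu> \<le> b" using domI F_leI \<mu> by auto
qed

lemma geodesic_ineq:
  assumes conv: "lambda_convex_gg l J" and M: "prob_space M" and s: "sq_int M X" "sq_int M Y" "sq_int M Z"
    and o: "distr M borel (\<lambda>w. (X w, Y w)) \<in> opt_couplings \<rho> \<nu>0" "distr M borel (\<lambda>w. (X w, Z w)) \<in> opt_couplings \<rho> \<nu>1"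
    and \<rho>: "\<rho> \<in> P2" and \<nu>: "\<nu>0 \<in> dom_J J" "\<nu>1 \<in> dom_J J" and t: "0 \<le> t" "t \<le> 1"
  defines "\<nu>t \<equiv> distr M borel (\<lambda>w. (1 - t) *\<^sub>R Y w + t *\<^sub>R Z w)"
  shows "\<nu>t \<in> dom_J J" "F \<nu>t \<le> (1 - t) * F \<nu>0 + t * F \<nu>1 - l / 2 * t * (1 - t) * (l2 M (\<lambda>w. Z w - Y w))\<^sup>2"
proof -
  have m: "X \<in> borel_measurable M" "Y \<in> borel_measurable M" "Z \<in> borel_measurable M"
    using s by (auto simp: sq_int_def)
  note T = triple_geodesic_plan[OF M m o]
  have "J \<nu>t \<le> ereal (1 - t) * J \<nu>0 + ereal t * J \<nu>1 - ereal (l / 2 * t * (1 - t) * (l2 M (\<lambda>w. Z w - Y w))\<^sup>2)"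
    using conv \<nu> \<rho> T(1) t unfolding lambda_convex_gg_def \<nu>t_def T(2)[symmetric] T(3)[symmetric] by auto
  then have le: "J \<nu>t \<le> ereal ((1 - t) * F \<nu>0 + t * F \<nu>1 - l / 2 * t * (1 - t) * (l2 M (\<lambda>w. Z w - Y w))\<^sup>2)"
    using J_eq \<nu> by simp
  have "sq_int M (\<lambda>w. (1 - t) *\<^sub>R Y w + t *\<^sub>R Z w)" using s by auto
  then have "\<nu>t \<in> P2" unfolding \<nu>t_def using distr_in_P2_iff[OF M] sq_int_measurable by blast
  then show "\<nu>t \<in> dom_J J" "F \<nu>t \<le> (1 - t) * F \<nu>0 + t * F \<nu>1 - l / 2 * t * (1 - t) * (l2 M (\<lambda>w. Z w - Y w))\<^sup>2"
    using domI F_leI le by auto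
qed

section \<open>Proximal points: existence and subgradients\<close>

definition prox :: "real \<Rightarrow> 'a measure \<Rightarrow> 'a measure \<Rightarrow> real" where
  "prox \<tau> \<mu> \<nu> = F \<nu> + (W2 \<mu> \<nu>)\<^sup>2 / (2 * \<tau>)"

text \<open>Along a generalised geodesic based at \<mu> the squared distance to \<mu> is controlled
  by the parallelogram identity for the glued variables, which adds \<open>1 / \<tau>\<close> to the
  modulus \<open>l\<close>. The factor 1/8 is one half times \<open>t * (1 - t)\<close> at the
  midpoint.\<close>

lemma prox_midpoint:
  assumes conv: "lambda_convex_gg l J" and \<mu>: "\<mu> \<in> P2" and \<nu>: "\<nu>0 \<in> dom_J J" "\<nu>1 \<in> dom_J J"
    and \<tau>: "0 < \<tau>" "0 < l + 1 / \<tau>"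
  obtains \<nu> where "\<nu> \<in> dom_J J"
    "prox \<tau> \<mu> \<nu> \<le> (prox \<tau> \<mu> \<nu>0 + prox \<tau> \<mu> \<nu>1) / 2 - (l + 1 / \<tau>) / 8 * (W2 \<nu>0 \<nu>1)\<^sup>2"
proof -
  note P = dom_P2[OF \<nu>(1)] dom_P2[OF \<nu>(2)]
  obtain \<gamma> \<gamma>' where \<gamma>: "\<gamma> \<in> opt_couplings \<mu> \<nu>0" and \<gamma>': "\<gamma>' \<in> opt_couplings \<mu> \<nu>1"
    using opt_couplings_nonempty \<mu> P by blast
  obtain M :: "(('a \<times> real) \<times> real) measure" and X Y Z where M: "prob_space M" "sq_int M X" "sq_int M Y" "sq_int M Z"
    and e: "\<gamma> = distr M borel (\<lambda>w. (X w, Y w))" "\<gamma>' = distr M borel (\<lambda>w. (X w, Z w))"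
    and l: "\<mu> = distr M borel X" "\<nu>0 = distr M borel Y" "\<nu>1 = distr M borel Z"
    by (rule gluing[OF \<mu> P opt_couplings_sub[OF \<gamma>] opt_couplings_sub[OF \<gamma>']]) blast
  have m: "X \<in> borel_measurable M" "Y \<in> borel_measurable M" "Z \<in> borel_measurable M"
    using M(2-4) by (auto simp: sq_int_def)
  define V where "V w = (1 - 1/2) *\<^sub>R Y w + (1/2) *\<^sub>R Z w" for w
  have sV: "sq_int M V" unfolding V_def using M(2-4) by auto
  define \<nu> where "\<nu> = distr M borel V"
  note g = geodesic_ineq[OF conv M \<gamma>[unfolded e] \<gamma>'[unfolded e] \<mu> \<nu>, of "1/2", folded V_def, folded \<nu>_def]
  define D where "D = (l2 M (\<lambda>w. Z w - Y w))\<^sup>2"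
  have W0: "W2 \<mu> \<nu>0 = l2 M (\<lambda>w. X w - Y w)" and W1: "W2 \<mu> \<nu>1 = l2 M (\<lambda>w. X w - Z w)"
    using opt_couplings_W2[OF \<gamma>] opt_couplings_W2[OF \<gamma>'] l2_distr_pair[OF m(1,2)] l2_distr_pair[OF m(1,3)]
    unfolding e[symmetric] by simp_all
  have DW: "(W2 \<nu>0 \<nu>1)\<^sup>2 \<le> D"
    unfolding D_def l2_minus_commute[of M Z] using W2_le[OF M(1) m(2,3)] W2_nonneg[OF P] l by (simp add: power_mono)
  have pt: "(norm (X w - V w))\<^sup>2 = (norm (X w - Y w))\<^sup>2 / 2 + (norm (X w - Z w))\<^sup>2 / 2 - (norm (Z w - Y w))\<^sup>2 / 4" for w
    unfolding V_def power2_norm_eq_inner by (simp add: inner_simps inner_commute field_simps)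
  have i: "integrable M (\<lambda>w. (norm (X w - Y w))\<^sup>2)" "integrable M (\<lambda>w. (norm (X w - Z w))\<^sup>2)" "integrable M (\<lambda>w. (norm (Z w - Y w))\<^sup>2)"
    using sq_int_diff[OF M(2,3)] sq_int_diff[OF M(2,4)] sq_int_diff[OF M(4,3)] by (auto simp: sq_int_def)
  have "(W2 \<mu> \<nu>)\<^sup>2 \<le> (l2 M (\<lambda>w. X w - V w))\<^sup>2"
    unfolding \<nu>_def using W2_le[OF M(1) m(1) sq_int_measurable[OF sV]] W2_nonneg[OF \<mu> dom_P2[OF g(1)]] l \<nu>_def by (simp add: power_mono)
  also have "\<dots> = (W2 \<mu> \<nu>0)\<^sup>2 / 2 + (W2 \<mu> \<nu>1)\<^sup>2 / 2 - D / 4"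
    unfolding W0 W1 D_def l2_power2 pt using i by simp
  finally have WV: "(W2 \<mu> \<nu>)\<^sup>2 / (2 * \<tau>) \<le> ((W2 \<mu> \<nu>0)\<^sup>2 / 2 + (W2 \<mu> \<nu>1)\<^sup>2 / 2 - D / 4) / (2 * \<tau>)"
    using \<tau>(1) by (intro divide_right_mono) auto
  have "prox \<tau> \<mu> \<nu> \<le> (prox \<tau> \<mu> \<nu>0 + prox \<tau> \<mu> \<nu>1) / 2 - (l + 1 / \<tau>) / 8 * D"
  proof -
    have q: "x / (2 * \<tau>) = x * (1 / \<tau>) / 2" for x by simp
    have "F \<nu> \<le> (F \<nu>0 + F \<nu>1) / 2 - l / 8 * D" using g(2) by (simp add: D_def add_divide_distrib)
    with WV show ?thesis unfolding prox_def q by (simp only: ring_distribs add_divide_distrib diff_divide_distrib) argo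
  qed
  \<comment> \<open>The glued variables need not couple the two end points optimally, so
    \<open>D\<close> only dominates the squared distance; positivity of
    \<open>l + 1 / \<tau>\<close> gives the right sign.\<close>
  also have "\<dots> \<le> (prox \<tau> \<mu> \<nu>0 + prox \<tau> \<mu> \<nu>1) / 2 - (l + 1 / \<tau>) / 8 * (W2 \<nu>0 \<nu>1)\<^sup>2"
    using DW \<tau>(2) by (intro diff_left_mono mult_left_mono) auto
  finally show ?thesis using that g(1) by auto
qed

text \<open>Strong convexity turns minimising sequences into Cauchy sequences: errors
  \<open>(1/4) ^ n\<close> in the energy yield distances of order \<open>(1/2) ^ n\<close>, which
  are summable.\<close>

lemma prox_minimizer:
  assumes conv: "lambda_convex_gg l J" and \<mu>: "\<mu> \<in> P2" and \<tau>: "0 < \<tau>" "0 < l + 1 / \<tau>"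
  obtains m where "m \<in> dom_J J" "\<And>\<nu>. \<nu> \<in> dom_J J \<Longrightarrow> prox \<tau> \<mu> m \<le> prox \<tau> \<mu> \<nu>"
proof -
  define I where "I = (INF \<nu>\<in>dom_J J. prox \<tau> \<mu> \<nu>)"
  have lb: "Fmin \<le> prox \<tau> \<mu> \<nu>" if "\<nu> \<in> dom_J J" for \<nu>
    using Fmin_le[OF that] \<tau>(1) by (simp add: prox_def add_increasing2)
  have bdd: "bdd_below (prox \<tau> \<mu> ` dom_J J)" using lb by (auto intro!: bdd_belowI)
  have I_le: "I \<le> prox \<tau> \<mu> \<nu>" if "\<nu> \<in> dom_J J" for \<nu>
    unfolding I_def by (rule cINF_lower[OF bdd that])
  have "\<exists>\<nu>\<in>dom_J J. prox \<tau> \<mu> \<nu> < I + (1/4) ^ n" for n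
    using cInf_lessD[of "prox \<tau> \<mu> ` dom_J J" "I + (1/4) ^ n"] proper by (auto simp: I_def proper_J_def)
  then obtain \<nu> where \<nu>: "\<And>n. \<nu> n \<in> dom_J J" and \<nu>I: "\<And>n. prox \<tau> \<mu> (\<nu> n) < I + (1/4) ^ n" by metis
  have P: "\<nu> n \<in> P2" for n using dom_P2[OF \<nu>] .
  define k where "k = (l + 1 / \<tau>) / 8"
  have k: "0 < k" using \<tau> by (simp add: k_def)
  have d: "W2 (\<nu> n) (\<nu> (Suc n)) \<le> sqrt (1 / k) * (1/2) ^ n" for n
  proof -
    obtain \<nu>' where \<nu>': "\<nu>' \<in> dom_J J"
      "prox \<tau> \<mu> \<nu>' \<le> (prox \<tau> \<mu> (\<nu> n) + prox \<tau> \<mu> (\<nu> (Suc n))) / 2 - k * (W2 (\<nu> n) (\<nu> (Suc n)))\<^sup>2"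
      unfolding k_def by (rule prox_midpoint[OF conv \<mu> \<nu>[of n] \<nu>[of "Suc n"] \<tau>]) blast
    have "k * (W2 (\<nu> n) (\<nu> (Suc n)))\<^sup>2 \<le> (1/4) ^ n"
    proof -
      define p where "p = (1/4 :: real) ^ n"
      have "0 \<le> p" "prox \<tau> \<mu> (\<nu> n) < I + p" "prox \<tau> \<mu> (\<nu> (Suc n)) < I + p / 4"
        using \<nu>I[of n] \<nu>I[of "Suc n"] by (simp_all add: p_def)
      then show ?thesis
        using \<nu>'(2) I_le[OF \<nu>'(1)] unfolding p_def[symmetric] by argo
    qed
    also have "(1/4 :: real) ^ n = ((1/2) ^ n)\<^sup>2"
      by (simp add: power2_eq_square flip: power_mult_distrib)
    finally have "(W2 (\<nu> n) (\<nu> (Suc n)))\<^sup>2 \<le> 1 / k * ((1/2) ^ n)\<^sup>2"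
      using k by (simp add: pos_le_divide_eq mult.commute)
    then have "W2 (\<nu> n) (\<nu> (Suc n)) \<le> sqrt (1 / k * ((1/2) ^ n)\<^sup>2)" by (rule real_le_rsqrt)
    then show ?thesis unfolding real_sqrt_mult by simp
  qed
  have "summable (\<lambda>n. W2 (\<nu> n) (\<nu> (Suc n)))"
  proof (rule summable_comparison_test')
    show "summable (\<lambda>n. sqrt (1 / k) * (1/2) ^ n)" by (intro summable_mult summable_geometric) simp
    show "norm (W2 (\<nu> n) (\<nu> (Suc n))) \<le> sqrt (1 / k) * (1/2) ^ n" for n using d[of n] P by simp
  qed
  then obtain m where m: "m \<in> P2" "(\<lambda>n. W2 (\<nu> n) m) \<longlonglongrightarrow> 0" using W2_complete[of \<nu>] P by blast
  have Wlim: "(\<lambda>n. W2 \<mu> (\<nu> n)) \<longlonglongrightarrow> W2 \<mu> m"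
  proof (rule LIM_zero_cancel, rule tendsto_rabs_zero_cancel, rule tendsto_sandwich[OF _ _ tendsto_const m(2)])
    have "\<bar>W2 \<mu> (\<nu> n) - W2 \<mu> m\<bar> \<le> W2 (\<nu> n) m" for n
      using W2_triangle[OF \<mu> P m(1), of n] W2_triangle[OF \<mu> m(1) P, of n] W2_commute[OF m(1) P, of n] by simp
    then show "\<forall>\<^sub>F n in sequentially. \<bar>W2 \<mu> (\<nu> n) - W2 \<mu> m\<bar> \<le> W2 (\<nu> n) m" by simp
  qed simp
  \<comment> \<open>Lower semicontinuity is applied to \<open>F\<close> alone; the quadratic part
    converges and is moved into the bound.\<close>
  have Fle: "F (\<nu> n) \<le> I + (1/4) ^ n - (W2 \<mu> (\<nu> n))\<^sup>2 / (2 * \<tau>)" for n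
    using \<nu>I[of n] by (simp add: prox_def)
  have c: "(\<lambda>n. I + (1/4) ^ n - (W2 \<mu> (\<nu> n))\<^sup>2 / (2 * \<tau>)) \<longlonglongrightarrow> I + 0 - (W2 \<mu> m)\<^sup>2 / (2 * \<tau>)"
    by (intro tendsto_intros Wlim LIMSEQ_power_zero) (use \<tau> in auto)
  note L = lsc_seq[OF \<nu> m Fle c]
  then have "prox \<tau> \<mu> m \<le> I" by (simp add: prox_def)
  then show ?thesis using that[OF L(1)] I_le by force
qed

text \<open>First variation of the minimality of \<open>m\<close> along a geodesic from
  \<open>m\<close> to \<nu> based at \<open>m\<close>. An upper bound for the distance from \<mu> to
  the moved point suffices; the glued variables give one whose linear term is a pairing with the
  barycentric field.\<close>

lemma prox_subdiff:
  assumes conv: "lambda_convex_gg l J" and \<mu>: "\<mu> \<in> P2" and \<tau>: "0 < \<tau>"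
    and m: "m \<in> dom_J J" and min: "\<And>\<nu>. \<nu> \<in> dom_J J \<Longrightarrow> prox \<tau> \<mu> m \<le> prox \<tau> \<mu> \<nu>"
  obtains g where "g \<in> subdiff l J m" "L2_norm m g \<le> W2 \<mu> m / \<tau>"
proof -
  have mP: "m \<in> P2" using dom_P2[OF m] .
  obtain \<gamma> where \<gamma>: "\<gamma> \<in> opt_couplings m \<mu>" using opt_couplings_nonempty[OF mP \<mu>] by blast
  show ?thesis
  proof (rule barycentric_gluing[OF mP \<mu> opt_couplings_sub[OF \<gamma>]])
    fix g0 assume g0: "g0 \<in> L2_fields m" "L2_norm m g0 \<le> l2 \<gamma> (\<lambda>p. fst p - snd p)"
      and glue: "\<And>\<nu> \<gamma>'. \<nu> \<in> P2 \<Longrightarrow> \<gamma>' \<in> couplings m \<nu> \<Longrightarrow>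
        \<exists>(M :: (('a \<times> real) \<times> real) measure) X Y Z. prob_space M \<and> sq_int M X \<and> sq_int M Y \<and> sq_int M Z \<and>
          \<gamma> = distr M borel (\<lambda>w. (X w, Y w)) \<and> \<gamma>' = distr M borel (\<lambda>w. (X w, Z w)) \<and>
          (\<integral>w. (Y w - X w) \<bullet> (Z w - X w) \<partial>M) = (\<integral>p. g0 (fst p) \<bullet> (snd p - fst p) \<partial>\<gamma>')"
    define g where "g x = (1 / \<tau>) *\<^sub>R g0 x" for x
    have gL: "g \<in> L2_fields m"
      using g0(1) unfolding g_def[abs_def] L2_fields_def by (auto simp: power_divide)
    have "L2_norm m g = L2_norm m g0 / \<tau>"
      using \<tau> by (simp add: L2_norm_def g_def power_mult_distrib real_sqrt_mult real_sqrt_divide power_divide)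
    also have "\<dots> \<le> W2 \<mu> m / \<tau>"
      using g0(2) opt_couplings_W2[OF \<gamma>] W2_commute[OF mP \<mu>] \<tau> by (simp add: divide_right_mono)
    finally have gn: "L2_norm m g \<le> W2 \<mu> m / \<tau>" .
    have "\<exists>\<Psi>\<in>opt_couplings m \<nu>.
        J \<nu> \<ge> J m + ereal (\<integral>p. g (fst p) \<bullet> (snd p - fst p) \<partial>\<Psi>) + ereal (l / 2 * (W2 m \<nu>)\<^sup>2)"
      if \<nu>P: "\<nu> \<in> P2" for \<nu>
    proof -
      obtain \<gamma>' where \<gamma>': "\<gamma>' \<in> opt_couplings m \<nu>" using opt_couplings_nonempty[OF mP \<nu>P] by blast
      show ?thesis
      proof (cases "J \<nu> = \<infinity>")
        case True
        then show ?thesis using \<gamma>' by auto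
      next
        case False
        then have \<nu>: "\<nu> \<in> dom_J J" using dom_iff[OF \<nu>P] by simp
        obtain M :: "(('a \<times> real) \<times> real) measure" and X Y Z where M: "prob_space M" "sq_int M X" "sq_int M Y" "sq_int M Z"
          and e: "\<gamma> = distr M borel (\<lambda>w. (X w, Y w))" "\<gamma>' = distr M borel (\<lambda>w. (X w, Z w))"
          and B: "(\<integral>w. (Y w - X w) \<bullet> (Z w - X w) \<partial>M) = (\<integral>p. g0 (fst p) \<bullet> (snd p - fst p) \<partial>\<gamma>')"
          using glue[OF \<nu>P opt_couplings_sub[OF \<gamma>']] by blast
        have ms: "X \<in> borel_measurable M" "Y \<in> borel_measurable M" "Z \<in> borel_measurable M"
          using M(2-4) by (auto simp: sq_int_def)
        have law: "m = distr M borel X" "\<mu> = distr M borel Y"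
          using couplings_distr(3,4)[OF opt_couplings_sub[OF \<gamma>]]
          unfolding e(1) distr_pair_marginals[OF ms(1,2)] by simp_all
        define b where "b = (\<integral>w. (Y w - X w) \<bullet> (Z w - X w) \<partial>M)"
        define D where "D = (W2 m \<nu>)\<^sup>2"
        define W where "W = (W2 \<mu> m)\<^sup>2"
        have D: "(l2 M (\<lambda>w. Z w - X w))\<^sup>2 = D"
          unfolding D_def opt_couplings_W2[OF \<gamma>'] unfolding e(2) l2_distr_pair[OF ms(1,3)] l2_minus_commute[of M Z] ..
        have W: "(l2 M (\<lambda>w. Y w - X w))\<^sup>2 = W"
          unfolding W_def W2_commute[OF \<mu> mP] opt_couplings_W2[OF \<gamma>] unfolding e(1) l2_distr_pair[OF ms(1,2)] l2_minus_commute[of M Y] ..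
        have diag: "distr M borel (\<lambda>w. (X w, X w)) \<in> opt_couplings m m"
          using diagonal_opt_coupling[OF M(1) ms(1)] law by simp
        \<comment> \<open>The minimality inequality divided by \<open>t\<close>. The first bracket
          is the desired inequality; the other term collects the second-order parts of the modulus
          and of the squared distance and vanishes with \<open>t\<close>.\<close>
        have "0 \<le> (F \<nu> - F m - l / 2 * D - b / \<tau>) + t * (l / 2 * D + D / (2 * \<tau>))" if t: "0 < t" "t \<le> 1" for t
        proof -
          define V where "V w = (1 - t) *\<^sub>R X w + t *\<^sub>R Z w" for w
          have sV: "sq_int M V" unfolding V_def using M(2-4) by auto
          define \<nu>t where "\<nu>t = distr M borel V"
          have "\<nu>t \<in> dom_J J" and Ft: "F \<nu>t \<le> (1 - t) * F m + t * F \<nu> - l / 2 * t * (1 - t) * D"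
            using geodesic_ineq[OF conv M(1) M(2) M(2) M(4) diag \<gamma>'[unfolded e] mP m \<nu>, of t] t
            unfolding V_def \<nu>t_def D by simp_all
          then have "prox \<tau> \<mu> m \<le> prox \<tau> \<mu> \<nu>t" and \<nu>tP: "\<nu>t \<in> P2" using min dom_P2 by auto
          then have min': "F m + W / (2 * \<tau>) \<le> F \<nu>t + (W2 \<mu> \<nu>t)\<^sup>2 / (2 * \<tau>)" by (simp add: prox_def W_def)
          have "(W2 \<mu> \<nu>t)\<^sup>2 \<le> (l2 M (\<lambda>w. Y w - V w))\<^sup>2"
            using W2_le[OF M(1) ms(2) sq_int_measurable[OF sV]] W2_nonneg[OF \<mu> \<nu>tP] law \<nu>t_def by (simp add: power_mono)
          also have "\<dots> = (\<integral>w. (norm ((Y w - X w) - t *\<^sub>R (Z w - X w)))\<^sup>2 \<partial>M)"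
            unfolding l2_power2 V_def by (simp add: algebra_simps)
          also have "\<dots> = W - 2 * t * b + t\<^sup>2 * D"
            unfolding integral_norm_diff_scaleR[OF sq_int_diff[OF M(3,2)] sq_int_diff[OF M(4,2)]] W D b_def ..
          finally have "(W2 \<mu> \<nu>t)\<^sup>2 / (2 * \<tau>) \<le> (W - 2 * t * b + t\<^sup>2 * D) / (2 * \<tau>)"
            using \<tau> by (intro divide_right_mono) auto
          with min' Ft have "0 \<le> t * (F \<nu> - F m) - l / 2 * t * (1 - t) * D + (t\<^sup>2 * D - 2 * t * b) / (2 * \<tau>)"
            by (simp add: algebra_simps diff_divide_distrib add_divide_distrib)
          also have "\<dots> = t * ((F \<nu> - F m - l / 2 * D - b / \<tau>) + t * (l / 2 * D + D / (2 * \<tau>)))"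
            using \<tau> by (simp add: field_simps power2_eq_square)
          finally show ?thesis using t(1) by (simp add: zero_le_mult_iff)
        qed
        then have "0 \<le> F \<nu> - F m - l / 2 * D - b / \<tau>" by (rule nonneg_of_small_perturbation)
        moreover have "(\<integral>p. g (fst p) \<bullet> (snd p - fst p) \<partial>\<gamma>') = b / \<tau>"
          unfolding b_def B g_def by simp
        ultimately have "J \<nu> \<ge> J m + ereal (\<integral>p. g (fst p) \<bullet> (snd p - fst p) \<partial>\<gamma>') + ereal (l / 2 * (W2 m \<nu>)\<^sup>2)"
          using J_eq[OF m] J_eq[OF \<nu>] by (simp add: D_def)
        then show ?thesis using \<gamma>' by blast
      qed
    qed
    then have "g \<in> subdiff l J m" using gL m by (simp add: subdiff_def)
    then show thesis using that gn by blast
  qed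
qed

text \<open>The improvement is one proximal step with a small time step: the gradient inequality at its end
  point bounds the length of the step from below, hence the energy drop from below by a multiple of
  the length.\<close>

lemma proximal_descent:
  assumes conv: "lambda_convex_gg l J" and \<theta>: "0 < \<theta>" "\<theta> \<le> 1" and c: "0 < c"
    and LG: "\<And>\<rho> g. \<rho> \<in> P2 \<Longrightarrow> min_J J < J \<rho> \<Longrightarrow> J \<rho> < r0 \<Longrightarrow> g \<in> subdiff l J \<rho> \<Longrightarrow>
        c * real_of_ereal (J \<rho> - min_J J) powr (1 - \<theta>) \<le> L2_norm \<rho> g"
    and \<mu>: "\<mu> \<in> dom_J J" "Fmin < F \<mu>" "J \<mu> < r0"
  obtains m where "m \<in> dom_J J" "0 < W2 \<mu> m"
    "(F m - Fmin) powr \<theta> + \<theta> * c / 4 * W2 \<mu> m \<le> (F \<mu> - Fmin) powr \<theta>"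
proof -
  define a where "a = F \<mu> - Fmin"
  have a: "0 < a" using \<mu>(2) by (simp add: a_def)
  have \<mu>P: "\<mu> \<in> P2" using dom_P2[OF \<mu>(1)] .
  have "F \<mu> = Fmin + a" by (simp add: a_def)
  then have "ereal (Fmin + a / 2) < J \<mu>" using J_eq[OF \<mu>(1)] a by simp
  \<comment> \<open>Lower semicontinuity keeps the gap above \<open>a / 2\<close> near \<mu>; hence
    \<open>m\<close> is not a minimiser and its gap is comparable with that of \<mu>.\<close>
  then obtain \<delta> where \<delta>: "0 < \<delta>" "\<And>\<nu>. \<nu> \<in> P2 \<Longrightarrow> W2 \<mu> \<nu> < \<delta> \<Longrightarrow> ereal (Fmin + a / 2) < J \<nu>"
    using lsc \<mu>P unfolding W2_lsc_def by blast
  \<comment> \<open>The first entry confines \<open>m\<close> to the \<delta>-ball, since its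
    squared distance from \<mu> is at most \<open>2 * \<tau> * a\<close>; the second makes
    \<open>l + 1 / \<tau>\<close> positive for either sign of \<open>l\<close>.\<close>
  define \<tau> where "\<tau> = min (\<delta>\<^sup>2 / (4 * a)) (1 / (\<bar>l\<bar> + 1))"
  have \<tau>: "0 < \<tau>" using a \<delta> by (simp add: \<tau>_def)
  have "\<tau> \<le> 1 / (\<bar>l\<bar> + 1)" by (simp add: \<tau>_def)
  then have "\<bar>l\<bar> + 1 \<le> 1 / \<tau>" using \<tau> by (simp add: field_simps)
  then have l\<tau>: "0 < l + 1 / \<tau>" by linarith
  have "\<tau> \<le> \<delta>\<^sup>2 / (4 * a)" by (simp add: \<tau>_def)
  then have \<tau>a: "\<tau> * (4 * a) \<le> \<delta>\<^sup>2" using a by (simp add: pos_le_divide_eq)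
  obtain m where m: "m \<in> dom_J J" and min: "\<And>\<nu>. \<nu> \<in> dom_J J \<Longrightarrow> prox \<tau> \<mu> m \<le> prox \<tau> \<mu> \<nu>"
    using prox_minimizer[OF conv \<mu>P \<tau> l\<tau>] by blast
  have mP: "m \<in> P2" using dom_P2[OF m] .
  define W where "W = W2 \<mu> m"
  define b where "b = F m - Fmin"
  have W0: "0 \<le> W" using \<mu>P mP by (simp add: W_def)
  have drop: "W\<^sup>2 / (2 * \<tau>) \<le> a - b"
    using min[OF \<mu>(1)] by (simp add: prox_def W2_self[OF \<mu>P] W_def a_def b_def)
  have b0: "0 \<le> b" using Fmin_le[OF m] by (simp add: b_def)
  have ba: "b \<le> a" using drop \<tau> zero_le_power2[of W] by (smt (verit) divide_nonneg_pos)
  have "W\<^sup>2 \<le> (a - b) * (2 * \<tau>)" using drop \<tau> by (simp add: pos_divide_le_eq)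
  also have "\<dots> \<le> a * (2 * \<tau>)" using b0 \<tau> by (intro mult_right_mono) auto
  also have "\<dots> < \<tau> * (4 * a)" using a \<tau> by simp
  also have "\<dots> \<le> \<delta>\<^sup>2" by (rule \<tau>a)
  finally have "W < \<delta>" using \<delta>(1) by (simp add: power_less_imp_less_base)
  then have "ereal (Fmin + a / 2) < J m" using \<delta>(2)[OF mP] by (simp add: W_def)
  then have b: "a / 2 < b" using J_eq[OF m] by (simp add: b_def)
  have "F m \<le> F \<mu>" using ba by (simp add: a_def b_def)
  then have "J m < r0" using J_eq[OF m] J_eq[OF \<mu>(1)] \<mu>(3) by (simp add: le_less_trans[of "ereal (F m)" "ereal (F \<mu>)"])
  moreover have "min_J J < J m" using b a J_eq[OF m] min_J_eq by (simp add: b_def)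
  moreover obtain g where g: "g \<in> subdiff l J m" "L2_norm m g \<le> W / \<tau>"
    unfolding W_def using prox_subdiff[OF conv \<mu>P \<tau> m min] by blast
  moreover have "real_of_ereal (J m - min_J J) = b" using J_eq[OF m] min_J_eq by (simp add: b_def)
  ultimately have cb: "c * b powr (1 - \<theta>) \<le> W / \<tau>" using LG[OF mP, of g] by simp
  have bp: "0 < b powr (1 - \<theta>)" using a b by simp
  then have "0 < W / \<tau>" using cb c by (smt (verit) mult_pos_pos)
  then have Wpos: "0 < W" using \<tau> by (simp add: zero_less_divide_iff)
  \<comment> \<open>Exchanges the gap \<open>b\<close> at \<open>m\<close>, where (LG) is applied,
    for the gap \<open>a\<close> at \<mu>, where the tangent of the power is taken.\<close>
  have half: "1 / 2 \<le> a powr (\<theta> - 1) * b powr (1 - \<theta>)"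
  proof -
    have "(1 / 2 :: real) = (1 / 2) powr 1" by simp
    also have "\<dots> \<le> (1 / 2) powr (1 - \<theta>)" using \<theta> by (intro powr_mono') auto
    also have "\<dots> \<le> (b / a) powr (1 - \<theta>)" using \<theta> a b by (intro powr_mono2) (auto simp: field_simps)
    also have "\<dots> = a powr (\<theta> - 1) * b powr (1 - \<theta>)"
      using a b by (simp add: powr_divide powr_diff field_simps)
    finally show ?thesis .
  qed
  have "\<theta> * c / 4 * W = \<theta> * (c / 2 * W) * (1 / 2)" by simp
  also have "\<dots> \<le> \<theta> * (c / 2 * W) * (a powr (\<theta> - 1) * b powr (1 - \<theta>))"
    using \<theta> c Wpos half by (intro mult_left_mono) auto
  also have "\<dots> = \<theta> * a powr (\<theta> - 1) * (c * b powr (1 - \<theta>) * W / 2)" by (simp add: mult_ac)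
  also have "\<dots> \<le> \<theta> * a powr (\<theta> - 1) * (a - b)"
  proof (rule mult_left_mono)
    have "c * b powr (1 - \<theta>) * W / 2 \<le> W / \<tau> * W / 2"
      using cb W0 by (intro divide_right_mono mult_right_mono) auto
    also have "\<dots> = W\<^sup>2 / (2 * \<tau>)" by (simp add: power2_eq_square)
    finally show "c * b powr (1 - \<theta>) * W / 2 \<le> a - b" using drop by simp
  qed (use \<theta> in auto)
  finally have "b powr \<theta> + \<theta> * c / 4 * W \<le> a powr \<theta>"
    using Bernoulli_powr[of a b \<theta>] a b \<theta> by (simp add: algebra_simps)
  with that m Wpos show ?thesis by (simp add: a_def b_def W_def)
qed

lemma gradient_imp_functional:
  assumes conv: "lambda_convex_gg l J" and \<theta>: "0 < \<theta>" "\<theta> \<le> 1" and LG: "Lojasiewicz_gradient l J r0 \<theta>"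
  shows "Lojasiewicz_functional J r0 \<theta>"
proof -
  obtain c where c: "0 < c" and LGc: "\<And>\<rho> g. \<rho> \<in> P2 \<Longrightarrow> min_J J < J \<rho> \<Longrightarrow> J \<rho> < r0 \<Longrightarrow> g \<in> subdiff l J \<rho> \<Longrightarrow>
        c * real_of_ereal (J \<rho> - min_J J) powr (1 - \<theta>) \<le> L2_norm \<rho> g"
    using LG unfolding Lojasiewicz_gradient_def by blast
  define \<kappa> where "\<kappa> = \<theta> * c / 4"
  have \<kappa>: "0 < \<kappa>" using \<theta> c by (simp add: \<kappa>_def)
  define \<psi> where "\<psi> \<mu> = (F \<mu> - Fmin) powr \<theta>" for \<mu>
  have psi_le: "F \<mu> \<le> F \<nu>" if "\<psi> \<mu> \<le> \<psi> \<nu>" "\<mu> \<in> dom_J J" "\<nu> \<in> dom_J J" for \<mu> \<nu>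
    using that Fmin_le[of \<mu>] Fmin_le[of \<nu>] \<theta>(1) powr_less_mono2[of \<theta> "F \<nu> - Fmin" "F \<mu> - Fmin"]
    by (force simp: \<psi>_def)
  \<comment> \<open>Along the sequence a decreasing \<psi> means a decreasing \<open>F\<close>;
    lower semicontinuity applied to each tail, with its first value as constant bound, compares the
    limit with every member.\<close>
  have complete: "\<exists>\<mu>\<in>dom_J J. (\<lambda>n. W2 (\<nu> n) \<mu>) \<longlonglongrightarrow> 0 \<and> (\<forall>n. \<psi> \<mu> \<le> \<psi> (\<nu> n))"
    if \<nu>: "\<And>n. \<nu> n \<in> dom_J J" and dec: "decseq (\<lambda>n. \<psi> (\<nu> n))" and sum: "summable (\<lambda>n. W2 (\<nu> n) (\<nu> (Suc n)))" for \<nu>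
  proof -
    obtain \<mu> where \<mu>: "\<mu> \<in> P2" "(\<lambda>n. W2 (\<nu> n) \<mu>) \<longlonglongrightarrow> 0"
      using W2_complete[of \<nu>] dom_P2[OF \<nu>] sum by blast
    have "\<mu> \<in> dom_J J \<and> F \<mu> \<le> F (\<nu> n)" for n
    proof -
      have "F (\<nu> (k + n)) \<le> F (\<nu> n)" for k using decseqD[OF dec, of n "k + n"] psi_le \<nu> by simp
      from lsc_seq[OF \<nu> \<mu>(1) LIMSEQ_ignore_initial_segment[OF \<mu>(2), of n] this tendsto_const] show ?thesis by simp
    qed
    then have "\<mu> \<in> dom_J J" "\<psi> \<mu> \<le> \<psi> (\<nu> n)" for n
      using Fmin_le[of \<mu>] \<theta> by (auto simp: \<psi>_def intro!: powr_mono2)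
    then show ?thesis using \<mu>(2) by blast
  qed
  \<comment> \<open>The constant of (LF) comes from raising the Ekeland estimate
    \<open>\<kappa> * W2 \<rho> y \<le> \<psi> \<rho>\<close> to the power
    \<open>1 / \<theta>\<close>.\<close>
  have "\<kappa> powr (1 / \<theta>) * W2_set \<rho> (Argmin J) powr (1 / \<theta>) \<le> real_of_ereal (J \<rho> - min_J J)"
    if \<rho>: "\<rho> \<in> P2" "min_J J < J \<rho>" "J \<rho> < r0" for \<rho>
  proof -
    have \<rho>d: "\<rho> \<in> dom_J J" using \<rho> by (auto simp: dom_J_def)
    obtain y where y: "y \<in> dom_J J" "\<psi> y + \<kappa> * W2 \<rho> y \<le> \<psi> \<rho>"
      "\<And>z. z \<in> dom_J J \<Longrightarrow> \<psi> z + \<kappa> * W2 y z \<le> \<psi> y \<Longrightarrow> W2 y z = 0"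
    proof (rule Ekeland_principle[where d = W2 and \<psi> = \<psi>, OF \<rho>d \<kappa>])
      show "0 \<le> \<psi> x" for x by (simp add: \<psi>_def)
    qed (auto intro: complete dom_P2 W2_self W2_triangle W2_nonneg)
    have Wy: "0 \<le> W2 \<rho> y" using \<rho>(1) dom_P2[OF y(1)] by simp
    have "F y = Fmin"
    proof (rule ccontr)
      assume "F y \<noteq> Fmin"
      then have "Fmin < F y" using Fmin_le[OF y(1)] by simp
      \<comment> \<open>The energy at the Ekeland point is at most that of \<rho>, so it stays below
        \<open>r0\<close>, where (LG) applies.\<close>
      moreover have "\<psi> y \<le> \<psi> \<rho>" using y(2) \<kappa> Wy mult_nonneg_nonneg[of \<kappa> "W2 \<rho> y"] by linarith
      then have "F y \<le> F \<rho>" using psi_le y(1) \<rho>d by blast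
      then have "J y < r0" using J_eq[OF y(1)] J_eq[OF \<rho>d] \<rho>(3) by (simp add: le_less_trans[of "ereal (F y)" "ereal (F \<rho>)"])
      ultimately obtain m where "m \<in> dom_J J" "0 < W2 y m" "\<psi> m + \<kappa> * W2 y m \<le> \<psi> y"
        using proximal_descent[OF conv \<theta> c LGc y(1)] unfolding \<psi>_def \<kappa>_def by blast
      with y(3) show False by force
    qed
    then have yA: "y \<in> Argmin J" using Argmin_iff[OF y(1)] by simp
    have AP: "\<eta> \<in> P2" if "\<eta> \<in> Argmin J" for \<eta> using that by (simp add: Argmin_def)
    have "W2_set \<rho> (Argmin J) \<le> W2 \<rho> y" unfolding W2_set_def
      by (rule cINF_lower[OF _ yA]) (use AP \<rho>(1) in \<open>auto intro!: bdd_belowI[of _ 0]\<close>)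
    then have "\<kappa> * W2_set \<rho> (Argmin J) \<le> \<kappa> * W2 \<rho> y" using \<kappa> by simp
    also have "\<dots> \<le> \<psi> \<rho>" using y(2) by (simp add: \<psi>_def add_increasing order_trans[rotated])
    finally have le: "\<kappa> * W2_set \<rho> (Argmin J) \<le> \<psi> \<rho>" .
    have W0: "0 \<le> W2_set \<rho> (Argmin J)" unfolding W2_set_def
      using Argmin_nonempty AP \<rho>(1) by (intro cINF_greatest) auto
    have "\<kappa> powr (1 / \<theta>) * W2_set \<rho> (Argmin J) powr (1 / \<theta>) = (\<kappa> * W2_set \<rho> (Argmin J)) powr (1 / \<theta>)"
      using \<kappa> W0 by (simp add: powr_mult)
    also have "\<dots> \<le> \<psi> \<rho> powr (1 / \<theta>)" using le \<kappa> W0 \<theta> by (intro powr_mono2) auto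
    also have "\<dots> = F \<rho> - Fmin" using \<theta> Fmin_le[OF \<rho>d] by (simp add: \<psi>_def powr_powr)
    also have "\<dots> = real_of_ereal (J \<rho> - min_J J)" using J_eq[OF \<rho>d] min_J_eq by simp
    finally show ?thesis .
  qed
  moreover have "0 < \<kappa> powr (1 / \<theta>)" using \<kappa> by simp
  ultimately show ?thesis unfolding Lojasiewicz_functional_def by blast
qed

text \<open>The subdifferential inequality is tested with a minimiser; for modulus 0 its quadratic
  term vanishes, and Cauchy-Schwarz on the optimal coupling produces the distance.\<close>

lemma subdiff_gap_le:
  assumes g: "g \<in> subdiff 0 J \<rho>" and \<rho>: "\<rho> \<in> P2" and \<eta>: "\<eta> \<in> Argmin J"
  shows "F \<rho> - Fmin \<le> L2_norm \<rho> g * W2 \<rho> \<eta>"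
proof -
  have \<eta>P: "\<eta> \<in> P2" and \<eta>d: "\<eta> \<in> dom_J J" using \<eta> Argmin_dom by (auto simp: Argmin_def)
  have \<rho>d: "\<rho> \<in> dom_J J" using g by (simp add: subdiff_def)
  obtain \<Psi> where \<Psi>: "\<Psi> \<in> opt_couplings \<rho> \<eta>"
    and le: "J \<eta> \<ge> J \<rho> + ereal (\<integral>p. g (fst p) \<bullet> (snd p - fst p) \<partial>\<Psi>)"
    using g \<eta>P unfolding subdiff_def by auto
  note C = opt_couplings_sub[OF \<Psi>]
  note c = couplings_distr[OF C] and q = couplings_sq_int[OF C \<rho> \<eta>P]
  have "sets \<rho> = sets borel" using \<rho> by (simp add: P2_iff)
  moreover have "g \<in> borel_measurable \<rho>" using g by (simp add: subdiff_def L2_fields_def)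
  ultimately have gb: "g \<in> borel_measurable borel" using measurable_cong_sets[OF _ refl] by blast
  have "sq_int \<rho> g" using g by (simp add: subdiff_def L2_fields_def sq_int_def)
  then have sg: "sq_int \<Psi> (\<lambda>p. g (fst p))" using sq_int_distr[OF c(5) gb] c(3) by simp
  have lg: "l2 \<Psi> (\<lambda>p. g (fst p)) = L2_norm \<rho> g" using l2_distr[OF c(5) gb] c(3) by (simp add: l2_def L2_norm_def)
  have "F \<rho> - Fmin \<le> - (\<integral>p. g (fst p) \<bullet> (snd p - fst p) \<partial>\<Psi>)"
    using le J_eq[OF \<rho>d] J_eq[OF \<eta>d] Argmin_iff[OF \<eta>d] \<eta> by simp
  also have "\<dots> \<le> l2 \<Psi> (\<lambda>p. g (fst p)) * l2 \<Psi> (\<lambda>p. snd p - fst p)"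
    using l2_Cauchy_Schwarz[OF sg sq_int_diff[OF q(2,1)]] by linarith
  also have "\<dots> = L2_norm \<rho> g * W2 \<rho> \<eta>"
    unfolding lg opt_couplings_W2[OF \<Psi>] by (simp add: l2_minus_commute[of \<Psi> fst])
  finally show ?thesis .
qed

lemma functional_imp_gradient:
  assumes \<theta>: "0 < \<theta>" "\<theta> \<le> 1" and LF: "Lojasiewicz_functional J r0 \<theta>"
  shows "Lojasiewicz_gradient 0 J r0 \<theta>"
proof -
  obtain c where c: "0 < c" and LFc: "\<And>\<rho>. \<rho> \<in> P2 \<Longrightarrow> min_J J < J \<rho> \<Longrightarrow> J \<rho> < r0 \<Longrightarrow>
        c * W2_set \<rho> (Argmin J) powr (1 / \<theta>) \<le> real_of_ereal (J \<rho> - min_J J)"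
    using LF unfolding Lojasiewicz_functional_def by blast
  \<comment> \<open>The constant is that of (LF) to the power \<theta>: (LF) becomes
    \<open>c powr \<theta> * s \<le> a powr \<theta>\<close>, and \<open>a \<le> N * s\<close>
    eliminates the distance \<open>s\<close>.\<close>
  have "c powr \<theta> * real_of_ereal (J \<rho> - min_J J) powr (1 - \<theta>) \<le> L2_norm \<rho> g"
    if \<rho>: "\<rho> \<in> P2" "min_J J < J \<rho>" "J \<rho> < r0" and g: "g \<in> subdiff 0 J \<rho>" for \<rho> g
  proof -
    have \<rho>d: "\<rho> \<in> dom_J J" using g by (simp add: subdiff_def)
    define a where "a = F \<rho> - Fmin"
    define N where "N = L2_norm \<rho> g"
    define s where "s = W2_set \<rho> (Argmin J)"
    have ra: "real_of_ereal (J \<rho> - min_J J) = a" using J_eq[OF \<rho>d] min_J_eq by (simp add: a_def)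
    have a: "0 < a" using \<rho>(2) J_eq[OF \<rho>d] min_J_eq by (simp add: a_def)
    have N0: "0 \<le> N" by (simp add: N_def L2_norm_def)
    have gap: "a \<le> N * W2 \<rho> \<eta>" if "\<eta> \<in> Argmin J" for \<eta>
      using subdiff_gap_le[OF g \<rho>(1) that] by (simp add: a_def N_def)
    then have "N \<noteq> 0" using a Argmin_nonempty by fastforce
    then have N: "0 < N" using N0 by simp
    \<comment> \<open>\<open>s\<close> is an infimum over the minimisers; after division by
      \<open>N\<close>, positive because the gap \<open>a\<close> is, all minimisers share the lower
      bound \<open>a / N\<close>, which therefore passes to the infimum.\<close>
    have "a / N \<le> s" unfolding s_def W2_set_def
      using Argmin_nonempty gap N by (intro cINF_greatest) (auto simp: pos_divide_le_eq mult.commute)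
    then have as: "a \<le> N * s" using N by (simp add: pos_divide_le_eq mult.commute)
    have s0: "0 < s" using \<open>a / N \<le> s\<close> a N by (smt (verit) divide_pos_pos)
    have "c * s powr (1 / \<theta>) \<le> a" using LFc[OF \<rho>] by (simp add: ra s_def)
    then have "(c * s powr (1 / \<theta>)) powr \<theta> \<le> a powr \<theta>" using c \<theta> by (intro powr_mono2) auto
    then have cs: "c powr \<theta> * s \<le> a powr \<theta>" using c s0 \<theta> by (simp add: powr_mult powr_powr)
    have "c powr \<theta> * a \<le> c powr \<theta> * (N * s)" using as by (intro mult_left_mono) auto
    also have "\<dots> \<le> N * a powr \<theta>" using mult_left_mono[OF cs N0] by (simp add: mult_ac)
    finally have "c powr \<theta> * a / a powr \<theta> \<le> N" using a by (simp add: pos_divide_le_eq)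
    then show ?thesis using a by (simp add: ra N_def powr_diff)
  qed
  moreover have "0 < c powr \<theta>" using c by simp
  ultimately show ?thesis unfolding Lojasiewicz_gradient_def by blast
qed

end

lemma convex_gg_iff_lambda_convex_gg_0: "convex_gg J \<longleftrightarrow> lambda_convex_gg 0 J"
  by (simp add: convex_gg_def lambda_convex_gg_def zero_ereal_def[symmetric])

theorem theorem1:
  fixes J :: "'a::euclidean_space measure \<Rightarrow> ereal" and r0 :: ereal and \<theta> :: real
  assumes "\<forall>\<mu>\<in>P2. J \<mu> \<noteq> -\<infinity>"
    and "proper_J J"
    and "W2_lsc J"
    and "Argmin J \<noteq> {}"
    and "min_J J < r0"
    and "0 < \<theta>" and "\<theta> \<le> 1"
  shows "(\<forall>l::real. lambda_convex_gg l J \<longrightarrow>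
            Lojasiewicz_gradient l J r0 \<theta> \<longrightarrow> Lojasiewicz_functional J r0 \<theta>)
       \<and> (convex_gg J \<longrightarrow>
            (Lojasiewicz_gradient 0 J r0 \<theta> \<longleftrightarrow> Lojasiewicz_functional J r0 \<theta>))"
proof -
  interpret W2_functional J
    by standard (use assms(1-4) in auto)
  show ?thesis
    using gradient_imp_functional[OF _ assms(6,7)] functional_imp_gradient[OF assms(6,7)]
      convex_gg_iff_lambda_convex_gg_0[of J] by blast
qed

end
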